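(* Consider the problem $$\min\ c(\vec d,\vec b)\quad\text{s.t.}\quad \sum_i (d_i+b_i)=D+B,\quad \sum_i b_i=B,\quad |\vec{\bar d}+\vec{\bar b}-\vec d-\vec b|_1/2\le z,\qquad (\vec d,\vec b)\in\mathbb Z^n\times\mathbb Z^n,$$ where $(\vec{\bar d},\vec{\bar b})$ is an allocation with $c(\vec{\bar d},\vec{\bar b})<\infty$ and $z\ge0$ is an integer. The scaling algorithm with operational constraints for this problem runs in time polynomial in $n$ and $\log(B+D)$.
   Context: **Costs.** Stations are indexed by $[n]=\{1,\dots,n\}$; $D,B$ are nonnegative integers, $B+D\ge1$. For a finite sequence $X=(X_1,\dots,X_s)\in\{\pm1\}^s$ ($X_t=1$: attempted bike return, $X_t=-1$: attempted rental) and integers $d,b\ge 0$ let $\delta_0=d$, $\delta_t=\max\{0,\min\{d+b,\delta_{t-1}-X_t\}\}$ and $$c^X(d,b)=|\{t:X_t=1,\ \delta_{t-1}=0\}|+|\{t:X_t=-1,\ \delta_{t-1}=d+b\}|.$$ Each station $i$ has a probability distribution $p_i$ on finite $\pm1$ sequences and integers $0\le l_i\le u_i$, and $c_i(d,b)=\mathbb E_{X\sim p_i}[c^X(d,b)]$ if $d,b\ge0$ and $l_i\le d+b\le u_i$, while $c_i(d,b)=\infty$ for all other $(d,b)\in\mathbb Z^2$. (One station may be a "depot" station, for which instead $c_i(d,b)=d+b-l_i$ on the same kind of domain and $\infty$ elsewhere.) The objective is $c(\vec d,\vec b)=\sum_i c_i(d_i,b_i)$. The functions $c_i$ are accessed through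 an evaluation oracle; running time counts oracle calls and elementary operations. **Allocations.** An allocation is a pair $(\vec d,\vec b)\in\mathbb Z^n\times\mathbb Z^n$ with $\sum_i(d_i+b_i)=D+B$ and $\sum_i b_i=B$. **Scaled dock-moves.** With unit vectors $e_i$, for a positive integer $\alpha$, stations $i\ne j$ and a station $h$, the dock-moves of $\alpha$ docks from $i$ to $j$ are: $o^\alpha_{ij}(\vec d,\vec b)=(\vec d-\alpha e_i+\alpha e_j,\vec b)$; $e^\alpha_{ij}(\vec d,\vec b)=(\vec d,\vec b-\alpha e_i+\alpha e_j)$; $E^\alpha_{ijh}(\vec d,\vec b)=(\vec d-\alpha e_i+\alpha e_h,\vec b+\alpha e_j-\alpha e_h)$; $O^\alpha_{ijh}(\vec d,\vec b)=(\vec d+\alpha e_j-\alpha e_h,\vec b-\alpha e_i+\alpha e_h)$. $N^\alpha(\vec d,\vec b)$ is the set of all allocations obtained from $(\vec d,\vec b)$ by one such transformation. A best dock-move of $\alpha$ docks from $i$ to $j$ is one of these (over the four types and all $h$) minimizing the resulting $c$. **Scaling algorithm with operational constraints.** Start with $(\vec d,\vec b)=(\vec{\bar d},\vec{\bar b})$. For $k=0,1,\dots,\lfloor\log_2(B+D)\rfloor+1$ (phase $k$), with $\alpha_k=2^{\lfloor\log_2(B+D)\rfloor+1-k}$ and $M=16n^6(n+4)\alpha_k$: (i) Bike step: repeatedly choose $i^\star$ maximizing $c_i(d_i,b_i)-c_i(d_i-\alpha_k,b_i+\alpha_k)$ and $j^\star$ maximizing $c_j(d_j,b_j)-c_j(d_j+\alpha_k,b_j-\alpha_k)$;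 if moving $\alpha_k$ bikes from $j^\star$ to $i^\star$ (i.e. $d_{i^\star}$ decreases and $b_{i^\star}$ increases by $\alpha_k$, $d_{j^\star}$ increases and $b_{j^\star}$ decreases by $\alpha_k$) strictly decreases $c_{i^\star}+c_{j^\star}$, do it; otherwise end the bike step. (ii) Subroutine: let $(\vec d^k,\vec b^k)$ be the current allocation, $\mathcal S^+=\{i:d^k_i+b^k_i\ge\bar d_i+\bar b_i\}$ and $\mathcal S^-=\{j:d^k_j+b^k_j<\bar d_j+\bar b_j\}$. While there exists $i\in\mathcal S^+$ with $d_i+b_i>\max\{d_i^k+b_i^k-M,\bar d_i+\bar b_i\}$: if there exists $j\in\mathcal S^-$ with $d_j+b_j<\min\{d_j^k+b_j^k+M,\bar d_j+\bar b_j\}$, carry out a best dock-move of $\alpha_k$ docks from such $i$ to such $j$; else pick $j\in\mathcal S^-$ with $d_j+b_j<\min\{d_j^k+b_j^k+nM,\bar d_j+\bar b_j\}$ and carry out a best dock-move of $\alpha_k$ docks from such $i$ to $j$. Then, while there exists $j\in\mathcal S^-$ with $d_j+b_j<\min\{d_j^k+b_j^k+M,\bar d_j+\bar b_j\}$: pick $i\in\mathcal S^+$ with $d_i+b_i>\max\{d_i^k+b_i^k-nM,\bar d_i+\bar b_i\}$ and carry out a best dock-move of $\alpha_k$ docks from $i$ to such $j$. (iii) Gradient-descent steps: let $(\vec d',\vec b')$ be a minimizer of $c$ over $N^{\alpha_k}(\vec d,\vec b)$; while $c(\vec d',\vec b')<c(\vec d,\vec b)$ and $|\vec{\bar d}+\vec{\bar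 b}-\vec d'-\vec b'|_1/2\le z$, replace $(\vec d,\vec b)$ by $(\vec d',\vec b')$ and recompute the minimizer. After the last phase return $(\vec d,\vec b)$. *)

theory Defs
  imports
    "HOL-Probability.Probability"
    "HOL-Computational_Algebra.Polynomial"
    "HOL-Library.Monad_Syntax"
begin

section \<open>Cost functions\<close>

text \<open>
  Stations are the elements of \<open>{1..n}\<close>; functions on stations are total on \<open>nat\<close> and only their
  values on \<open>{1..n}\<close> matter. The list element \<open>X ! t\<close> is the mathematical \<open>X\<^sub>t\<^sub>+\<^sub>1\<close>, and
  \<open>fill X d b t\<close> is \<open>\<delta>\<^sub>t\<close>.
\<close>

primrec fill :: "int list \<Rightarrow> int \<Rightarrow> int \<Rightarrow> nat \<Rightarrow> int" where
  "fill X d b 0 = d"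
| "fill X d b (Suc t) = max 0 (min (d + b) (fill X d b t - X ! t))"

definition sequence_cost :: "int list \<Rightarrow> int \<Rightarrow> int \<Rightarrow> nat" where
  "sequence_cost X d b =
     card {t. t < length X \<and> X ! t = 1 \<and> fill X d b t = 0} +
     card {t. t < length X \<and> X ! t = -1 \<and> fill X d b t = d + b}"

text \<open>
  The expectation is a Lebesgue integral in \<open>[0, \<infinity>]\<close>, since no integrability is assumed.
  \<open>depot = Some i\<close> makes \<open>i\<close> the depot station.
\<close>

definition station_cost ::
  "(nat \<Rightarrow> int list pmf) \<Rightarrow> (nat \<Rightarrow> nat) \<Rightarrow> (nat \<Rightarrow> nat) \<Rightarrow> nat option
     \<Rightarrow> nat \<Rightarrow> int \<Rightarrow> int \<Rightarrow> ereal" where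
  "station_cost p l u depot i d b =
     (if 0 \<le> d \<and> 0 \<le> b \<and> int (l i) \<le> d + b \<and> d + b \<le> int (u i)
      then if depot = Some i
           then ereal (real_of_int (d + b - int (l i)))
           else enn2ereal (\<integral>\<^sup>+ X. of_nat (sequence_cost X d b) \<partial>measure_pmf (p i))
      else \<infinity>)"

type_synonym alloc = "(nat \<Rightarrow> int) \<times> (nat \<Rightarrow> int)"

definition objective :: "nat \<Rightarrow> (nat \<Rightarrow> int \<Rightarrow> int \<Rightarrow> ereal) \<Rightarrow> alloc \<Rightarrow> ereal" where
  "objective n c a = (\<Sum>i\<in>{1..n}. c i (fst a i) (snd a i))"

definition is_allocation :: "nat \<Rightarrow> nat \<Rightarrow> nat \<Rightarrow> alloc \<Rightarrow> bool" where
  "is_allocation n D B a \<longleftrightarrow>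
     (\<Sum>i\<in>{1..n}. fst a i + snd a i) = int (D + B) \<and> (\<Sum>i\<in>{1..n}. snd a i) = int B"

section \<open>Dock-moves\<close>

definition unit_vec :: "nat \<Rightarrow> nat \<Rightarrow> int" where
  "unit_vec i = (\<lambda>k. if k = i then 1 else 0)"

text \<open>The four constructors are the moves \<open>o\<^sub>i\<^sub>j\<close>, \<open>e\<^sub>i\<^sub>j\<close>, \<open>E\<^sub>i\<^sub>j\<^sub>h\<close> and \<open>O\<^sub>i\<^sub>j\<^sub>h\<close>, in this order.\<close>

datatype dock_move =
    Empty_Move nat nat
  | Full_Move nat nat
  | Empty_Via nat nat nat
  | Full_Via nat nat nat

fun apply_move :: "int \<Rightarrow> dock_move \<Rightarrow> alloc \<Rightarrow> alloc" where
  "apply_move \<alpha> (Empty_Move i j) (d, b) =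
     (\<lambda>k. d k - \<alpha> * unit_vec i k + \<alpha> * unit_vec j k, b)"
| "apply_move \<alpha> (Full_Move i j) (d, b) =
     (d, \<lambda>k. b k - \<alpha> * unit_vec i k + \<alpha> * unit_vec j k)"
| "apply_move \<alpha> (Empty_Via i j h) (d, b) =
     (\<lambda>k. d k - \<alpha> * unit_vec i k + \<alpha> * unit_vec h k,
      \<lambda>k. b k + \<alpha> * unit_vec j k - \<alpha> * unit_vec h k)"
| "apply_move \<alpha> (Full_Via i j h) (d, b) =
     (\<lambda>k. d k + \<alpha> * unit_vec j k - \<alpha> * unit_vec h k,
      \<lambda>k. b k - \<alpha> * unit_vec i k + \<alpha> * unit_vec h k)"

fun bike_move :: "int \<Rightarrow> nat \<Rightarrow> nat \<Rightarrow> alloc \<Rightarrow> alloc" where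
  "bike_move \<alpha> i j (d, b) =
     (\<lambda>k. d k - \<alpha> * unit_vec i k + \<alpha> * unit_vec j k,
      \<lambda>k. b k + \<alpha> * unit_vec i k - \<alpha> * unit_vec j k)"

section \<open>Nondeterministic computations with a step count\<close>

text \<open>
  A loop-free program fragment is the set of its possible outcomes, each paired with the number of
  oracle calls and elementary operations performed. Nondeterminism is used only for choices that
  the algorithm leaves open: ties among optimal candidates, and ``pick some station with \<dots>''.
  An arithmetic operation, comparison or array update on numbers has unit cost.
\<close>

datatype 'a nd = ND (outcomes: "('a \<times> nat) set")

definition nd_bind :: "'a nd \<Rightarrow> ('a \<Rightarrow> 'b nd) \<Rightarrow> 'b nd" where
  "nd_bind m f = ND {(y, s + t) | x s y t. (x, s) \<in> outcomes m \<and> (y, t) \<in> outcomes (f x)}"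

adhoc_overloading Monad_Syntax.bind \<rightleftharpoons> nd_bind

definition ops :: "nat \<Rightarrow> 'a \<Rightarrow> 'a nd" where
  "ops m x = ND {(x, m)}"

abbreviation ret :: "'a \<Rightarrow> 'a nd" where
  "ret \<equiv> ops 0"

definition one_of :: "'a set \<Rightarrow> 'a nd" where
  "one_of S = ND ((\<lambda>x. (x, 0)) ` S)"

definition stuck :: "'a nd" where
  "stuck = ND {}"

text \<open>An arbitrary one of the best elements of a list (together with its value), by linear scan.\<close>

primrec scan_best ::
  "(ereal \<Rightarrow> ereal \<Rightarrow> bool) \<Rightarrow> ('a \<Rightarrow> ereal nd) \<Rightarrow> 'a list \<Rightarrow> ('a \<times> ereal) option nd" where
  "scan_best better f [] = ret None"
| "scan_best better f (x # xs) = do {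
     v \<leftarrow> f x;
     r \<leftarrow> scan_best better f xs;
     case r of
       None \<Rightarrow> ret (Some (x, v))
     | Some (y, w) \<Rightarrow> do {
         x_wins \<leftarrow> ops 1 (better v w);
         y_wins \<leftarrow> ops 1 (better w v);
         if x_wins then ret (Some (x, v))
         else if y_wins then ret (Some (y, w))
         else one_of {Some (x, v), Some (y, w)}
       }
   }"

abbreviation scan_min where "scan_min \<equiv> scan_best (<)"
abbreviation scan_max where "scan_max \<equiv> scan_best (>)"

primrec scan_filter :: "('a \<Rightarrow> bool nd) \<Rightarrow> 'a list \<Rightarrow> 'a list nd" where
  "scan_filter P [] = ret []"
| "scan_filter P (x # xs) = do {
     t \<leftarrow> P x;
     ys \<leftarrow> scan_filter P xs;
     ret (if t then x # ys else ys)
   }"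

definition pick :: "('a \<Rightarrow> bool nd) \<Rightarrow> 'a list \<Rightarrow> 'a option nd" where
  "pick P xs = do {
     ys \<leftarrow> scan_filter P xs;
     if ys = [] then ret None else one_of (Some ` set ys)
   }"

section \<open>The scaling algorithm with operational constraints\<close>

datatype location = Phase_Start | Bike_Step | Dock_Loop_1 | Dock_Loop_2 | Descent | Halted

text \<open>\<open>snapshot\<close> is the allocation \<open>(d\<^sup>k, b\<^sup>k)\<close> at the end of the bike step of the phase.\<close>

record state =
  loc :: location
  phase :: nat
  scale :: int
  bound :: int
  current :: alloc
  snapshot :: alloc

text \<open>
  The parameter \<open>c\<close> is the evaluation oracle. The algorithm receives nothing else about the
  station costs.
\<close>

locale scaling_algorithm =
  fixes n D B :: nat
    and c :: "nat \<Rightarrow> int \<Rightarrow> int \<Rightarrow> ereal"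
    and dbar bbar :: "nat \<Rightarrow> int"
    and z :: nat
begin

definition stations :: "nat list" where
  "stations = [1..<Suc n]"

definition moves_between :: "nat \<Rightarrow> nat \<Rightarrow> dock_move list" where
  "moves_between i j = Empty_Move i j # Full_Move i j #
     concat (map (\<lambda>h. [Empty_Via i j h, Full_Via i j h]) stations)"

definition all_moves :: "dock_move list" where
  "all_moves = concat (map (\<lambda>i. concat (map (moves_between i) (filter (\<lambda>j. j \<noteq> i) stations))) stations)"

definition last_phase :: nat where
  "last_phase = nat \<lfloor>log 2 (real (B + D))\<rfloor> + 1"

definition query :: "nat \<Rightarrow> int \<Rightarrow> int \<Rightarrow> ereal nd" where
  "query i d b = ops 1 (c i d b)"

primrec sum_costs :: "alloc \<Rightarrow> nat list \<Rightarrow> ereal nd" where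
  "sum_costs a [] = ret 0"
| "sum_costs a (i # is) = do {
     x \<leftarrow> query i (fst a i) (snd a i);
     y \<leftarrow> sum_costs a is;
     ops 1 (x + y)
   }"

definition eval_objective :: "alloc \<Rightarrow> ereal nd" where
  "eval_objective a = sum_costs a stations"

text \<open>A move changes at most four array entries, each by one addition or subtraction.\<close>

definition eval_move :: "int \<Rightarrow> alloc \<Rightarrow> dock_move \<Rightarrow> ereal nd" where
  "eval_move \<alpha> a m = do {
     a' \<leftarrow> ops 8 (apply_move \<alpha> m a);
     eval_objective a'
   }"

definition best_dock_move :: "nat \<Rightarrow> nat \<Rightarrow> state \<Rightarrow> state nd" where
  "best_dock_move i j s = do {
     r \<leftarrow> scan_min (eval_move (scale s) (current s)) (moves_between i j);
     case r of
       None \<Rightarrow> stuck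
     | Some (m, _) \<Rightarrow> ops 8 (s\<lparr>current := apply_move (scale s) m (current s)\<rparr>)
   }"

definition bike_gain :: "int \<Rightarrow> alloc \<Rightarrow> nat \<Rightarrow> ereal nd" where
  "bike_gain \<beta> a i = do {
     x \<leftarrow> query i (fst a i) (snd a i);
     d' \<leftarrow> ops 1 (fst a i - \<beta>);
     b' \<leftarrow> ops 1 (snd a i + \<beta>);
     y \<leftarrow> query i d' b';
     ops 1 (x - y)
   }"

text \<open>
  \<open>docks a i\<close> and \<open>docks0 i\<close> are \<open>d\<^sub>i + b\<^sub>i\<close> for a given and for the initial allocation. Testing
  membership in \<open>S\<^sup>+\<close> or \<open>S\<^sup>-\<close> together with the bound \<open>radius\<close> takes 3 additions for the sums,
  one addition or subtraction, one maximum or minimum, 2 comparisons and one conjunction.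
\<close>

definition docks :: "alloc \<Rightarrow> nat \<Rightarrow> int" where
  "docks a i = fst a i + snd a i"

definition docks0 :: "nat \<Rightarrow> int" where
  "docks0 i = dbar i + bbar i"

definition surplus_station :: "state \<Rightarrow> int \<Rightarrow> nat \<Rightarrow> bool nd" where
  "surplus_station s radius i = ops 8
     (docks (snapshot s) i \<ge> docks0 i \<and>
      docks (current s) i > max (docks (snapshot s) i - radius) (docks0 i))"

definition deficit_station :: "state \<Rightarrow> int \<Rightarrow> nat \<Rightarrow> bool nd" where
  "deficit_station s radius j = ops 8
     (docks (snapshot s) j < docks0 j \<and>
      docks (current s) j < min (docks (snapshot s) j + radius) (docks0 j))"

definition dock_distance :: "alloc \<Rightarrow> int" where
  "dock_distance a = (\<Sum>i\<in>{1..n}. \<bar>docks0 i - docks a i\<bar>)"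

text \<open>
  The charge \<open>3 * (last_phase + 1)\<close> covers obtaining \<open>\<alpha>\<^sub>k\<close> by doubling 1 until it exceeds \<open>B + D\<close>
  and then halving \<open>k\<close> times; the charge 9 is for the multiplications and the addition in \<open>M\<close>.
\<close>

definition start_phase :: "state \<Rightarrow> state nd" where
  "start_phase s = do {
     continue \<leftarrow> ops 1 (phase s \<le> last_phase);
     if continue then do {
       \<alpha> \<leftarrow> ops (3 * (last_phase + 1)) (2 ^ (last_phase - phase s));
       M \<leftarrow> ops 9 (16 * int n ^ 6 * (int n + 4) * \<alpha>);
       ret (s\<lparr>loc := Bike_Step, scale := \<alpha>, bound := M\<rparr>)
     }
     else ret (s\<lparr>loc := Halted\<rparr>)
   }"

definition end_bike_step :: "state \<Rightarrow> state nd" where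
  "end_bike_step s = ops (2 * n) (s\<lparr>loc := Dock_Loop_1, snapshot := current s\<rparr>)"

definition bike_step :: "state \<Rightarrow> state nd" where
  "bike_step s = do {
     let a = current s;
     ri \<leftarrow> scan_max (bike_gain (scale s) a) stations;
     rj \<leftarrow> scan_max (bike_gain (- scale s) a) stations;
     case (ri, rj) of
       (Some (i, _), Some (j, _)) \<Rightarrow> do {
         a' \<leftarrow> ops 8 (bike_move (scale s) i j a);
         old \<leftarrow> sum_costs a [i, j];
         new \<leftarrow> sum_costs a' [i, j];
         decreases \<leftarrow> ops 1 (new < old);
         if decreases then ret (s\<lparr>current := a'\<rparr>) else end_bike_step s
       }
     | _ \<Rightarrow> end_bike_step s
   }"

definition dock_loop_1 :: "state \<Rightarrow> state nd" where
  "dock_loop_1 s = do {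
     ri \<leftarrow> pick (surplus_station s (bound s)) stations;
     case ri of
       None \<Rightarrow> ret (s\<lparr>loc := Dock_Loop_2\<rparr>)
     | Some i \<Rightarrow> do {
         rj \<leftarrow> pick (deficit_station s (bound s)) stations;
         case rj of
           Some j \<Rightarrow> best_dock_move i j s
         | None \<Rightarrow> do {
             radius \<leftarrow> ops 1 (int n * bound s);
             rj' \<leftarrow> pick (deficit_station s radius) stations;
             case rj' of
               Some j \<Rightarrow> best_dock_move i j s
             | None \<Rightarrow> stuck
           }
       }
   }"

definition dock_loop_2 :: "state \<Rightarrow> state nd" where
  "dock_loop_2 s = do {
     rj \<leftarrow> pick (deficit_station s (bound s)) stations;
     case rj of
       None \<Rightarrow> ret (s\<lparr>loc := Descent\<rparr>)
     | Some j \<Rightarrow> do {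
         radius \<leftarrow> ops 1 (int n * bound s);
         ri \<leftarrow> pick (surplus_station s radius) stations;
         case ri of
           Some i \<Rightarrow> best_dock_move i j s
         | None \<Rightarrow> stuck
       }
   }"

text \<open>
  The minimization over \<open>N\<^sup>\<alpha>\<close> ranges over the moves generating it. With a single station there is
  no move, and the phase ends.
\<close>

definition descent_step :: "state \<Rightarrow> state nd" where
  "descent_step s = do {
     r \<leftarrow> scan_min (eval_move (scale s) (current s)) all_moves;
     let next_phase = ops 1 (s\<lparr>loc := Phase_Start, phase := phase s + 1\<rparr>);
     case r of
       None \<Rightarrow> next_phase
     | Some (m, new) \<Rightarrow> do {
         old \<leftarrow> eval_objective (current s);
         a' \<leftarrow> ops 8 (apply_move (scale s) m (current s));
         dist \<leftarrow> ops (5 * n) (dock_distance a');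
         continue \<leftarrow> ops 4 (new < old \<and> real_of_int dist / 2 \<le> real z);
         if continue then ret (s\<lparr>current := a'\<rparr>) else next_phase
       }
   }"

fun advance :: "state \<Rightarrow> state nd" where
  "advance s = (case loc s of
     Phase_Start \<Rightarrow> start_phase s
   | Bike_Step \<Rightarrow> bike_step s
   | Dock_Loop_1 \<Rightarrow> dock_loop_1 s
   | Dock_Loop_2 \<Rightarrow> dock_loop_2 s
   | Descent \<Rightarrow> descent_step s
   | Halted \<Rightarrow> stuck)"

text \<open>The fields \<open>scale\<close>, \<open>bound\<close>, \<open>snapshot\<close> are overwritten before they are first read.\<close>

definition initial :: state where
  "initial = \<lparr>loc = Phase_Start, phase = 0, scale = 0, bound = 0,
     current = (dbar, bbar), snapshot = (dbar, bbar)\<rparr>"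

text \<open>
  \<open>reaches T s\<close>: some (partial) execution arrives in \<open>s\<close> with running time \<open>T\<close>. The initial charge
  is for copying the input allocation, and every loop iteration is charged one extra operation
  for the control transfer. Hence a bound on all such \<open>T\<close> rules out infinite executions.
\<close>

inductive reaches :: "nat \<Rightarrow> state \<Rightarrow> bool" where
  start: "reaches (2 * n) initial"
| step: "reaches T s \<Longrightarrow> (s', t) \<in> outcomes (advance s) \<Longrightarrow> reaches (Suc (T + t)) s'"

text \<open>Every execution, however ties are broken, halts regularly with running time at most \<open>tmax\<close>.\<close>

definition runs_within :: "real \<Rightarrow> bool" where
  "runs_within tmax \<longleftrightarrow>
     (\<forall>T s. reaches T s \<longrightarrow> real T \<le> tmax \<and> (loc s = Halted \<or> outcomes (advance s) \<noteq> {}))"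

end

text \<open>Evaluation of a polynomial in two variables, given as a polynomial with polynomial coefficients.\<close>

definition poly2 :: "real poly poly \<Rightarrow> real \<Rightarrow> real \<Rightarrow> real" where
  "poly2 P x y = poly (poly P [:x:]) y"

end

theory Submission
  imports Defs
begin

text \<open>
  There are about \<open>log 2 (B + D)\<close> phases, and one loop iteration takes a number of operations that is
  polynomial in \<open>n\<close>. So the theorem says that each loop of a phase ends after a number of iterations
  polynomial in \<open>n\<close>, and that it is never stuck. For the rollback loops the number is built into their
  radius; the point is to bound the bike step and the gradient descent.

  Within a phase, positions are measured relative to the initial allocation and in units of the step
  length. The cost of a station is then a multimodular function of its empty and full docks
  (\<open>cost_shape_sequence_cost\<close>, \<open>rescaled_station_cost\<close>). The change from one allocation to another
  consists of circuits, which are exchanges of a bike between two stations and dock-moves, and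
  multimodularity means that a circuit of the change can be applied to the first allocation and
  undone at the second one without raising the total cost (\<open>F_exchange\<close>, \<open>dock_move_between\<close>). Hence
  the minimum over all positions of the bikes is an M-convex function of the numbers of docks
  (\<open>M_convex_dock_cost\<close>), and a best dock-move from a bike-optimal allocation is bike-optimal again and
  realizes a transfer of a dock for this function (\<open>best_move_bike_optimal\<close>).

  Steepest descent on an M-convex function comes one unit closer to a nearest minimizer with every step
  (\<open>minimum_beyond_transfer\<close>), so the number of steps is bounded by a distance. For the bike step,
  and for a descent that the bound \<open>z\<close> does not stop, this distance is small by proximity: an optimum
  for the doubled step length has an optimum for the present one nearby, since otherwise some
  circuit would fit twice between the two (\<open>proximity\<close>, \<open>bike_proximity\<close>).

  The bound \<open>z\<close> acts as a Lagrange multiplier. The minimizers of the cost plus a multiple of the number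
  of moved docks form a path on which each steepest step moves one more dock
  (\<open>best_transfer_from_penalized_min\<close>), and a phase ends on this path, either at a minimizer of the cost
  or where one more moved dock is forbidden (\<open>phase_opt\<close>). By proximity the path of the next phase
  passes nearby, within the bound (\<open>near_path_from_coarse\<close>). The rollback is longer than that distance, so
  it ends between the initial allocation and a point of the path (\<open>descending_init\<close>). From there each
  steepest step leads towards that point and, unless the target is a minimizer of the cost, moves
  one more dock (\<open>best_transfer_towards_penalized_min\<close>). The number of moved docks is bounded by \<open>z\<close> and was
  close to this bound before, so few steps remain, and they end on the path again (\<open>descending_step\<close>).
\<close>

section \<open>M-convex minimization on dock vectors\<close>

definition transfer :: "nat \<Rightarrow> nat \<Rightarrow> (nat \<Rightarrow> int) \<Rightarrow> nat \<Rightarrow> int" where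
  "transfer i j x = (\<lambda>k. x k - unit_vec i k + unit_vec j k)"

definition dist1 :: "nat set \<Rightarrow> (nat \<Rightarrow> int) \<Rightarrow> (nat \<Rightarrow> int) \<Rightarrow> int" where
  "dist1 V x y = (\<Sum>k\<in>V. \<bar>x k - y k\<bar>)"

definition norm1 :: "nat set \<Rightarrow> (nat \<Rightarrow> int) \<Rightarrow> int" where
  "norm1 V x = (\<Sum>k\<in>V. \<bar>x k\<bar>)"

text \<open>A part \<open>a\<close> of a signed change \<open>t\<close> that neither overshoots nor goes the wrong way.\<close>

definition conforms :: "int \<Rightarrow> int \<Rightarrow> bool" where
  "conforms a t \<longleftrightarrow> 0 \<le> a \<and> a \<le> t \<or> t \<le> a \<and> a \<le> 0"

lemma transfer_apply:
  "i \<noteq> j \<Longrightarrow> transfer i j x k = (if k = i then x i - 1 else if k = j then x j + 1 else x k)"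
  by (simp add: transfer_def unit_vec_def)

lemma transfer_self [simp]: "transfer i i x = x"
  by (simp add: transfer_def)

lemma sum_transfer:
  fixes h :: "nat \<Rightarrow> int \<Rightarrow> int"
  assumes "finite V" "i \<in> V" "j \<in> V" "i \<noteq> j"
  shows "(\<Sum>k\<in>V. h k (transfer i j x k)) =
    (\<Sum>k\<in>V. h k (x k)) + (h i (x i - 1) - h i (x i)) + (h j (x j + 1) - h j (x j))"
proof -
  have V: "V = insert i (insert j (V - {i, j}))" "finite (V - {i, j})"
    using assms by auto
  have *: "(\<Sum>k\<in>V. f k) = f i + (f j + (\<Sum>k\<in>V - {i, j}. f k))" for f :: "nat \<Rightarrow> int"
    using assms(4) V(2) by (subst V(1)) simp
  have "(\<Sum>k\<in>V - {i, j}. h k (transfer i j x k)) = (\<Sum>k\<in>V - {i, j}. h k (x k))"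
    by (rule sum.cong) (auto simp: transfer_apply[OF assms(4)])
  then show ?thesis
    using assms(4) by (simp add: * transfer_apply[OF assms(4)])
qed

lemma norm1_transfer:
  assumes "finite V" "i \<in> V" "j \<in> V" "i \<noteq> j"
  shows "norm1 V (transfer i j x) =
    norm1 V x + (if x i > 0 then - 1 else 1) + (if x j < 0 then - 1 else 1)"
  unfolding norm1_def using sum_transfer[OF assms, of "\<lambda>k t. \<bar>t\<bar>" x] by auto

lemma dist1_transfer:
  assumes "finite V" "i \<in> V" "j \<in> V" "i \<noteq> j"
  shows "dist1 V x (transfer i j y) =
    dist1 V x y + (if y i > x i then - 1 else 1) + (if y j < x j then - 1 else 1)"
  unfolding dist1_def using sum_transfer[OF assms, of "\<lambda>k t. \<bar>x k - t\<bar>" y] by auto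

lemma dist1_commute: "dist1 V x y = dist1 V y x"
  by (simp add: dist1_def abs_minus_commute)

lemma dist1_nonneg: "0 \<le> dist1 V x y"
  by (simp add: dist1_def sum_nonneg)

lemma norm1_nonneg: "0 \<le> norm1 V x"
  by (simp add: norm1_def sum_nonneg)

lemma dist1_triangle: "dist1 V x z \<le> dist1 V x y + dist1 V y z"
  unfolding dist1_def sum.distrib[symmetric] by (rule sum_mono) linarith

lemma norm1_triangle: "norm1 V x \<le> norm1 V y + dist1 V x y"
  unfolding dist1_def norm1_def sum.distrib[symmetric] by (rule sum_mono) linarith

lemma norm1_eq_0: "finite V \<Longrightarrow> norm1 V x = 0 \<longleftrightarrow> (\<forall>k\<in>V. x k = 0)"
  unfolding norm1_def by (subst sum_nonneg_eq_0_iff) auto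

lemma norm1_conforms:
  assumes "\<forall>k\<in>V. conforms (w k) (m k)"
  shows "norm1 V m = norm1 V w + dist1 V w m"
  unfolding norm1_def dist1_def sum.distrib[symmetric]
  by (rule sum.cong) (use assms in \<open>auto simp: conforms_def\<close>)

lemma ereal_add_le_cancel:
  fixes a b c d :: ereal
  assumes "a + b \<le> c + d" "d \<le> b" "0 \<le> a" "0 \<le> d" "c < \<infinity>" "d < \<infinity>" "0 \<le> c"
  shows "a \<le> c"
  using assms by (cases a; cases b; cases c; cases d) auto

lemma ereal_shift_le_iff:
  "a + ereal (r * of_int m) \<le> b + ereal (r * of_int m') \<longleftrightarrow>
    a \<le> b + ereal (r * of_int (m' - m))"
  by (cases a; cases b) (auto simp: algebra_simps)

text \<open>
  Vectors are functions on all naturals, of which only the coordinates in \<open>V\<close> matter. Boundedness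
  stands for a finite effective domain, so that minimizers exist.
\<close>

locale M_convex =
  fixes V :: "nat set" and g :: "(nat \<Rightarrow> int) \<Rightarrow> ereal"
  assumes finite_V: "finite V"
    and nonneg: "0 \<le> g x"
    and cong: "(\<And>k. k \<in> V \<Longrightarrow> x k = y k) \<Longrightarrow> g x = g y"
    and bounded: "\<exists>K. \<forall>x. g x < \<infinity> \<longrightarrow> (\<forall>k\<in>V. \<bar>x k\<bar> \<le> K)"
    and exchange: "\<lbrakk>g x < \<infinity>; g y < \<infinity>; i \<in> V; y i < x i\<rbrakk> \<Longrightarrow>
      \<exists>j\<in>V. x j < y j \<and> g (transfer i j x) + g (transfer j i y) \<le> g x + g y"

definition is_min :: "('a \<Rightarrow> ereal) \<Rightarrow> 'a \<Rightarrow> bool" where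
  "is_min g x \<longleftrightarrow> g x < \<infinity> \<and> (\<forall>y. g x \<le> g y)"

text \<open>The rule of steepest descent, for any way of breaking ties.\<close>

definition best_transfer :: "nat set \<Rightarrow> ((nat \<Rightarrow> int) \<Rightarrow> ereal) \<Rightarrow> (nat \<Rightarrow> int) \<Rightarrow> nat \<Rightarrow> nat \<Rightarrow> bool" where
  "best_transfer V g x i j \<longleftrightarrow> i \<in> V \<and> j \<in> V \<and> i \<noteq> j \<and>
     (\<forall>a\<in>V. \<forall>b\<in>V. a \<noteq> b \<longrightarrow> g (transfer i j x) \<le> g (transfer a b x))"

lemma nearest_exists:
  assumes "P y"
  shows "\<exists>y0. P y0 \<and> (\<forall>y. P y \<longrightarrow> dist1 V x y0 \<le> dist1 V x y)"
proof -
  obtain y0 where "P y0" "\<forall>y. P y \<longrightarrow> nat (dist1 V x y0) \<le> nat (dist1 V x y)"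
    using ex_has_least_nat[of P y "\<lambda>y. nat (dist1 V x y)"] assms by auto
  then show ?thesis by (intro exI[of _ y0]) (auto simp: nat_le_eq_zle dist1_nonneg)
qed

text \<open>
  Only finitely many values are below infinity, as these are values at integral points of a box.
\<close>

lemma attains_minimum:
  fixes g :: "(nat \<Rightarrow> int) \<Rightarrow> ereal"
  assumes "finite V" and cong: "\<And>x y. (\<And>k. k \<in> V \<Longrightarrow> x k = y k) \<Longrightarrow> g x = g y"
    and bounded: "\<And>x. g x < \<infinity> \<Longrightarrow> \<forall>k\<in>V. \<bar>x k\<bar> \<le> K" and S: "S \<noteq> {}"
  shows "\<exists>x\<in>S. \<forall>y\<in>S. g x \<le> g y"
proof -
  let ?T = "PiE V (\<lambda>_. {-K..K})"
  have "g ` S \<subseteq> insert \<infinity> (g ` ?T)"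
  proof
    fix v assume "v \<in> g ` S"
    then obtain x where x: "v = g x" by auto
    have "g (restrict x V) = g x" by (rule cong) simp
    moreover have "restrict x V \<in> ?T" if "g x < \<infinity>"
    proof (rule PiE_I)
      fix k assume "k \<in> V"
      then have "\<bar>x k\<bar> \<le> K" using bounded[OF that] by blast
      then show "restrict x V k \<in> {-K..K}" using \<open>k \<in> V\<close> by auto
    qed simp
    ultimately show "v \<in> insert \<infinity> (g ` ?T)"
      using x by (metis ereal_infty_less(1) image_eqI insert_iff)
  qed
  moreover have "finite ?T" using assms(1) by (auto intro: finite_PiE)
  ultimately have fin: "finite (g ` S)" by (meson finite.insertI finite_imageI finite_subset)
  then have "Min (g ` S) \<in> g ` S" using S by (auto intro: Min_in)
  then obtain x where "x \<in> S" "g x = Min (g ` S)" by auto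
  then have "g x \<le> g y" if "y \<in> S" for y using fin that by simp
  then show ?thesis using \<open>x \<in> S\<close> by blast
qed

context M_convex
begin

lemma minimum_exists:
  assumes "g x < \<infinity>"
  obtains m where "is_min g m"
proof -
  from bounded obtain K where K: "\<forall>x. g x < \<infinity> \<longrightarrow> (\<forall>k\<in>V. \<bar>x k\<bar> \<le> K)" by blast
  have "\<exists>m\<in>UNIV. \<forall>y\<in>UNIV. g m \<le> g y"
  proof (rule attains_minimum[OF finite_V])
    show "g y < \<infinity> \<Longrightarrow> \<forall>k\<in>V. \<bar>y k\<bar> \<le> K" for y using K by blast
  qed (rule cong, simp_all)
  then obtain m where m: "\<And>y. g m \<le> g y" by blast
  then have "is_min g m" unfolding is_min_def using le_less_trans[OF m assms] by blast
  then show ?thesis by (rule that)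
qed

lemma exchange_up:
  assumes "g x < \<infinity>" "g y < \<infinity>" "i \<in> V" "x i < y i"
  shows "\<exists>j\<in>V. y j < x j \<and> g (transfer j i x) + g (transfer i j y) \<le> g x + g y"
  using exchange[OF assms(2,1,3,4)] by (simp add: add.commute)

text \<open>If \<open>x\<close> exceeds \<open>y\<close> nowhere, the pair comes from the exchange that starts at \<open>y\<close>.\<close>

lemma exchange_pair:
  assumes "g x < \<infinity>" "g y < \<infinity>" "\<not> (\<forall>k\<in>V. x k = y k)"
  obtains i j where "i \<in> V" "j \<in> V" "y i < x i" "x j < y j"
    "g (transfer i j x) + g (transfer j i y) \<le> g x + g y"
proof -
  from assms(3) obtain k where k: "k \<in> V" "x k \<noteq> y k" by auto
  show thesis
  proof (cases "y k < x k")
    case True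
    then show thesis using exchange[OF assms(1,2) k(1)] that k(1) by blast
  next
    case False
    then show thesis using exchange_up[OF assms(1,2) k(1)] that k by force
  qed
qed

text \<open>
  An exchange with a nearest minimizer is a unit transfer at \<open>x\<close>, which does not help, and so gives a
  minimizer that is nearer.
\<close>

lemma local_min_imp_is_min:
  assumes fin: "g x < \<infinity>"
    and loc: "\<And>i j. i \<in> V \<Longrightarrow> j \<in> V \<Longrightarrow> i \<noteq> j \<Longrightarrow> g x \<le> g (transfer i j x)"
  shows "is_min g x"
proof -
  obtain m1 where m1: "is_min g m1" using minimum_exists[OF fin] .
  obtain m where m: "is_min g m" and near: "\<And>y. is_min g y \<Longrightarrow> dist1 V x m \<le> dist1 V x y"
    using nearest_exists[of "is_min g", OF m1, of V x] by blast
  have mfin: "g m < \<infinity>" using m by (simp add: is_min_def)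
  show ?thesis
  proof (cases "\<forall>k\<in>V. x k = m k")
    case True
    then show ?thesis using m cong[of x m] by (auto simp: is_min_def)
  next
    case False
    obtain i j where ij: "i \<in> V" "j \<in> V" "m i < x i" "x j < m j"
      and le: "g (transfer i j x) + g (transfer j i m) \<le> g x + g m"
      using exchange_pair[OF fin mfin False] .
    then have ne: "i \<noteq> j" by auto
    have "g (transfer j i m) \<le> g m"
    proof (rule ereal_add_le_cancel)
      show "g (transfer j i m) + g (transfer i j x) \<le> g m + g x"
        using le by (simp add: add.commute)
      show "g x \<le> g (transfer i j x)" using loc ij ne by blast
    qed (fact nonneg fin mfin)+
    then have "is_min g (transfer j i m)"
      using m by (auto simp: is_min_def intro: order_trans)
    then have "dist1 V x m \<le> dist1 V x (transfer j i m)" by (rule near)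
    then show ?thesis
      using dist1_transfer[OF finite_V ij(2,1), of x m] ne ij by simp
  qed
qed

text \<open>
  Why steepest descent heads for a nearest minimizer. Let \<open>m\<close> be a minimizer nearest to \<open>w\<close>, and let
  \<open>w'\<close> arise from \<open>w\<close> by the transfer from \<open>i\<close> to \<open>j\<close>. If \<open>m\<close> has not lost at \<open>i\<close>, the exchange of \<open>m\<close> and
  \<open>w'\<close> at \<open>i\<close> turns \<open>w'\<close> into the result of a competing transfer, from some \<open>k\<close> to \<open>j\<close>. If that is no
  better than \<open>w'\<close>, the exchanged copy of \<open>m\<close> is a minimizer as well; it is no farther from \<open>w\<close>, and it has
  lost at \<open>i\<close>. The same works for a gain at \<open>j\<close>. The predicate \<open>P\<close> restricts the argument to some of the
  minimizers; the two hypotheses say that no competitor is better and that \<open>P\<close> is inherited.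
\<close>

lemma minimum_beyond_transfer:
  assumes fin: "g w < \<infinity>" and less: "g (transfer i j w) < g w" and ij: "i \<in> V" "j \<in> V" "i \<noteq> j"
    and P: "\<And>y. P y \<Longrightarrow> is_min g y" and m: "P m"
    and lose: "\<And>y k. \<lbrakk>P y; k \<in> V; k \<noteq> i; k \<noteq> j; y k < w k; w i \<le> y i; g (transfer k j w) \<le> g (transfer i j w)\<rbrakk>
      \<Longrightarrow> g (transfer i j w) \<le> g (transfer k j w) \<and> (is_min g (transfer i k y) \<longrightarrow> P (transfer i k y))"
    and gain: "\<And>y k. \<lbrakk>P y; k \<in> V; k \<noteq> i; k \<noteq> j; w k < y k; y j \<le> w j; g (transfer i k w) \<le> g (transfer i j w)\<rbrakk>
      \<Longrightarrow> g (transfer i j w) \<le> g (transfer i k w) \<and> (is_min g (transfer k j y) \<longrightarrow> P (transfer k j y))"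
  shows "\<exists>y. P y \<and> y i < w i \<and> w j < y j \<and> dist1 V w y \<le> dist1 V w m"
proof -
  let ?w' = "transfer i j w"
  have fin': "g ?w' < \<infinity>" using less fin by (rule less_trans)
  obtain m0 where m0: "P m0" and near: "\<And>y. P y \<Longrightarrow> dist1 V w m0 \<le> dist1 V w y"
    using nearest_exists[of P, OF m, of V w] by blast
  have min_le: "g y \<le> g x" and min_fin: "g y < \<infinity>" if "P y" for x y
    using P[OF that] by (auto simp: is_min_def)
  have min_trans: "is_min g x" if "P y" "g x \<le> g y" for x y
    using P[OF that(1)] that(2) by (auto simp: is_min_def intro: order_trans)
  have "\<exists>y. P y \<and> y i < w i \<and> dist1 V w y = dist1 V w m0"
  proof (cases "m0 i < w i")
    case True
    then show ?thesis using m0 by auto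
  next
    case False
    have lt: "?w' i < m0 i" using False ij(3) by (simp add: transfer_apply)
    obtain k where k: "k \<in> V" "m0 k < ?w' k"
      and le: "g (transfer i k m0) + g (transfer k i ?w') \<le> g m0 + g ?w'"
      using exchange[OF min_fin[OF m0] fin' ij(1) lt] by auto
    have ki: "k \<noteq> i" using k(2) lt by auto
    have eq: "transfer k i ?w' = (if k = j then w else transfer k j w)" by (auto simp: transfer_def)
    have le': "g (transfer k i ?w') \<le> g ?w'"
      by (rule ereal_add_le_cancel[OF _ min_le[OF m0]])
        (use le in \<open>simp add: add.commute\<close>, (fact nonneg min_fin[OF m0] fin')+)
    have kj: "k \<noteq> j" using le' less eq by auto
    have k': "m0 k < w k" using k(2) ki kj by (simp add: transfer_apply ij(3))
    have "g (transfer k j w) \<le> g ?w'" using le' eq kj by simp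
    note * = lose[OF m0 k(1) ki kj k' _ this]
    have "g (transfer i k m0) \<le> g m0"
      by (rule ereal_add_le_cancel[OF le]) (use * False eq kj in simp, (fact nonneg min_fin[OF m0] fin')+)
    then have P': "P (transfer i k m0)" using * False min_trans[OF m0] by simp
    have "dist1 V w (transfer i k m0) = dist1 V w m0 + (if m0 i > w i then - 2 else 0)"
      using dist1_transfer[OF finite_V ij(1) k(1) ki[symmetric], of w m0] k' by simp
    then have "m0 i = w i" "dist1 V w (transfer i k m0) = dist1 V w m0"
      using near[OF P'] False by (auto split: if_splits)
    then show ?thesis using P' ki by (intro exI[of _ "transfer i k m0"]) (simp add: transfer_apply)
  qed
  then obtain y where y: "P y" "y i < w i" "dist1 V w y = dist1 V w m0" by auto
  show ?thesis
  proof (cases "w j < y j")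
    case True
    then show ?thesis using y near[OF m] by auto
  next
    case False
    have lt: "y j < ?w' j" using False ij(3) by (simp add: transfer_apply)
    obtain k where k: "k \<in> V" "?w' k < y k"
      and le: "g (transfer j k ?w') + g (transfer k j y) \<le> g ?w' + g y"
      using exchange[OF fin' min_fin[OF y(1)] ij(2) lt] by auto
    have ki: "k \<noteq> i" "k \<noteq> j" using k(2) y(2) lt ij(3) by (auto simp: transfer_apply)
    have eq: "transfer j k ?w' = transfer i k w" by (auto simp: transfer_def)
    have le': "g (transfer i k w) \<le> g ?w'"
      unfolding eq[symmetric]
      by (rule ereal_add_le_cancel[OF le min_le[OF y(1)]]) (fact nonneg min_fin[OF y(1)] fin')+
    have k': "w k < y k" using k(2) ki by (simp add: transfer_apply ij(3))
    note * = gain[OF y(1) k(1) ki k' _ le']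
    have "g (transfer k j y) \<le> g y"
      by (rule ereal_add_le_cancel[of _ "g (transfer j k ?w')" _ "g ?w'"])
        (use le in \<open>simp add: add.commute\<close>, use * False eq in simp, (fact nonneg min_fin[OF y(1)] fin')+)
    then have P': "P (transfer k j y)" using * False min_trans[OF y(1)] by simp
    have "dist1 V w (transfer k j y) = dist1 V w y + (if y j < w j then - 2 else 0)"
      using dist1_transfer[OF finite_V k(1) ij(2) ki(2), of w y] k' by simp
    then have "y j = w j" "dist1 V w (transfer k j y) = dist1 V w y"
      using near[OF P'] y(3) False by (auto split: if_splits)
    then show ?thesis using P' y ki ij(3) near[OF m]
      by (intro exI[of _ "transfer k j y"]) (auto simp: transfer_apply)
  qed
qed

lemma best_transfer_approaches_minimum:
  assumes fin: "g x < \<infinity>" and notmin: "\<not> is_min g x" and best: "best_transfer V g x i j"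
    and m: "is_min g m"
  shows "\<exists>m'. is_min g m' \<and> dist1 V (transfer i j x) m' + 2 \<le> dist1 V x m"
proof -
  let ?x' = "transfer i j x"
  have ij: "i \<in> V" "j \<in> V" "i \<noteq> j"
    and steep: "\<And>a b. a \<in> V \<Longrightarrow> b \<in> V \<Longrightarrow> a \<noteq> b \<Longrightarrow> g ?x' \<le> g (transfer a b x)"
    using best by (auto simp: best_transfer_def)
  have less: "g ?x' < g x"
    using local_min_imp_is_min[OF fin] notmin steep by (meson not_le order_trans)
  have "\<exists>y. is_min g y \<and> y i < x i \<and> x j < y j \<and> dist1 V x y \<le> dist1 V x m"
    by (rule minimum_beyond_transfer[where P = "is_min g", OF fin less ij _ m]) (use steep ij in auto)
  then obtain y where y: "is_min g y" "y i < x i" "x j < y j" "dist1 V x y \<le> dist1 V x m" by blast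
  have "dist1 V y ?x' = dist1 V y x - 2"
    using dist1_transfer[OF finite_V ij, of y x] y by simp
  then show ?thesis using y by (intro exI[of _ y]) (simp add: dist1_commute)
qed

text \<open>
  The penalty is a Lagrange multiplier for the bound on the number of moved docks, which is half the
  norm: a transfer changes the norm by -2, 0 or 2.
\<close>

definition penalized :: "real \<Rightarrow> (nat \<Rightarrow> int) \<Rightarrow> ereal" where
  "penalized \<rho> x = g x + ereal (\<rho> * of_int (norm1 V x))"

lemma penalized_0 [simp]: "penalized 0 = g"
  by (auto simp: penalized_def)

lemma penalized_finite: "penalized \<rho> x < \<infinity> \<longleftrightarrow> g x < \<infinity>"
  by (cases "g x") (auto simp: penalized_def)

text \<open>
  An exchange moves the two points towards each other in both coordinates, which does not increase the
  sum of their norms.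
\<close>

lemma M_convex_penalized:
  assumes "0 \<le> \<rho>"
  shows "M_convex V (penalized \<rho>)"
proof
  show "finite V" by (rule finite_V)
  show "0 \<le> penalized \<rho> x" for x
    using nonneg[of x] assms norm1_nonneg[of V x] by (auto simp: penalized_def)
  show "penalized \<rho> x = penalized \<rho> y" if "\<And>k. k \<in> V \<Longrightarrow> x k = y k" for x y
    using that cong[of x y] by (auto simp: penalized_def norm1_def)
  show "\<exists>K. \<forall>x. penalized \<rho> x < \<infinity> \<longrightarrow> (\<forall>k\<in>V. \<bar>x k\<bar> \<le> K)"
    unfolding penalized_finite by (rule bounded)
next
  fix x y i assume *: "penalized \<rho> x < \<infinity>" "penalized \<rho> y < \<infinity>" "i \<in> V" "y i < x i"
  then obtain j where j: "j \<in> V" "x j < y j" "g (transfer i j x) + g (transfer j i y) \<le> g x + g y"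
    using exchange unfolding penalized_finite by blast
  have ij: "i \<noteq> j" using j * by auto
  have "norm1 V (transfer i j x) + norm1 V (transfer j i y) \<le> norm1 V x + norm1 V y"
    using norm1_transfer[OF finite_V *(3) j(1) ij, of x]
      norm1_transfer[OF finite_V j(1) *(3) ij[symmetric], of y] j * by auto
  then have "\<rho> * of_int (norm1 V (transfer i j x) + norm1 V (transfer j i y))
      \<le> \<rho> * of_int (norm1 V x + norm1 V y)"
    using assms by (intro mult_left_mono) linarith+
  then have "penalized \<rho> (transfer i j x) + penalized \<rho> (transfer j i y) \<le> penalized \<rho> x + penalized \<rho> y"
    using j(3) nonneg[of x] nonneg[of y] nonneg[of "transfer i j x"] nonneg[of "transfer j i y"]
    by (cases "g x"; cases "g y"; cases "g (transfer i j x)"; cases "g (transfer j i y)")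
      (auto simp: penalized_def algebra_simps)
  then show "\<exists>j\<in>V. x j < y j \<and>
      penalized \<rho> (transfer i j x) + penalized \<rho> (transfer j i y) \<le> penalized \<rho> x + penalized \<rho> y"
    using j by blast
qed

lemma penalized_min_finite: "is_min (penalized \<rho>) x \<Longrightarrow> g x < \<infinity>"
  using penalized_finite by (simp add: is_min_def)

lemma penalized_min_le:
  assumes "is_min (penalized \<rho>) x"
  shows "g x \<le> g y + ereal (\<rho> * of_int (norm1 V y - norm1 V x))"
  using assms unfolding is_min_def penalized_def ereal_shift_le_iff by blast

lemma penalized_minI:
  assumes "0 \<le> \<rho>" "g x < \<infinity>"
    and "\<And>i j. i \<in> V \<Longrightarrow> j \<in> V \<Longrightarrow> i \<noteq> j \<Longrightarrow>
      g x \<le> g (transfer i j x) + ereal (\<rho> * of_int (norm1 V (transfer i j x) - norm1 V x))"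
  shows "is_min (penalized \<rho>) x"
proof (rule M_convex.local_min_imp_is_min[OF M_convex_penalized[OF assms(1)]])
  show "penalized \<rho> x < \<infinity>" using assms(2) unfolding penalized_finite .
  fix i j assume "i \<in> V" "j \<in> V" "i \<noteq> j"
  from assms(3)[OF this] show "penalized \<rho> x \<le> penalized \<rho> (transfer i j x)"
    unfolding penalized_def ereal_shift_le_iff .
qed

text \<open>
  The points that minimize \<open>g\<close> plus some multiple of the norm form a path: a steepest step for \<open>g\<close> alone
  leads to the next point of this path. With half the gain of the step as multiplier, both of its
  ends have the same penalized value, and any other transfer from \<open>x\<close> is no better.
\<close>

lemma best_transfer_from_penalized_min:
  assumes min: "is_min (penalized \<rho>) x" and lam: "0 \<le> \<rho>" and best: "best_transfer V g x i j"
    and less: "g (transfer i j x) < g x"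
  shows "norm1 V (transfer i j x) = norm1 V x + 2"
    and "\<exists>\<mu>>0. is_min (penalized \<mu>) (transfer i j x)"
proof -
  let ?x' = "transfer i j x"
  have ij: "i \<in> V" "j \<in> V" "i \<noteq> j"
    and steep: "\<And>a b. a \<in> V \<Longrightarrow> b \<in> V \<Longrightarrow> a \<noteq> b \<Longrightarrow> g ?x' \<le> g (transfer a b x)"
    using best by (auto simp: best_transfer_def)
  have xfin: "g x < \<infinity>" by (rule penalized_min_finite[OF min])
  obtain r where r: "g x = ereal r" using xfin nonneg[of x] by (cases "g x") auto
  obtain s where s: "g ?x' = ereal s" using xfin less nonneg[of ?x'] by (cases "g ?x'") auto
  have sr: "s < r" using less r s by simp
  define \<mu> where "\<mu> = (r - s) / 2"
  have le: "g x \<le> g y + ereal (\<rho> * of_int (norm1 V y - norm1 V x))" for y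
    by (rule penalized_min_le[OF min])
  have norm': "norm1 V (transfer a b x) - norm1 V x \<in> {-2, 0, 2}" if "a \<in> V" "b \<in> V" "a \<noteq> b" for a b
    using norm1_transfer[OF finite_V that] by auto
  have gain: "r - s \<le> \<rho> * of_int (norm1 V ?x' - norm1 V x)"
    using le[of ?x'] r s by simp
  show norm: "norm1 V ?x' = norm1 V x + 2"
  proof (rule ccontr)
    assume "norm1 V ?x' \<noteq> norm1 V x + 2"
    then have "norm1 V ?x' - norm1 V x \<le> 0" using norm'[OF ij] by auto
    then have "\<rho> * of_int (norm1 V ?x' - norm1 V x) \<le> 0" using lam by (simp add: mult_nonneg_nonpos)
    then show False using gain sr by linarith
  qed
  have mu: "0 < \<mu>" "\<mu> \<le> \<rho>" using sr gain norm by (auto simp: \<mu>_def)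
  have min': "is_min (penalized \<mu>) x"
  proof (rule penalized_minI)
    fix a b assume ab: "a \<in> V" "b \<in> V" "a \<noteq> b"
    let ?y = "transfer a b x"
    consider "norm1 V ?y - norm1 V x = 2" | "norm1 V ?y - norm1 V x = 0" | "norm1 V ?y - norm1 V x = -2"
      using norm'[OF ab] by auto
    then show "g x \<le> g ?y + ereal (\<mu> * of_int (norm1 V ?y - norm1 V x))"
    proof cases
      case 1
      have "\<mu> * 2 = r - s" by (simp add: \<mu>_def)
      then show ?thesis using steep[OF ab] r s 1 nonneg[of ?y] by (cases "g ?y") auto
    next
      case 2
      then show ?thesis using le[of ?y] by simp
    next
      case 3
      then show ?thesis using le[of ?y] r nonneg[of ?y] mu(2) by (cases "g ?y") auto
    qed
  qed (use mu xfin in auto)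
  have "penalized \<mu> ?x' = penalized \<mu> x"
    using r s by (simp add: penalized_def norm \<mu>_def field_simps)
  then have "is_min (penalized \<mu>) ?x'" using min' by (simp add: is_min_def)
  then show "\<exists>\<mu>>0. is_min (penalized \<mu>) ?x'" using mu by blast
qed

text \<open>The same path, followed towards the origin by the cheapest of the transfers that shorten \<open>x\<close>.\<close>

lemma penalized_min_one_step_back:
  assumes min: "is_min (penalized \<rho>) x" and lam: "0 \<le> \<rho>" and g0: "g (\<lambda>_. 0) < \<infinity>"
    and nz: "norm1 V x > 0"
  shows "\<exists>x' \<mu>. \<rho> \<le> \<mu> \<and> is_min (penalized \<mu>) x' \<and> norm1 V x' = norm1 V x - 2 \<and> dist1 V x x' = 2"
proof -
  have xfin: "g x < \<infinity>" by (rule penalized_min_finite[OF min])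
  let ?S = "{(i, j). i \<in> V \<and> j \<in> V \<and> 0 < x i \<and> x j < 0}"
  let ?v = "\<lambda>(i, j). g (transfer i j x)"
  have "\<not> (\<forall>k\<in>V. x k = (\<lambda>_. 0) k)" using nz norm1_eq_0[OF finite_V, of x] by auto
  then obtain i0 j0 where ij0: "i0 \<in> V" "j0 \<in> V" "0 < x i0" "x j0 < 0"
    and le0: "g (transfer i0 j0 x) + g (transfer j0 i0 (\<lambda>_. 0)) \<le> g x + g (\<lambda>_. 0)"
    using exchange_pair[OF xfin g0] by auto
  have "finite ?S" by (rule finite_subset[of _ "V \<times> V"]) (use finite_V in auto)
  moreover have "(i0, j0) \<in> ?S" using ij0 by auto
  ultimately have S: "finite ?S" "?S \<noteq> {}" by auto
  define p where "p = arg_min_on ?v ?S"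
  have p: "p \<in> ?S" unfolding p_def by (rule arg_min_if_finite(1)[OF S])
  have pmin: "?v p \<le> ?v q" if "q \<in> ?S" for q
    using arg_min_if_finite(2)[OF S, of ?v] that unfolding p_def[symmetric] by (meson not_le)
  obtain i j where pij: "p = (i, j)" by force
  have ij: "i \<in> V" "j \<in> V" "0 < x i" "x j < 0" using p pij by auto
  then have ne: "i \<noteq> j" by auto
  let ?x' = "transfer i j x"
  have cheap: "g ?x' \<le> g (transfer a b x)" if "a \<in> V" "b \<in> V" "0 < x a" "x b < 0" for a b
    using pmin[of "(a, b)"] that pij by auto
  have "g (transfer i0 j0 x) < \<infinity>"
    using le0 g0 xfin nonneg[of "transfer j0 i0 (\<lambda>_. 0)"] nonneg[of x] nonneg[of "\<lambda>_. 0"]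
    by (cases "g (transfer i0 j0 x)"; cases "g (transfer j0 i0 (\<lambda>_. 0))"; cases "g x"; cases "g (\<lambda>_. 0)") auto
  then have "g ?x' < \<infinity>" using cheap[OF ij0] by (rule le_less_trans[rotated])
  then obtain s where s: "g ?x' = ereal s" using nonneg[of ?x'] by (cases "g ?x'") auto
  obtain r where r: "g x = ereal r" using xfin nonneg[of x] by (cases "g x") auto
  define \<mu> where "\<mu> = (s - r) / 2"
  have norm: "norm1 V ?x' = norm1 V x - 2" using norm1_transfer[OF finite_V ij(1,2) ne] ij by simp
  have le: "g x \<le> g y + ereal (\<rho> * of_int (norm1 V y - norm1 V x))" for y
    by (rule penalized_min_le[OF min])
  have mu: "\<rho> \<le> \<mu>" using le[of ?x'] r s norm by (simp add: \<mu>_def)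
  have min': "is_min (penalized \<mu>) x"
  proof (rule penalized_minI)
    fix a b assume ab: "a \<in> V" "b \<in> V" "a \<noteq> b"
    let ?y = "transfer a b x"
    have ny: "norm1 V ?y - norm1 V x = (if x a > 0 then - 1 else 1) + (if x b < 0 then - 1 else 1)"
      using norm1_transfer[OF finite_V ab] by simp
    consider "norm1 V ?y - norm1 V x = 2" | "norm1 V ?y - norm1 V x = 0"
      | "norm1 V ?y - norm1 V x = -2" "0 < x a" "x b < 0"
      using ny by (auto split: if_splits)
    then show "g x \<le> g ?y + ereal (\<mu> * of_int (norm1 V ?y - norm1 V x))"
    proof cases
      case 1
      then show ?thesis using le[of ?y] r nonneg[of ?y] mu by (cases "g ?y") auto
    next
      case 2
      then show ?thesis using le[of ?y] by simp
    next
      case 3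
      have "\<mu> * 2 = s - r" by (simp add: \<mu>_def)
      then show ?thesis using cheap[OF ab(1,2) 3(2,3)] r s 3(1) nonneg[of ?y] by (cases "g ?y") auto
    qed
  qed (use mu lam xfin in auto)
  have "penalized \<mu> ?x' = penalized \<mu> x"
    using r s by (simp add: penalized_def norm \<mu>_def field_simps)
  then have "is_min (penalized \<mu>) ?x'" using min' by (simp add: is_min_def)
  moreover have "dist1 V x ?x' = 2"
    using dist1_transfer[OF finite_V ij(1,2) ne, of x x] by (simp add: dist1_def)
  ultimately show ?thesis using mu norm by blast
qed

lemma penalized_min_back:
  assumes "is_min (penalized \<rho>) x" and "0 \<le> \<rho>" and "g (\<lambda>_. 0) < \<infinity>"
    and "2 * int N \<le> norm1 V x" and "even (norm1 V x)"
  shows "\<exists>x' \<mu>. \<rho> \<le> \<mu> \<and> is_min (penalized \<mu>) x' \<and> norm1 V x' = 2 * int N \<and>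
    dist1 V x x' \<le> norm1 V x - 2 * int N"
  using assms
proof (induction "nat (norm1 V x)" arbitrary: x \<rho> rule: less_induct)
  case less
  show ?case
  proof (cases "norm1 V x = 2 * int N")
    case True
    then show ?thesis using less.prems by (intro exI[of _ x] exI[of _ \<rho>]) (simp add: dist1_def)
  next
    case False
    then have pos: "norm1 V x > 2 * int N" using less.prems by simp
    then obtain x1 \<mu>1 where 1: "\<rho> \<le> \<mu>1" "is_min (penalized \<mu>1) x1" "norm1 V x1 = norm1 V x - 2"
        "dist1 V x x1 = 2"
      using penalized_min_one_step_back[OF less.prems(1-3)] by auto
    have "\<exists>x' \<mu>. \<mu>1 \<le> \<mu> \<and> is_min (penalized \<mu>) x' \<and> norm1 V x' = 2 * int N \<and>
        dist1 V x1 x' \<le> norm1 V x1 - 2 * int N"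
    proof (rule less.hyps)
      show "nat (norm1 V x1) < nat (norm1 V x)" using 1 pos by simp
      show "is_min (penalized \<mu>1) x1" by fact
      show "2 * int N \<le> norm1 V x1" "even (norm1 V x1)" using 1(3) pos less.prems(5) by presburger+
    qed (use 1 less.prems in auto)
    then obtain x' \<mu> where 2: "\<mu>1 \<le> \<mu>" "is_min (penalized \<mu>) x'" "norm1 V x' = 2 * int N"
        "dist1 V x1 x' \<le> norm1 V x1 - 2 * int N" by blast
    have "dist1 V x x' \<le> norm1 V x - 2 * int N" using dist1_triangle[of V x x' x1] 1 2 by simp
    moreover have "\<rho> \<le> \<mu>" using 1 2 by simp
    ultimately show ?thesis using 2 by blast
  qed
qed

text \<open>
  Descent for \<open>g\<close> from a point \<open>w\<close> between the origin and a penalized minimizer \<open>m\<close>. A transfer towards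
  \<open>m\<close> lengthens \<open>w\<close> by 2, the most that is possible. So a steepest step for \<open>g\<close> is at least as good for the
  penalized function as any transfer towards \<open>m\<close>. In \<open>minimum_beyond_transfer\<close> the competitors share one
  end with the step and lengthen \<open>w\<close> at the other; as the penalty is positive, the step would be strictly
  better unless it lengthened \<open>w\<close> there as well.
\<close>

lemma best_transfer_towards_penalized_min:
  assumes lam: "0 < \<rho>" and m: "is_min (penalized \<rho>) m"
    and box: "\<forall>k\<in>V. conforms (w k) (m k)" and fin: "g w < \<infinity>"
    and notmin: "\<not> is_min (penalized \<rho>) w" and best: "best_transfer V g w i j"
  shows "norm1 V (transfer i j w) = norm1 V w + 2"
    and "g (transfer i j w) < g w"
    and "\<exists>m'. is_min (penalized \<rho>) m' \<and> (\<forall>k\<in>V. conforms (transfer i j w k) (m' k)) \<and>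
      norm1 V m' \<le> norm1 V m"
proof -
  interpret P: M_convex V "penalized \<rho>" using M_convex_penalized lam by simp
  let ?P = "\<lambda>y. is_min (penalized \<rho>) y \<and> (\<forall>k\<in>V. conforms (w k) (y k))"
  let ?w' = "transfer i j w"
  let ?n = "norm1 V"
  have ij: "i \<in> V" "j \<in> V" "i \<noteq> j"
    and steep: "\<And>a b. a \<in> V \<Longrightarrow> b \<in> V \<Longrightarrow> a \<noteq> b \<Longrightarrow> g ?w' \<le> g (transfer a b w)"
    using best by (auto simp: best_transfer_def)
  obtain m0 where m0: "?P m0" and near: "\<And>y. ?P y \<Longrightarrow> dist1 V w m0 \<le> dist1 V w y"
    using nearest_exists[of ?P m V w] m box by blast
  have m0fin: "penalized \<rho> m0 < \<infinity>" using m0 by (simp add: is_min_def)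
  have wfin: "penalized \<rho> w < \<infinity>" using fin unfolding penalized_finite .
  have beyond: "w k \<le> 0" if "k \<in> V" "?P y" "y k < w k" for k y
    using that by (auto simp: conforms_def)
  have beyond': "0 \<le> w k" if "k \<in> V" "?P y" "w k < y k" for k y
    using that by (auto simp: conforms_def)
  have len: "?n (transfer a b w) = ?n w + (if w a > 0 then - 1 else 1) + (if w b < 0 then - 1 else 1)"
    if "a \<in> V" "b \<in> V" "a \<noteq> b" for a b
    using norm1_transfer[OF finite_V that] .
  have pen_mono: "penalized \<rho> x \<le> penalized \<rho> y" if "g x \<le> g y" "?n x \<le> ?n y" for x y
    using that lam unfolding penalized_def by (intro add_mono) auto
  have pen_strict: "penalized \<rho> x < penalized \<rho> y" if "g x \<le> g y" "?n x < ?n y" "g x < \<infinity>" for x y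
    using that lam nonneg[of x] nonneg[of y] unfolding penalized_def by (cases "g x"; cases "g y") (auto intro!: add_le_less_mono)
  \<comment> \<open>a step from \<open>a\<close> to \<open>b\<close> towards \<open>m0\<close> shows that the steepest step improves the penalized value\<close>
  have "\<not> (\<forall>k\<in>V. w k = m0 k)"
  proof
    assume "\<forall>k\<in>V. w k = m0 k"
    then have "penalized \<rho> w = penalized \<rho> m0" by (intro P.cong) blast
    then show False using m0 notmin by (simp add: is_min_def)
  qed
  then obtain a b where ab: "a \<in> V" "b \<in> V" "m0 a < w a" "w b < m0 b"
    and le: "penalized \<rho> (transfer a b w) + penalized \<rho> (transfer b a m0) \<le> penalized \<rho> w + penalized \<rho> m0"
    using P.exchange_pair[OF wfin m0fin] by blast
  have ne: "a \<noteq> b" using ab by auto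
  have sgn: "w a \<le> 0" "0 \<le> w b" using beyond[OF ab(1) m0 ab(3)] beyond'[OF ab(2) m0 ab(4)] by auto
  have "\<not> is_min (penalized \<rho>) (transfer b a m0)"
  proof
    assume *: "is_min (penalized \<rho>) (transfer b a m0)"
    have "conforms (w k) (transfer b a m0 k)" if "k \<in> V" for k
    proof -
      have "conforms (w k) (m0 k)" using m0 that by blast
      then show ?thesis using ne sgn ab(3,4) by (auto simp: transfer_apply conforms_def)
    qed
    then have "dist1 V w m0 \<le> dist1 V w (transfer b a m0)" using near * by blast
    then show False using dist1_transfer[OF finite_V ab(2,1), of w m0] ne ab by simp
  qed
  moreover have "penalized \<rho> m0 \<le> penalized \<rho> (transfer b a m0)" using m0 by (simp add: is_min_def)
  ultimately have "penalized \<rho> m0 < penalized \<rho> (transfer b a m0)"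
    using m0 unfolding is_min_def by (metis le_less not_le order_trans)
  then have less_ab: "penalized \<rho> (transfer a b w) < penalized \<rho> w"
    using le wfin m0fin P.nonneg[of w] P.nonneg[of m0] P.nonneg[of "transfer a b w"] P.nonneg[of "transfer b a m0"]
    by (cases "penalized \<rho> (transfer a b w)"; cases "penalized \<rho> (transfer b a m0)";
        cases "penalized \<rho> w"; cases "penalized \<rho> m0") auto
  have len_ab: "?n (transfer a b w) = ?n w + 2" using len[OF ab(1,2) ne] sgn by auto
  have len_ij: "?n ?w' \<le> ?n w + 2" using len[OF ij] by auto
  have g_ab: "g ?w' \<le> g (transfer a b w)" using steep[OF ab(1,2) ne] .
  have less': "penalized \<rho> ?w' < penalized \<rho> w"
    using pen_mono[OF g_ab] len_ab len_ij less_ab by (auto intro: le_less_trans)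
  then have wfin': "penalized \<rho> ?w' < \<infinity>" using wfin by (rule less_trans)
  then have gfin': "g ?w' < \<infinity>" unfolding penalized_finite .
  show "g ?w' < g w"
  proof (rule ccontr)
    assume "\<not> g ?w' < g w"
    then have "g w \<le> g (transfer a b w)" using g_ab by auto
    then show False using pen_mono[of w "transfer a b w"] len_ab less_ab by auto
  qed
  have "\<exists>y. ?P y \<and> y i < w i \<and> w j < y j \<and> dist1 V w y \<le> dist1 V w m"
  proof (rule P.minimum_beyond_transfer[OF wfin less' ij])
    fix y k assume y: "?P y" and k: "k \<in> V" "k \<noteq> i" "k \<noteq> j" "y k < w k" and i: "w i \<le> y i"
      and le': "penalized \<rho> (transfer k j w) \<le> penalized \<rho> ?w'"
    have wk: "w k \<le> 0" by (rule beyond[OF k(1) y k(4)])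
    have g_kj: "g ?w' \<le> g (transfer k j w)" using steep[OF k(1) ij(2) k(3)] .
    \<comment> \<open>if the competitor were longer than \<open>w'\<close>, it would be strictly worse\<close>
    then have "?n (transfer k j w) \<le> ?n ?w'"
      using le' pen_strict[of ?w' "transfer k j w"] gfin' by force
    then have wi: "w i \<le> 0" using len[OF k(1) ij(2) k(3)] len[OF ij] wk by (auto split: if_splits)
    have "penalized \<rho> ?w' \<le> penalized \<rho> (transfer k j w)"
      using pen_mono[OF g_kj] len[OF k(1) ij(2) k(3)] len[OF ij] wk wi by auto
    moreover have "conforms (w q) (transfer i k y q)" if "q \<in> V" for q
    proof -
      have "conforms (w q) (y q)" using y that by blast
      then show ?thesis using k wi wk i by (auto simp: transfer_apply conforms_def)
    qed
    ultimately show "penalized \<rho> ?w' \<le> penalized \<rho> (transfer k j w) \<and>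
        (is_min (penalized \<rho>) (transfer i k y) \<longrightarrow> ?P (transfer i k y))" by blast
  next
    fix y k assume y: "?P y" and k: "k \<in> V" "k \<noteq> i" "k \<noteq> j" "w k < y k" and j: "y j \<le> w j"
      and le': "penalized \<rho> (transfer i k w) \<le> penalized \<rho> ?w'"
    have wk: "0 \<le> w k" by (rule beyond'[OF k(1) y k(4)])
    have g_ik: "g ?w' \<le> g (transfer i k w)" using steep[OF ij(1) k(1)] k by auto
    then have "?n (transfer i k w) \<le> ?n ?w'"
      using le' pen_strict[of ?w' "transfer i k w"] gfin' by force
    then have wj: "0 \<le> w j" using len[OF ij(1) k(1)] k len[OF ij] wk by (auto split: if_splits)
    have "penalized \<rho> ?w' \<le> penalized \<rho> (transfer i k w)"
      using pen_mono[OF g_ik] len[OF ij(1) k(1)] k len[OF ij] wk wj by auto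
    moreover have "conforms (w q) (transfer k j y q)" if "q \<in> V" for q
    proof -
      have "conforms (w q) (y q)" using y that by blast
      then show ?thesis using k wj wk j by (auto simp: transfer_apply conforms_def)
    qed
    ultimately show "penalized \<rho> ?w' \<le> penalized \<rho> (transfer i k w) \<and>
        (is_min (penalized \<rho>) (transfer k j y) \<longrightarrow> ?P (transfer k j y))" by blast
  qed (use m box in auto)
  then obtain y where y: "?P y" "y i < w i" "w j < y j" "dist1 V w y \<le> dist1 V w m" by blast
  have wi: "w i \<le> 0" and wj: "0 \<le> w j" using beyond[OF ij(1) y(1,2)] beyond'[OF ij(2) y(1,3)] by auto
  show "?n ?w' = ?n w + 2" using len[OF ij] wi wj by auto
  have "conforms (?w' k) (y k)" if "k \<in> V" for k
  proof -
    have "conforms (w k) (y k)" using y that by blast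
    then show ?thesis using y wi wj by (auto simp: transfer_apply[OF ij(3)] conforms_def)
  qed
  moreover have "?n y \<le> ?n m"
    using norm1_conforms[of V w y] norm1_conforms[OF box] y by auto
  ultimately show "\<exists>m'. is_min (penalized \<rho>) m' \<and> (\<forall>k\<in>V. conforms (?w' k) (m' k)) \<and> ?n m' \<le> ?n m"
    using y by blast
qed

end

section \<open>Multimodular stations and circuits\<close>

text \<open>
  A change \<open>(u, v)\<close> of empty and full docks as a part of the change \<open>(p, q)\<close>. The third condition, on the
  number of docks, makes removing an empty dock, adding a full dock and removing a bike three
  directions of equal standing.
\<close>

definition fits :: "int \<Rightarrow> int \<Rightarrow> int \<Rightarrow> int \<Rightarrow> bool" where
  "fits u v p q \<longleftrightarrow> conforms u p \<and> conforms v q \<and> conforms (u + v) (p + q)"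

text \<open>
  Multimodularity is usually this inequality for unit changes only. With changes of any size, the
  property is inherited when the step length is multiplied by an integer.
\<close>

definition multimodular :: "(int \<Rightarrow> int \<Rightarrow> ereal) \<Rightarrow> bool" where
  "multimodular f \<longleftrightarrow> (\<forall>x y p q u v. fits u v p q \<longrightarrow>
     f (x + u) (y + v) + f (x + p - u) (y + q - v) \<le> f x y + f (x + p) (y + q))"

definition balanced :: "nat \<Rightarrow> alloc \<Rightarrow> bool" where
  "balanced n X \<longleftrightarrow> (\<Sum>k\<in>{1..n}. fst X k) = 0 \<and> (\<Sum>k\<in>{1..n}. snd X k) = 0"

definition capacity :: "alloc \<Rightarrow> nat \<Rightarrow> int" where
  "capacity X = (\<lambda>k. fst X k + snd X k)"

definition plus_alloc :: "alloc \<Rightarrow> alloc \<Rightarrow> alloc" where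
  "plus_alloc X U = (\<lambda>k. fst X k + fst U k, \<lambda>k. snd X k + snd U k)"

definition minus_alloc :: "alloc \<Rightarrow> alloc \<Rightarrow> alloc" where
  "minus_alloc X U = (\<lambda>k. fst X k - fst U k, \<lambda>k. snd X k - snd U k)"

definition scale_alloc :: "int \<Rightarrow> alloc \<Rightarrow> alloc" where
  "scale_alloc a X = (\<lambda>k. a * fst X k, \<lambda>k. a * snd X k)"

definition zero_alloc :: alloc where
  "zero_alloc = (\<lambda>_. 0, \<lambda>_. 0)"

definition fits_alloc :: "nat \<Rightarrow> alloc \<Rightarrow> alloc \<Rightarrow> alloc \<Rightarrow> bool" where
  "fits_alloc n U X Y \<longleftrightarrow>
     (\<forall>k\<in>{1..n}. fits (fst U k) (snd U k) (fst Y k - fst X k) (snd Y k - snd X k))"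

text \<open>
  The intermediate station may be \<open>i\<close> or \<open>j\<close>; the move then has the effect of one of the first two.
\<close>

definition moves :: "nat \<Rightarrow> nat \<Rightarrow> nat \<Rightarrow> dock_move set" where
  "moves n i j = {Empty_Move i j, Full_Move i j} \<union>
     (\<Union>h\<in>{1..n}. {Empty_Via i j h, Full_Via i j h})"

abbreviation move_vec :: "int \<Rightarrow> dock_move \<Rightarrow> alloc" where
  "move_vec a m \<equiv> apply_move a m zero_alloc"

abbreviation bike_vec :: "int \<Rightarrow> nat \<Rightarrow> nat \<Rightarrow> alloc" where
  "bike_vec a i j \<equiv> bike_move a i j zero_alloc"

lemma plus_move_vec: "plus_alloc X (move_vec a m) = apply_move a m X"
  by (cases X; cases m) (auto simp: plus_alloc_def zero_alloc_def algebra_simps)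

lemma plus_bike_vec: "plus_alloc X (bike_vec a i j) = bike_move a i j X"
  by (cases X) (auto simp: plus_alloc_def zero_alloc_def algebra_simps)

lemma move_vec_scale: "move_vec a m = scale_alloc a (move_vec 1 m)"
  by (cases m) (auto simp: scale_alloc_def zero_alloc_def algebra_simps)

lemma bike_vec_scale: "bike_vec a i j = scale_alloc a (bike_vec 1 i j)"
  by (auto simp: scale_alloc_def zero_alloc_def algebra_simps)

lemma sum_unit_vec: "finite V \<Longrightarrow> (\<Sum>k\<in>V. a * unit_vec i k) = (if i \<in> V then a else 0)"
  by (simp add: unit_vec_def if_distrib cong: if_cong)

lemma balanced_plus: "balanced n X \<Longrightarrow> balanced n U \<Longrightarrow> balanced n (plus_alloc X U)"
  by (simp add: balanced_def plus_alloc_def sum.distrib)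

lemma balanced_minus: "balanced n X \<Longrightarrow> balanced n U \<Longrightarrow> balanced n (minus_alloc X U)"
  by (simp add: balanced_def minus_alloc_def sum_subtractf)

lemma balanced_scale: "balanced n X \<Longrightarrow> balanced n (scale_alloc a X)"
  by (simp add: balanced_def scale_alloc_def sum_distrib_left[symmetric])

lemma balanced_move_vec:
  assumes "i \<in> {1..n}" "j \<in> {1..n}" "m \<in> moves n i j"
  shows "balanced n (move_vec a m)"
  using assms by (auto simp: moves_def balanced_def zero_alloc_def sum.distrib sum_subtractf sum_negf sum_unit_vec)

lemma balanced_bike_vec:
  assumes "i \<in> {1..n}" "j \<in> {1..n}"
  shows "balanced n (bike_vec a i j)"
  using assms by (auto simp: balanced_def zero_alloc_def sum.distrib sum_subtractf sum_negf sum_unit_vec)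

lemma capacity_plus: "capacity (plus_alloc X U) = (\<lambda>k. capacity X k + capacity U k)"
  by (auto simp: capacity_def plus_alloc_def)

lemma capacity_minus: "capacity (minus_alloc X U) = (\<lambda>k. capacity X k - capacity U k)"
  by (auto simp: capacity_def minus_alloc_def)

lemma capacity_scale: "capacity (scale_alloc a X) = (\<lambda>k. a * capacity X k)"
  by (auto simp: capacity_def scale_alloc_def algebra_simps)

lemma capacity_move_vec: "m \<in> moves n i j \<Longrightarrow> capacity (move_vec 1 m) = (\<lambda>k. unit_vec j k - unit_vec i k)"
  by (auto simp: moves_def capacity_def zero_alloc_def)

lemma capacity_bike_vec: "capacity (bike_vec a i j) = (\<lambda>k. 0)"
  by (auto simp: capacity_def zero_alloc_def)

lemma sum_capacity: "balanced n X \<Longrightarrow> (\<Sum>k\<in>{1..n}. capacity X k) = 0"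
  by (simp add: balanced_def capacity_def sum.distrib)

lemma capacity_apply_move:
  "m \<in> moves n i j \<Longrightarrow> capacity (apply_move 1 m X) = transfer i j (capacity X)"
  unfolding plus_move_vec[of X, symmetric] capacity_plus by (auto simp: capacity_move_vec transfer_def)

lemma minus_alloc_move_capacity:
  "m \<in> moves n i j \<Longrightarrow> capacity (minus_alloc X (move_vec 1 m)) = transfer j i (capacity X)"
  by (auto simp: capacity_minus capacity_move_vec transfer_def)

text \<open>
  A change \<open>(p, q)\<close> at one station splits into unit changes of six kinds without cancellation:
  \<open>\<plusminus>\<close> an empty dock, \<open>\<plusminus>\<close> a full dock, and \<open>\<plusminus>\<close> the removal of a bike. The numbers of units of each
  kind are \<open>dock_units (\<plusminus>p) (\<plusminus>q)\<close>, \<open>dock_units (\<plusminus>q) (\<plusminus>p)\<close> and \<open>swap_units (\<plusminus>p) (\<plusminus>q)\<close>.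
\<close>

definition dock_units :: "int \<Rightarrow> int \<Rightarrow> int" where
  "dock_units p q = max 0 (min p (p + q))"

definition swap_units :: "int \<Rightarrow> int \<Rightarrow> int" where
  "swap_units p q = max 0 (min p (- q))"

lemma units_decomposition:
  "p = dock_units p q - dock_units (- p) (- q) + swap_units p q - swap_units (- p) (- q)"
  "q = dock_units q p - dock_units (- q) (- p) - swap_units p q + swap_units (- p) (- q)"
  by (auto simp: dock_units_def swap_units_def max_def min_def)

context
  fixes n :: nat and X Y :: alloc and t :: int
  assumes t: "1 \<le> t"
begin

abbreviation (input) "d_change k \<equiv> fst Y k - fst X k"
abbreviation (input) "b_change k \<equiv> snd Y k - snd X k"

lemma fits_unit:
  "t \<le> dock_units p q \<Longrightarrow> fits t 0 p q" "t \<le> dock_units (- p) (- q) \<Longrightarrow> fits (- t) 0 p q"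
  "t \<le> dock_units q p \<Longrightarrow> fits 0 t p q" "t \<le> dock_units (- q) (- p) \<Longrightarrow> fits 0 (- t) p q"
  "t \<le> swap_units p q \<Longrightarrow> fits t (- t) p q" "t \<le> swap_units (- p) (- q) \<Longrightarrow> fits (- t) t p q"
  "fits 0 0 p q"
  using t by (auto simp: fits_def conforms_def dock_units_def swap_units_def)

text \<open>
  Two kinds that occur in a common circuit never occur at the same station, so the stations of a
  circuit are different.
\<close>

lemma opposite_units:
  "t \<le> dock_units (- p) (- q) \<Longrightarrow> \<not> t \<le> dock_units p q"
  "t \<le> dock_units (- p) (- q) \<Longrightarrow> \<not> t \<le> dock_units q p"
  "t \<le> dock_units (- p) (- q) \<Longrightarrow> \<not> t \<le> swap_units p q"
  "t \<le> dock_units p q \<Longrightarrow> \<not> t \<le> swap_units (- p) (- q)"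
  "t \<le> swap_units (- p) (- q) \<Longrightarrow> \<not> t \<le> swap_units p q"
  using t by (auto simp: dock_units_def swap_units_def)

lemma opposite_units':
  "t \<le> dock_units q p \<Longrightarrow> \<not> t \<le> swap_units p q"
  "t \<le> dock_units (- q) (- p) \<Longrightarrow> \<not> t \<le> swap_units (- p) (- q)"
  using t by (auto simp: dock_units_def swap_units_def)

lemma fits_allocI:
  assumes "\<And>k. fits (fst U k) (snd U k) (d_change k) (b_change k)"
  shows "fits_alloc n U X Y"
  using assms by (simp add: fits_alloc_def)

lemma fits_Empty_Move:
  assumes "t \<le> dock_units (- d_change i) (- b_change i)" "t \<le> dock_units (d_change j) (b_change j)"
  shows "i \<noteq> j \<and> fits_alloc n (move_vec t (Empty_Move i j)) X Y"
proof (intro conjI fits_allocI)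
  show ne: "i \<noteq> j" using opposite_units assms by blast
  show "fits (fst (move_vec t (Empty_Move i j)) k) (snd (move_vec t (Empty_Move i j)) k) (d_change k) (b_change k)" for k
    using assms ne fits_unit by (cases "k = i"; cases "k = j") (simp_all add: zero_alloc_def unit_vec_def)
qed

lemma fits_Full_Move:
  assumes "t \<le> dock_units (- b_change i) (- d_change i)" "t \<le> dock_units (b_change j) (d_change j)"
  shows "i \<noteq> j \<and> fits_alloc n (move_vec t (Full_Move i j)) X Y"
proof (intro conjI fits_allocI)
  show ne: "i \<noteq> j" using opposite_units assms by blast
  show "fits (fst (move_vec t (Full_Move i j)) k) (snd (move_vec t (Full_Move i j)) k) (d_change k) (b_change k)" for k
    using assms ne fits_unit by (cases "k = i"; cases "k = j") (simp_all add: zero_alloc_def unit_vec_def)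
qed

lemma fits_Empty_Via:
  assumes "t \<le> dock_units (- d_change i) (- b_change i)" "t \<le> dock_units (b_change j) (d_change j)" "t \<le> swap_units (d_change h) (b_change h)"
  shows "i \<noteq> j \<and> fits_alloc n (move_vec t (Empty_Via i j h)) X Y"
proof (intro conjI fits_allocI)
  show ne: "i \<noteq> j" using opposite_units assms by blast
  have "i \<noteq> h" "j \<noteq> h" using opposite_units opposite_units' assms by blast+
  then show "fits (fst (move_vec t (Empty_Via i j h)) k) (snd (move_vec t (Empty_Via i j h)) k) (d_change k) (b_change k)" for k
    using assms ne fits_unit
    by (cases "k = i"; cases "k = j"; cases "k = h") (simp_all add: zero_alloc_def unit_vec_def)
qed

lemma fits_Full_Via:
  assumes "t \<le> dock_units (- b_change i) (- d_change i)" "t \<le> dock_units (d_change j) (b_change j)" "t \<le> swap_units (- d_change h) (- b_change h)"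
  shows "i \<noteq> j \<and> fits_alloc n (move_vec t (Full_Via i j h)) X Y"
proof (intro conjI fits_allocI)
  show ne: "i \<noteq> j" using opposite_units assms by blast
  have "i \<noteq> h" "j \<noteq> h" using opposite_units opposite_units' assms by blast+
  then show "fits (fst (move_vec t (Full_Via i j h)) k) (snd (move_vec t (Full_Via i j h)) k) (d_change k) (b_change k)" for k
    using assms ne fits_unit
    by (cases "k = i"; cases "k = j"; cases "k = h") (simp_all add: zero_alloc_def unit_vec_def)
qed

lemma fits_bike_vec:
  assumes "t \<le> swap_units (- d_change i) (- b_change i)" "t \<le> swap_units (d_change j) (b_change j)"
  shows "i \<noteq> j \<and> fits_alloc n (bike_vec t i j) X Y"
proof (intro conjI fits_allocI)
  show ne: "i \<noteq> j" using opposite_units assms by blast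
  show "fits (fst (bike_vec t i j) k) (snd (bike_vec t i j) k) (d_change k) (b_change k)" for k
    using assms ne fits_unit by (cases "k = i"; cases "k = j") (simp_all add: zero_alloc_def unit_vec_def)
qed

end

lemma balanced_units:
  assumes "balanced n X" "balanced n Y"
  defines "p \<equiv> \<lambda>k. fst Y k - fst X k" and "q \<equiv> \<lambda>k. snd Y k - snd X k"
  shows "(\<Sum>k\<in>{1..n}. dock_units (p k) (q k)) + (\<Sum>k\<in>{1..n}. swap_units (p k) (q k)) =
      (\<Sum>k\<in>{1..n}. dock_units (- p k) (- q k)) + (\<Sum>k\<in>{1..n}. swap_units (- p k) (- q k))"
    and "(\<Sum>k\<in>{1..n}. dock_units (q k) (p k)) + (\<Sum>k\<in>{1..n}. swap_units (- p k) (- q k)) =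
      (\<Sum>k\<in>{1..n}. dock_units (- q k) (- p k)) + (\<Sum>k\<in>{1..n}. swap_units (p k) (q k))"
proof -
  have "(\<Sum>k\<in>{1..n}. p k) = 0" "(\<Sum>k\<in>{1..n}. q k) = 0"
    using assms by (auto simp: balanced_def sum_subtractf)
  moreover have "(\<Sum>k\<in>{1..n}. p k) = (\<Sum>k\<in>{1..n}. dock_units (p k) (q k) - dock_units (- p k) (- q k) +
      swap_units (p k) (q k) - swap_units (- p k) (- q k))"
    by (rule sum.cong[OF refl]) (rule units_decomposition(1))
  moreover have "(\<Sum>k\<in>{1..n}. q k) = (\<Sum>k\<in>{1..n}. dock_units (q k) (p k) - dock_units (- q k) (- p k) -
      swap_units (p k) (q k) + swap_units (- p k) (- q k))"
    by (rule sum.cong[OF refl]) (rule units_decomposition(2))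
  ultimately show "(\<Sum>k\<in>{1..n}. dock_units (p k) (q k)) + (\<Sum>k\<in>{1..n}. swap_units (p k) (q k)) =
      (\<Sum>k\<in>{1..n}. dock_units (- p k) (- q k)) + (\<Sum>k\<in>{1..n}. swap_units (- p k) (- q k))"
    and "(\<Sum>k\<in>{1..n}. dock_units (q k) (p k)) + (\<Sum>k\<in>{1..n}. swap_units (- p k) (- q k)) =
      (\<Sum>k\<in>{1..n}. dock_units (- q k) (- p k)) + (\<Sum>k\<in>{1..n}. swap_units (p k) (q k))"
    unfolding sum.distrib sum_subtractf by linarith+
qed

lemma units_nonneg: "0 \<le> dock_units p q" "0 \<le> swap_units p q"
  by (auto simp: dock_units_def swap_units_def)

lemma sum_pos_witness:
  fixes h :: "nat \<Rightarrow> int"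
  assumes "1 \<le> (\<Sum>k\<in>A. h k)"
  shows "\<exists>k\<in>A. 1 \<le> h k"
proof (rule ccontr)
  assume "\<not> ?thesis"
  then have "(\<Sum>k\<in>A. h k) \<le> 0" by (intro sum_nonpos) force
  then show False using assms by simp
qed

text \<open>
  Balance completes the loss at \<open>i\<close> to a circuit: if \<open>i\<close> loses an empty dock and no station gains one, then
  some station replaces a full dock by an empty one, and some station gains a full dock. The loss of a
  full dock is treated in the same way.
\<close>

lemma dock_move_between:
  assumes bal: "balanced n X" "balanced n Y" and i: "i \<in> {1..n}" "capacity Y i < capacity X i"
  shows "\<exists>j\<in>{1..n}. capacity X j < capacity Y j \<and> (\<exists>m\<in>moves n i j. fits_alloc n (move_vec 1 m) X Y)"
proof -
  let ?p = "\<lambda>k. fst Y k - fst X k" and ?q = "\<lambda>k. snd Y k - snd X k"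
  define S :: "(nat \<Rightarrow> int) \<Rightarrow> int" where "S h = (\<Sum>k\<in>{1..n}. h k)" for h
  define a where "a = (\<lambda>k. dock_units (?p k) (?q k))"
  define a' where "a' = (\<lambda>k. dock_units (- ?p k) (- ?q k))"
  define b where "b = (\<lambda>k. dock_units (?q k) (?p k))"
  define b' where "b' = (\<lambda>k. dock_units (- ?q k) (- ?p k))"
  define e where "e = (\<lambda>k. swap_units (?p k) (?q k))"
  define e' where "e' = (\<lambda>k. swap_units (- ?p k) (- ?q k))"
  note defs = a_def a'_def b_def b'_def e_def e'_def
  have nn: "0 \<le> a k" "0 \<le> a' k" "0 \<le> b k" "0 \<le> b' k" "0 \<le> e k" "0 \<le> e' k" for k
    by (simp_all add: defs units_nonneg)
  have Snn: "0 \<le> S a" "0 \<le> S a'" "0 \<le> S b" "0 \<le> S b'" "0 \<le> S e" "0 \<le> S e'"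
    by (auto simp: S_def intro!: sum_nonneg nn)
  have eq: "S a + S e = S a' + S e'" "S b + S e' = S b' + S e"
    using balanced_units[OF bal] by (simp_all add: S_def defs)
  have witness: "\<exists>k\<in>{1..n}. 1 \<le> h k" if "1 \<le> S h" for h
    using sum_pos_witness that unfolding S_def .
  have ge: "h i \<le> S h" if "\<And>k. 0 \<le> h k" for h
    unfolding S_def by (rule member_le_sum) (use that i in auto)
  have found: ?thesis if "j \<in> {1..n}" "1 \<le> a j \<or> 1 \<le> b j" "m \<in> moves n i j"
    "i \<noteq> j \<and> fits_alloc n (move_vec 1 m) X Y" for j m
  proof -
    have "capacity X j < capacity Y j"
      using that(2) by (auto simp: defs dock_units_def capacity_def max_def min_def split: if_splits)
    then show ?thesis using that by blast
  qed
  have "1 \<le> a' i \<or> 1 \<le> b' i"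
    using i(2) by (auto simp: defs dock_units_def capacity_def max_def min_def)
  then show ?thesis
  proof
    assume *: "1 \<le> a' i"
    show ?thesis
    proof (cases "\<exists>j\<in>{1..n}. 1 \<le> a j")
      case True
      then obtain j where j: "j \<in> {1..n}" "1 \<le> a j" by blast
      show ?thesis
        by (rule found[of j "Empty_Move i j", OF j(1)])
          (use j * fits_Empty_Move[of 1 Y i X j n] in \<open>simp_all add: defs moves_def\<close>)
    next
      case False
      then have "S a < 1" using witness[of a] by linarith
      then have "1 \<le> S e" "1 \<le> S b" using eq Snn ge[of a', OF nn(2)] * by linarith+
      then obtain h j where hj: "h \<in> {1..n}" "1 \<le> e h" "j \<in> {1..n}" "1 \<le> b j"
        using witness[of e] witness[of b] by blast
      show ?thesis
        by (rule found[of j "Empty_Via i j h", OF hj(3)])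
          (use hj * fits_Empty_Via[of 1 Y i X j h n] in \<open>simp_all add: defs moves_def\<close>)
    qed
  next
    assume *: "1 \<le> b' i"
    show ?thesis
    proof (cases "\<exists>j\<in>{1..n}. 1 \<le> b j")
      case True
      then obtain j where j: "j \<in> {1..n}" "1 \<le> b j" by blast
      show ?thesis
        by (rule found[of j "Full_Move i j", OF j(1)])
          (use j * fits_Full_Move[of 1 Y i X j n] in \<open>simp_all add: defs moves_def\<close>)
    next
      case False
      then have "S b < 1" using witness[of b] by linarith
      then have "1 \<le> S e'" "1 \<le> S a" using eq Snn ge[of b', OF nn(4)] * by linarith+
      then obtain h j where hj: "h \<in> {1..n}" "1 \<le> e' h" "j \<in> {1..n}" "1 \<le> a j"
        using witness[of e'] witness[of a] by blast
      show ?thesis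
        by (rule found[of j "Full_Via i j h", OF hj(3)])
          (use hj * fits_Full_Via[of 1 Y i X j h n] in \<open>simp_all add: defs moves_def\<close>)
    qed
  qed
qed

text \<open>
  If no circuit fits twice into the change from \<open>X\<close> to \<open>Y\<close>, then of any two opposite kinds of units, and
  of the three kinds in a triangle, one kind occurs at most once per station. With the two
  balance equations this bounds the totals of gained and lost docks of either kind by \<open>3 * n\<close>.
\<close>

lemma small_change:
  assumes bal: "balanced n X" "balanced n Y"
    and no_move: "\<And>i j m. \<lbrakk>i \<in> {1..n}; j \<in> {1..n}; i \<noteq> j; m \<in> moves n i j\<rbrakk> \<Longrightarrow> \<not> fits_alloc n (move_vec 2 m) X Y"
    and no_bike: "\<And>i j. \<lbrakk>i \<in> {1..n}; j \<in> {1..n}; i \<noteq> j\<rbrakk> \<Longrightarrow> \<not> fits_alloc n (bike_vec 2 i j) X Y"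
    and k: "k \<in> {1..n}"
  shows "\<bar>capacity Y k - capacity X k\<bar> \<le> 6 * int n"
proof -
  let ?p = "\<lambda>k. fst Y k - fst X k" and ?q = "\<lambda>k. snd Y k - snd X k"
  define S :: "(nat \<Rightarrow> int) \<Rightarrow> int" where "S h = (\<Sum>k\<in>{1..n}. h k)" for h
  define a where "a = (\<lambda>k. dock_units (?p k) (?q k))"
  define a' where "a' = (\<lambda>k. dock_units (- ?p k) (- ?q k))"
  define b where "b = (\<lambda>k. dock_units (?q k) (?p k))"
  define b' where "b' = (\<lambda>k. dock_units (- ?q k) (- ?p k))"
  define e where "e = (\<lambda>k. swap_units (?p k) (?q k))"
  define e' where "e' = (\<lambda>k. swap_units (- ?p k) (- ?q k))"
  note defs = a_def a'_def b_def b'_def e_def e'_def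
  have nn: "0 \<le> a k" "0 \<le> a' k" "0 \<le> b k" "0 \<le> b' k" "0 \<le> e k" "0 \<le> e' k" for k
    by (simp_all add: defs units_nonneg)
  have Snn: "0 \<le> S a" "0 \<le> S a'" "0 \<le> S b" "0 \<le> S b'" "0 \<le> S e" "0 \<le> S e'"
    by (auto simp: S_def intro!: sum_nonneg nn)
  have eq: "S a + S e = S a' + S e'" "S b + S e' = S b' + S e"
    using balanced_units[OF bal] by (simp_all add: S_def defs)
  have big: "S h \<le> int n \<or> (\<exists>k\<in>{1..n}. 2 \<le> h k)" for h
  proof (rule ccontr)
    assume *: "\<not> (S h \<le> int n \<or> (\<exists>k\<in>{1..n}. 2 \<le> h k))"
    then have "S h \<le> (\<Sum>k\<in>{1..n}. 1)" unfolding S_def by (intro sum_mono) force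
    then show False using * by simp
  qed
  have pair: "S h \<le> int n \<or> S h' \<le> int n"
    if "\<And>i j. \<lbrakk>i \<in> {1..n}; j \<in> {1..n}; 2 \<le> h i; 2 \<le> h' j\<rbrakk> \<Longrightarrow> False" for h h'
    using big[of h] big[of h'] that by blast
  have "S a' \<le> int n \<or> S a \<le> int n"
  proof (rule pair)
    fix i j assume *: "i \<in> {1..n}" "j \<in> {1..n}" "2 \<le> a' i" "2 \<le> a j"
    then show False using no_move[of i j "Empty_Move i j"] fits_Empty_Move[of 2 Y i X j n] * by (simp add: defs moves_def)
  qed
  moreover have "S b' \<le> int n \<or> S b \<le> int n"
  proof (rule pair)
    fix i j assume *: "i \<in> {1..n}" "j \<in> {1..n}" "2 \<le> b' i" "2 \<le> b j"
    then show False using no_move[of i j "Full_Move i j"] fits_Full_Move[of 2 Y i X j n] * by (simp add: defs moves_def)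
  qed
  moreover have "S e' \<le> int n \<or> S e \<le> int n"
  proof (rule pair)
    fix i j assume *: "i \<in> {1..n}" "j \<in> {1..n}" "2 \<le> e' i" "2 \<le> e j"
    then show False using no_bike[of i j] fits_bike_vec[of 2 Y i X j n] * by (simp add: defs)
  qed
  moreover have "S a' \<le> int n \<or> S b \<le> int n \<or> S e \<le> int n"
  proof (rule ccontr)
    assume "\<not> ?thesis"
    then obtain i j h where *: "i \<in> {1..n}" "j \<in> {1..n}" "h \<in> {1..n}" "2 \<le> a' i" "2 \<le> b j" "2 \<le> e h"
      using big[of a'] big[of b] big[of e] by blast
    then show False using no_move[of i j "Empty_Via i j h"] fits_Empty_Via[of 2 Y i X j h n] *
      by (force simp: defs moves_def)
  qed
  moreover have "S b' \<le> int n \<or> S a \<le> int n \<or> S e' \<le> int n"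
  proof (rule ccontr)
    assume "\<not> ?thesis"
    then obtain i j h where *: "i \<in> {1..n}" "j \<in> {1..n}" "h \<in> {1..n}" "2 \<le> b' i" "2 \<le> a j" "2 \<le> e' h"
      using big[of b'] big[of a] big[of e'] by blast
    then show False using no_move[of i j "Full_Via i j h"] fits_Full_Via[of 2 Y i X j h n] *
      by (force simp: defs moves_def)
  qed
  ultimately have bound: "S a \<le> 3 * int n" "S a' \<le> 3 * int n" "S b \<le> 3 * int n" "S b' \<le> 3 * int n"
    using eq Snn by linarith+
  have le: "h k \<le> S h" if "\<And>k. 0 \<le> h k" for h
    unfolding S_def by (rule member_le_sum) (use that k in auto)
  have "capacity Y k - capacity X k = ?p k + ?q k" by (simp add: capacity_def)
  also have "\<dots> = a k - a' k + (b k - b' k)"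
    using units_decomposition[where p="?p k" and q="?q k"] unfolding defs by linarith
  finally show ?thesis
    using le[of a, OF nn(1)] le[of a', OF nn(2)] le[of b, OF nn(3)] le[of b', OF nn(4)] bound nn[of k] by linarith
qed

\<comment> \<open>keeps \<open>{1..n}\<close> in this form\<close>
declare One_nat_def [simp del]

section \<open>Stations as an M-convex problem\<close>

text \<open>
  The origin stands for the initial allocation, and the arguments of \<open>f\<close> count changes from it in units
  of the step length. The last assumption holds because an additional dock never raises a cost from
  finite to infinite as long as the station does not exceed its initial number of docks, hence not
  its maximal number.
\<close>

locale multimodular_stations =
  fixes n :: nat and f :: "nat \<Rightarrow> int \<Rightarrow> int \<Rightarrow> ereal"
  assumes f_nonneg: "0 \<le> f k x y"
    and f_multimodular: "k \<in> {1..n} \<Longrightarrow> multimodular (f k)"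
    and f_bounded: "\<exists>K. \<forall>k\<in>{1..n}. \<forall>x y. f k x y < \<infinity> \<longrightarrow> \<bar>x\<bar> \<le> K \<and> \<bar>y\<bar> \<le> K"
    and f_origin: "k \<in> {1..n} \<Longrightarrow> f k 0 0 < \<infinity>"
    and f_grow: "\<lbrakk>k \<in> {1..n}; f k x y < \<infinity>; x + y < 0\<rbrakk> \<Longrightarrow> f k (x + 1) y < \<infinity> \<and> f k x (y + 1) < \<infinity>"
begin

abbreviation "V \<equiv> {1..n}"
abbreviation "F \<equiv> objective n f"

lemma F_nonneg: "0 \<le> F X"
  by (simp add: objective_def sum_nonneg f_nonneg)

lemma F_cong:
  "(\<And>k. k \<in> V \<Longrightarrow> fst X k = fst Y k \<and> snd X k = snd Y k) \<Longrightarrow> F X = F Y"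
  unfolding objective_def by (rule sum.cong) auto

lemma F_finite_iff: "F X < \<infinity> \<longleftrightarrow> (\<forall>k\<in>V. f k (fst X k) (snd X k) < \<infinity>)"
  unfolding objective_def using f_nonneg by (auto simp: sum_Pinfty)

lemma F_exchange:
  assumes "fits_alloc n U X Y"
  shows "F (plus_alloc X U) + F (minus_alloc Y U) \<le> F X + F Y"
  unfolding objective_def sum.distrib[symmetric]
proof (rule sum_mono)
  fix k assume k: "k \<in> V"
  have "fits (fst U k) (snd U k) (fst Y k - fst X k) (snd Y k - snd X k)"
    using assms k by (simp add: fits_alloc_def)
  from f_multimodular[OF k, unfolded multimodular_def, rule_format, OF this, of "fst X k" "snd X k"]
  show "f k (fst (plus_alloc X U) k) (snd (plus_alloc X U) k) + f k (fst (minus_alloc Y U) k) (snd (minus_alloc Y U) k)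
      \<le> f k (fst X k) (snd X k) + f k (fst Y k) (snd Y k)"
    by (simp add: plus_alloc_def minus_alloc_def)
qed

definition with_bikes :: "(nat \<Rightarrow> int) \<Rightarrow> (nat \<Rightarrow> int) \<Rightarrow> alloc" where
  "with_bikes x \<beta> = (\<lambda>k. x k - \<beta> k, \<beta>)"

lemma with_bikes_simps [simp]:
  "fst (with_bikes x \<beta>) k = x k - \<beta> k" "snd (with_bikes x \<beta>) = \<beta>"
  "capacity (with_bikes x \<beta>) = x" "with_bikes (capacity X) (snd X) = X"
  by (auto simp: with_bikes_def capacity_def)

lemma balanced_with_bikes:
  "(\<Sum>k\<in>V. x k) = 0 \<Longrightarrow> (\<Sum>k\<in>V. \<beta> k) = 0 \<Longrightarrow> balanced n (with_bikes x \<beta>)"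
  by (simp add: balanced_def sum_subtractf)

definition bike_cost :: "(nat \<Rightarrow> int) \<Rightarrow> (nat \<Rightarrow> int) \<Rightarrow> ereal" where
  "bike_cost x \<beta> = (if (\<Sum>k\<in>V. \<beta> k) = 0 then F (with_bikes x \<beta>) else \<infinity>)"

lemma bike_cost_cong:
  assumes "\<And>k. k \<in> V \<Longrightarrow> x k = x' k" "\<And>k. k \<in> V \<Longrightarrow> \<beta> k = \<beta>' k"
  shows "bike_cost x \<beta> = bike_cost x' \<beta>'"
  using assms F_cong[of "with_bikes x \<beta>" "with_bikes x' \<beta>'"] by (auto simp: bike_cost_def)

lemma bike_cost_snd: "balanced n X \<Longrightarrow> bike_cost (capacity X) (snd X) = F X"
  by (simp add: bike_cost_def balanced_def)

lemma bike_move_with_bikes: "bike_move 1 i j X = with_bikes (capacity X) (transfer j i (snd X))"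
  by (cases X) (auto simp: with_bikes_def capacity_def transfer_def)

lemma minus_bike_vec: "minus_alloc X (bike_vec 1 i j) = with_bikes (capacity X) (transfer i j (snd X))"
  by (auto simp: minus_alloc_def with_bikes_def capacity_def transfer_def zero_alloc_def)

lemma sum_transfer_id:
  assumes "i \<in> V" "j \<in> V"
  shows "(\<Sum>k\<in>V. transfer i j x k) = (\<Sum>k\<in>V. x k)"
  using sum_transfer[of V i j "\<lambda>k t. t" x] assms by (cases "i = j") auto

lemma M_convex_bike_cost:
  "M_convex V (bike_cost x)"
proof
  show "finite V" by simp
  show "0 \<le> bike_cost x \<beta>" for \<beta> by (simp add: bike_cost_def F_nonneg)
  show "bike_cost x \<beta> = bike_cost x \<gamma>" if "\<And>k. k \<in> V \<Longrightarrow> \<beta> k = \<gamma> k" for \<beta> \<gamma>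
    by (rule bike_cost_cong) (use that in auto)
  obtain K where K: "\<forall>k\<in>V. \<forall>x y. f k x y < \<infinity> \<longrightarrow> \<bar>x\<bar> \<le> K \<and> \<bar>y\<bar> \<le> K" using f_bounded by blast
  show "\<exists>K. \<forall>\<beta>. bike_cost x \<beta> < \<infinity> \<longrightarrow> (\<forall>k\<in>V. \<bar>\<beta> k\<bar> \<le> K)"
    using K by (intro exI[of _ K]) (auto simp only: bike_cost_def F_finite_iff with_bikes_simps split: if_splits)
next
  fix \<beta> \<gamma> i assume *: "bike_cost x \<beta> < \<infinity>" "bike_cost x \<gamma> < \<infinity>" "i \<in> V" "\<gamma> i < \<beta> i"
  have sums: "(\<Sum>k\<in>V. \<beta> k) = 0" "(\<Sum>k\<in>V. \<gamma> k) = 0"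
    using *(1,2) by (auto simp: bike_cost_def split: if_splits)
  have "\<exists>j\<in>V. \<beta> j < \<gamma> j"
  proof (rule ccontr)
    assume "\<not> ?thesis"
    then have "(\<Sum>k\<in>V. \<gamma> k) < (\<Sum>k\<in>V. \<beta> k)" using *(3,4) by (intro sum_strict_mono_ex1) force+
    then show False using sums by simp
  qed
  then obtain j where j: "j \<in> V" "\<beta> j < \<gamma> j" by blast
  let ?X = "with_bikes x \<beta>" and ?Y = "with_bikes x \<gamma>"
  have "fits_alloc n (bike_vec 1 j i) ?X ?Y"
    by (rule fits_bike_vec[THEN conjunct2]) (use * j in \<open>auto simp: swap_units_def\<close>)
  then have "F (with_bikes x (transfer i j \<beta>)) + F (with_bikes x (transfer j i \<gamma>)) \<le> F ?X + F ?Y"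
    using F_exchange[of "bike_vec 1 j i" ?X ?Y] unfolding plus_bike_vec bike_move_with_bikes[of _ _ ?X] minus_bike_vec by simp
  then show "\<exists>j\<in>V. \<beta> j < \<gamma> j \<and>
      bike_cost x (transfer i j \<beta>) + bike_cost x (transfer j i \<gamma>) \<le> bike_cost x \<beta> + bike_cost x \<gamma>"
    using j *(3) sums by (intro bexI[of _ j]) (simp_all add: bike_cost_def sum_transfer_id)
qed

definition dock_cost :: "(nat \<Rightarrow> int) \<Rightarrow> ereal" where
  "dock_cost x = (if (\<Sum>k\<in>V. x k) = 0 then INF \<beta>. bike_cost x \<beta> else \<infinity>)"

definition bike_optimal :: "alloc \<Rightarrow> bool" where
  "bike_optimal X \<longleftrightarrow> balanced n X \<and> F X < \<infinity> \<and> dock_cost (capacity X) = F X"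

lemma dock_cost_le: "balanced n X \<Longrightarrow> dock_cost (capacity X) \<le> F X"
  unfolding dock_cost_def bike_cost_snd[symmetric]
  using sum_capacity by (auto intro: INF_lower)

lemma is_min_bike_costD:
  assumes "is_min (bike_cost x) \<beta>" "(\<Sum>k\<in>V. x k) = 0"
  shows "bike_optimal (with_bikes x \<beta>)"
proof -
  have s: "(\<Sum>k\<in>V. \<beta> k) = 0" using assms(1) by (auto simp: is_min_def bike_cost_def split: if_splits)
  have "(INF \<beta>. bike_cost x \<beta>) = bike_cost x \<beta>"
    by (rule antisym) (use assms(1) in \<open>auto simp: is_min_def intro: INF_lower INF_greatest\<close>)
  then show ?thesis
    using assms s by (auto simp: bike_optimal_def dock_cost_def bike_cost_def is_min_def balanced_with_bikes)
qed

lemma bike_optimal_le: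
  assumes "bike_optimal X" "balanced n Y" "capacity Y = capacity X"
  shows "F X \<le> F Y"
  using dock_cost_le[OF assms(2)] assms by (simp add: bike_optimal_def)

lemma dock_cost_attained:
  assumes "dock_cost x < \<infinity>"
  obtains X where "bike_optimal X" "capacity X = x"
proof -
  have s: "(\<Sum>k\<in>V. x k) = 0" using assms by (auto simp: dock_cost_def split: if_splits)
  then have "(INF \<beta>. bike_cost x \<beta>) < \<infinity>" using assms by (simp add: dock_cost_def)
  then obtain \<beta> where "bike_cost x \<beta> < \<infinity>" unfolding INF_less_iff by blast
  then obtain m where "is_min (bike_cost x) m"
    using M_convex.minimum_exists[OF M_convex_bike_cost] by blast
  then show ?thesis using that[of "with_bikes x m"] is_min_bike_costD s by simp
qed

text \<open>
  The exchange is made along a dock-move between bike-optimal allocations for the two vectors.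
\<close>

lemma M_convex_dock_cost: "M_convex V dock_cost"
proof
  show "finite V" by simp
  show nn: "0 \<le> dock_cost x" for x
  proof -
    have "0 \<le> bike_cost x \<beta>" for \<beta> by (simp add: bike_cost_def F_nonneg)
    then show ?thesis by (simp add: dock_cost_def INF_greatest)
  qed
  show "dock_cost x = dock_cost y" if "\<And>k. k \<in> V \<Longrightarrow> x k = y k" for x y
  proof -
    have "bike_cost x \<beta> = bike_cost y \<beta>" for \<beta> by (rule bike_cost_cong) (use that in auto)
    then show ?thesis using that by (simp add: dock_cost_def)
  qed
  obtain K where K: "\<forall>k\<in>V. \<forall>x y. f k x y < \<infinity> \<longrightarrow> \<bar>x\<bar> \<le> K \<and> \<bar>y\<bar> \<le> K" using f_bounded by blast
  have "\<bar>x k\<bar> \<le> 2 * K" if x: "dock_cost x < \<infinity>" and k: "k \<in> V" for x k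
  proof -
    obtain X where X: "bike_optimal X" "capacity X = x" by (rule dock_cost_attained[OF x])
    then have "f k (fst X k) (snd X k) < \<infinity>" using k F_finite_iff unfolding bike_optimal_def by blast
    then have "\<bar>fst X k\<bar> \<le> K \<and> \<bar>snd X k\<bar> \<le> K" using K k by blast
    then show ?thesis using X(2) by (auto simp: capacity_def)
  qed
  then show "\<exists>K. \<forall>x. dock_cost x < \<infinity> \<longrightarrow> (\<forall>k\<in>V. \<bar>x k\<bar> \<le> K)" by blast
next
  fix x y i assume *: "dock_cost x < \<infinity>" "dock_cost y < \<infinity>" "i \<in> V" "y i < x i"
  obtain X where X: "bike_optimal X" "capacity X = x" by (rule dock_cost_attained[OF *(1)])
  obtain Y where Y: "bike_optimal Y" "capacity Y = y" by (rule dock_cost_attained[OF *(2)])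
  have bal: "balanced n X" "balanced n Y" using X Y by (auto simp: bike_optimal_def)
  obtain j m where j: "j \<in> V" "x j < y j" and m: "m \<in> moves n i j" "fits_alloc n (move_vec 1 m) X Y"
    using dock_move_between[OF bal *(3)] X Y * by auto
  have bm: "balanced n (move_vec 1 m)" by (rule balanced_move_vec[OF *(3) j(1) m(1)])
  have "dock_cost (transfer i j x) + dock_cost (transfer j i y)
      \<le> F (plus_alloc X (move_vec 1 m)) + F (minus_alloc Y (move_vec 1 m))"
    using dock_cost_le[OF balanced_plus[OF bal(1) bm]] dock_cost_le[OF balanced_minus[OF bal(2) bm]] X Y m(1)
    by (intro add_mono) (simp_all add: plus_move_vec capacity_apply_move minus_alloc_move_capacity)
  also have "\<dots> \<le> F X + F Y" by (rule F_exchange[OF m(2)])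
  also have "\<dots> = dock_cost x + dock_cost y" using X Y by (auto simp: bike_optimal_def)
  finally show "\<exists>j\<in>V. x j < y j \<and> dock_cost (transfer i j x) + dock_cost (transfer j i y) \<le> dock_cost x + dock_cost y"
    using j by blast
qed

sublocale docks: M_convex V dock_cost
  by (rule M_convex_dock_cost)

text \<open>
  However far the bikes must be rearranged after the transfer of a dock: the change to their optimal
  positions contains a dock-move, and the rest of the change only moves bikes, which does not pay.
\<close>

lemma dock_move_le:
  assumes X: "bike_optimal X" and ij: "i \<in> V" "j \<in> V" "i \<noteq> j"
  shows "\<exists>m\<in>moves n i j. F (apply_move 1 m X) \<le> dock_cost (transfer i j (capacity X))"
proof (cases "dock_cost (transfer i j (capacity X)) < \<infinity>")
  case False
  then show ?thesis by (intro bexI[of _ "Empty_Move i j"]) (auto simp: moves_def)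
next
  case True
  then obtain Y where Y: "bike_optimal Y" "capacity Y = transfer i j (capacity X)"
    by (rule dock_cost_attained)
  have bal: "balanced n X" "balanced n Y" using X Y by (auto simp: bike_optimal_def)
  have "capacity Y i < capacity X i" using Y ij by (simp add: transfer_apply)
  from dock_move_between[OF bal ij(1) this] obtain j' m where
    j': "j' \<in> V" "capacity X j' < capacity Y j'" and m: "m \<in> moves n i j'" "fits_alloc n (move_vec 1 m) X Y"
    by blast
  have "j' = j" using j'(2) Y(2) ij(3) by (auto simp: transfer_apply split: if_splits)
  with m have m: "m \<in> moves n i j" "fits_alloc n (move_vec 1 m) X Y" by auto
  have bm: "balanced n (move_vec 1 m)" by (rule balanced_move_vec[OF ij(1,2) m(1)])
  have "capacity (minus_alloc Y (move_vec 1 m)) = capacity X"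
    by (auto simp: minus_alloc_move_capacity[OF m(1)] Y(2) transfer_def)
  then have le: "F X \<le> F (minus_alloc Y (move_vec 1 m))"
    using bike_optimal_le[OF X balanced_minus[OF bal(2) bm]] by simp
  have "F (plus_alloc X (move_vec 1 m)) \<le> F Y"
    by (rule ereal_add_le_cancel[OF _ le])
      (use F_exchange[OF m(2)] X Y F_nonneg in \<open>auto simp: add.commute bike_optimal_def\<close>)
  then show ?thesis using m Y by (auto simp: plus_move_vec bike_optimal_def)
qed

lemma dock_cost_move_le:
  assumes "balanced n X" "i \<in> V" "j \<in> V" "m \<in> moves n i j"
  shows "dock_cost (transfer i j (capacity X)) \<le> F (apply_move 1 m X)"
  using dock_cost_le[OF balanced_plus[OF assms(1) balanced_move_vec[OF assms(2-4), of 1]]]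
  by (simp add: plus_move_vec capacity_apply_move[OF assms(4)])

lemma best_move_bike_optimal:
  assumes X: "bike_optimal X" and ij: "i \<in> V" "j \<in> V" "i \<noteq> j" and m: "m \<in> moves n i j"
    and best: "\<And>m'. m' \<in> moves n i j \<Longrightarrow> F (apply_move 1 m X) \<le> F (apply_move 1 m' X)"
  shows "F (apply_move 1 m X) = dock_cost (transfer i j (capacity X))"
    and "capacity (apply_move 1 m X) = transfer i j (capacity X)"
    and "F (apply_move 1 m X) < \<infinity> \<Longrightarrow> bike_optimal (apply_move 1 m X)"
proof -
  have bal: "balanced n X" using X by (simp add: bike_optimal_def)
  show 1: "F (apply_move 1 m X) = dock_cost (transfer i j (capacity X))"
  proof (rule antisym)
    obtain m' where "m' \<in> moves n i j" "F (apply_move 1 m' X) \<le> dock_cost (transfer i j (capacity X))"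
      using dock_move_le[OF X ij] by blast
    then show "F (apply_move 1 m X) \<le> dock_cost (transfer i j (capacity X))"
      using best order_trans by blast
  qed (rule dock_cost_move_le[OF bal ij(1,2) m])
  show 2: "capacity (apply_move 1 m X) = transfer i j (capacity X)"
    by (rule capacity_apply_move[OF m])
  show "bike_optimal (apply_move 1 m X)" if "F (apply_move 1 m X) < \<infinity>"
    using 1 2 that balanced_plus[OF bal balanced_move_vec[OF ij(1,2) m, of 1]]
    by (simp add: bike_optimal_def plus_move_vec)
qed

text \<open>
  Multimodularity between the current state of the surplus station \<open>i\<close> and the origin lets \<open>i\<close> give an
  empty or a full dock at finite cost, and the deficit station can take either by \<open>f_grow\<close>.
\<close>

lemma towards_origin_finite:
  assumes X: "bike_optimal X" and i: "i \<in> V" "0 < capacity X i" and j: "j \<in> V" "capacity X j < 0"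
  shows "dock_cost (transfer i j (capacity X)) < \<infinity>"
proof -
  have ne: "i \<noteq> j" using i j by auto
  have bal: "balanced n X" and fin: "\<forall>k\<in>V. f k (fst X k) (snd X k) < \<infinity>"
    using X F_finite_iff unfolding bike_optimal_def by auto
  let ?x = "fst X i" and ?y = "snd X i"
  have part: "f i (?x + u) (?y + v) < \<infinity>" if "fits u v (- ?x) (- ?y)" for u v
  proof -
    have "f i (?x + u) (?y + v) + f i (?x + - ?x - u) (?y + - ?y - v) \<le> f i ?x ?y + f i (?x + - ?x) (?y + - ?y)"
      using f_multimodular[OF i(1)] that unfolding multimodular_def by blast
    then have "f i (?x + u) (?y + v) \<le> f i ?x ?y + f i 0 0"
      using f_nonneg[of i] by (simp add: add_increasing2 order_trans[rotated])
    also have "\<dots> < \<infinity>" using fin i(1) f_origin[OF i(1)] by (auto simp: less_top)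
    finally show ?thesis .
  qed
  have grow: "f j (fst X j + 1) (snd X j) < \<infinity>" "f j (fst X j) (snd X j + 1) < \<infinity>"
    using f_grow[OF j(1)] fin j by (auto simp: capacity_def)
  have "\<exists>m\<in>moves n i j. F (apply_move 1 m X) < \<infinity>"
  proof (cases "fits (- 1) 0 (- ?x) (- ?y)")
    case True
    have "F (apply_move 1 (Empty_Move i j) X) < \<infinity>"
      unfolding F_finite_iff
    proof
      fix k assume "k \<in> V"
      then show "f k (fst (apply_move 1 (Empty_Move i j) X) k) (snd (apply_move 1 (Empty_Move i j) X) k) < \<infinity>"
        using part[OF True] grow fin ne by (cases X) (auto simp: unit_vec_def)
    qed
    then show ?thesis by (auto simp: moves_def)
  next
    case False
    then have "fits 0 (- 1) (- ?x) (- ?y)"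
      using i(2) by (auto simp: fits_def conforms_def capacity_def)
    note part = part[OF this]
    have "F (apply_move 1 (Full_Move i j) X) < \<infinity>"
      unfolding F_finite_iff
    proof
      fix k assume "k \<in> V"
      then show "f k (fst (apply_move 1 (Full_Move i j) X) k) (snd (apply_move 1 (Full_Move i j) X) k) < \<infinity>"
        using part grow fin ne by (cases X) (auto simp: unit_vec_def)
    qed
    then show ?thesis by (auto simp: moves_def)
  qed
  then show ?thesis using dock_cost_move_le[OF bal i(1) j(1)] by (auto intro: le_less_trans)
qed

section \<open>Proximity of optima at consecutive scales\<close>

definition penalized_cost :: "real \<Rightarrow> alloc \<Rightarrow> ereal" where
  "penalized_cost r X = F X + ereal (r * of_int (norm1 V (capacity X)))"

lemma penalized_cost_exchange:
  assumes "0 \<le> r" and fits: "fits_alloc n U X Y"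
  shows "penalized_cost r (plus_alloc X U) + penalized_cost r (minus_alloc Y U)
    \<le> penalized_cost r X + penalized_cost r Y"
proof -
  let ?N = "\<lambda>X. norm1 V (capacity X)"
  have "?N (plus_alloc X U) + ?N (minus_alloc Y U) \<le> ?N X + ?N Y"
    unfolding norm1_def sum.distrib[symmetric]
  proof (rule sum_mono)
    fix k assume "k \<in> V"
    then have "conforms (fst U k + snd U k) (fst Y k - fst X k + (snd Y k - snd X k))"
      using fits unfolding fits_alloc_def fits_def by blast
    then have "conforms (capacity U k) (capacity Y k - capacity X k)"
      by (simp add: capacity_def algebra_simps)
    then show "\<bar>capacity (plus_alloc X U) k\<bar> + \<bar>capacity (minus_alloc Y U) k\<bar> \<le> \<bar>capacity X k\<bar> + \<bar>capacity Y k\<bar>"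
      unfolding capacity_plus capacity_minus conforms_def by linarith
  qed
  then have "r * of_int (?N (plus_alloc X U) + ?N (minus_alloc Y U)) \<le> r * of_int (?N X + ?N Y)"
    using assms(1) by (intro mult_left_mono) linarith+
  then have "ereal (r * of_int (?N (plus_alloc X U))) + ereal (r * of_int (?N (minus_alloc Y U)))
      \<le> ereal (r * of_int (?N X)) + ereal (r * of_int (?N Y))"
    by (simp add: algebra_simps)
  from add_mono[OF F_exchange[OF fits] this] show ?thesis
    by (simp add: penalized_cost_def ac_simps)
qed

lemma penalized_cost_nonneg: "0 \<le> r \<Longrightarrow> 0 \<le> penalized_cost r X"
  by (auto simp: penalized_cost_def F_nonneg norm1_nonneg)

lemma penalized_cost_finite: "penalized_cost r X < \<infinity> \<longleftrightarrow> F X < \<infinity>"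
  by (cases "F X") (auto simp: penalized_cost_def)

lemma penalized_dock_cost_le:
  "balanced n X \<Longrightarrow> docks.penalized r (capacity X) \<le> penalized_cost r X"
  unfolding docks.penalized_def penalized_cost_def by (intro add_mono dock_cost_le) auto

lemma penalized_dock_cost_eq:
  "bike_optimal X \<Longrightarrow> docks.penalized r (capacity X) = penalized_cost r X"
  by (simp add: docks.penalized_def penalized_cost_def bike_optimal_def)

definition optimal :: "real \<Rightarrow> alloc \<Rightarrow> bool" where
  "optimal r X \<longleftrightarrow> balanced n X \<and> F X < \<infinity> \<and> (\<forall>Y. balanced n Y \<longrightarrow> penalized_cost r X \<le> penalized_cost r Y)"

lemma optimal_iff: "optimal r X \<longleftrightarrow> bike_optimal X \<and> is_min (docks.penalized r) (capacity X)"
proof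
  assume X: "optimal r X"
  have le: "penalized_cost r X \<le> docks.penalized r x" for x
  proof (cases "dock_cost x < \<infinity>")
    case True
    then obtain Y where Y: "bike_optimal Y" "capacity Y = x" by (rule dock_cost_attained)
    then have "penalized_cost r X \<le> penalized_cost r Y"
      using X unfolding optimal_def bike_optimal_def by blast
    then show ?thesis using Y penalized_dock_cost_eq[of Y r] by simp
  next
    case False
    then show ?thesis by (simp add: docks.penalized_def)
  qed
  have "F X \<le> dock_cost (capacity X)"
    using le[of "capacity X"] by (simp add: penalized_cost_def docks.penalized_def)
      (cases "F X"; cases "dock_cost (capacity X)"; simp)
  then have bo: "bike_optimal X"
    using X dock_cost_le[of X] by (auto simp: optimal_def bike_optimal_def)
  then show "bike_optimal X \<and> is_min (docks.penalized r) (capacity X)"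
    using le X penalized_dock_cost_eq[OF bo, of r] penalized_cost_finite[of r X]
    by (auto simp: is_min_def optimal_def)
next
  assume *: "bike_optimal X \<and> is_min (docks.penalized r) (capacity X)"
  have "penalized_cost r X \<le> penalized_cost r Y" if "balanced n Y" for Y
  proof -
    have "penalized_cost r X = docks.penalized r (capacity X)" using * penalized_dock_cost_eq by simp
    also have "\<dots> \<le> docks.penalized r (capacity Y)" using * by (simp add: is_min_def)
    also have "\<dots> \<le> penalized_cost r Y" by (rule penalized_dock_cost_le[OF that])
    finally show ?thesis .
  qed
  then show "optimal r X" using * by (auto simp: optimal_def bike_optimal_def)
qed

text \<open>
  Let \<open>X\<close> be optimal among the changes by even vectors and \<open>Y\<close> a nearest optimum. A circuit
  that fits twice into the change from \<open>X\<close> to \<open>Y\<close> could be applied twice to \<open>X\<close> without gain, so \<open>Y\<close> with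
  the circuit undone twice would be optimal and nearer.
\<close>

lemma proximity:
  assumes r: "0 \<le> r" and bal: "balanced n X" and fin: "F X < \<infinity>"
    and even_opt: "\<And>U. balanced n U \<Longrightarrow> penalized_cost r X \<le> penalized_cost r (plus_alloc X (scale_alloc 2 U))"
  shows "\<exists>Y. optimal r Y \<and> (\<forall>k\<in>V. \<bar>capacity Y k - capacity X k\<bar> \<le> 6 * int n)"
proof -
  interpret P: M_convex V "docks.penalized r" by (rule docks.M_convex_penalized[OF r])
  have "docks.penalized r (capacity X) < \<infinity>"
    using penalized_dock_cost_le[OF bal, of r] fin penalized_cost_finite[of r X] by (auto intro: le_less_trans)
  then obtain m where m: "is_min (docks.penalized r) m" by (rule P.minimum_exists)
  then have "dock_cost m < \<infinity>" by (rule docks.penalized_min_finite)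
  then obtain Y1 where Y1: "bike_optimal Y1" "capacity Y1 = m" by (rule dock_cost_attained)
  then have Y1: "optimal r Y1" using m by (simp add: optimal_iff)
  define d where "d Y = nat (dist1 V (fst Y) (fst X) + dist1 V (snd Y) (snd X))" for Y :: alloc
  obtain Y where Y: "optimal r Y" and near: "\<And>Z. optimal r Z \<Longrightarrow> d Y \<le> d Z"
    using ex_has_least_nat[of "optimal r" Y1 d] Y1 by blast
  have balY: "balanced n Y" and finY: "F Y < \<infinity>" using Y by (auto simp: optimal_def)
  have no: "\<not> fits_alloc n (scale_alloc 2 U) X Y"
    if U: "balanced n U" and nz: "\<exists>k\<in>V. fst U k \<noteq> 0 \<or> snd U k \<noteq> 0" for U
  proof
    let ?U = "scale_alloc 2 U"
    assume fits: "fits_alloc n ?U X Y"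
    have "penalized_cost r (minus_alloc Y ?U) \<le> penalized_cost r Y"
    proof (rule ereal_add_le_cancel[OF _ even_opt[OF U]])
      show "penalized_cost r (minus_alloc Y ?U) + penalized_cost r (plus_alloc X ?U)
          \<le> penalized_cost r Y + penalized_cost r X"
        using penalized_cost_exchange[OF r fits] by (simp add: add.commute)
      show "penalized_cost r X < \<infinity>" "penalized_cost r Y < \<infinity>"
        unfolding penalized_cost_finite by (fact fin finY)+
    qed (rule penalized_cost_nonneg[OF r])+
    moreover have "F (minus_alloc Y ?U) < \<infinity>"
      using calculation finY penalized_cost_finite le_less_trans by metis
    ultimately have "optimal r (minus_alloc Y ?U)"
      using Y balanced_minus[OF balY balanced_scale[OF U]] order_trans unfolding optimal_def by blast
    then have "d Y \<le> d (minus_alloc Y ?U)" by (rule near)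
    moreover have "dist1 V (fst (minus_alloc Y ?U)) (fst X) + dist1 V (snd (minus_alloc Y ?U)) (snd X) <
        dist1 V (fst Y) (fst X) + dist1 V (snd Y) (snd X)"
      unfolding dist1_def sum.distrib[symmetric]
    proof (rule sum_strict_mono_ex1)
      have *: "conforms (2 * fst U k) (fst Y k - fst X k)" "conforms (2 * snd U k) (snd Y k - snd X k)" if "k \<in> V" for k
        using fits that by (auto simp: fits_alloc_def fits_def scale_alloc_def)
      have fst_step: "\<bar>fst (minus_alloc Y ?U) k - fst X k\<bar> = \<bar>fst Y k - fst X k\<bar> - 2 * \<bar>fst U k\<bar>" if "k \<in> V" for k
        using *(1)[OF that] by (auto simp: minus_alloc_def scale_alloc_def conforms_def)
      have snd_step: "\<bar>snd (minus_alloc Y ?U) k - snd X k\<bar> = \<bar>snd Y k - snd X k\<bar> - 2 * \<bar>snd U k\<bar>" if "k \<in> V" for k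
        using *(2)[OF that] by (auto simp: minus_alloc_def scale_alloc_def conforms_def)
      show "\<forall>k\<in>V. \<bar>fst (minus_alloc Y ?U) k - fst X k\<bar> + \<bar>snd (minus_alloc Y ?U) k - snd X k\<bar>
          \<le> \<bar>fst Y k - fst X k\<bar> + \<bar>snd Y k - snd X k\<bar>"
      proof
        fix k assume "k \<in> V"
        then show "\<bar>fst (minus_alloc Y ?U) k - fst X k\<bar> + \<bar>snd (minus_alloc Y ?U) k - snd X k\<bar>
          \<le> \<bar>fst Y k - fst X k\<bar> + \<bar>snd Y k - snd X k\<bar>"
          using fst_step[of k] snd_step[of k] by linarith
      qed
      obtain k where "k \<in> V" "fst U k \<noteq> 0 \<or> snd U k \<noteq> 0" using nz by blast
      then show "\<exists>k\<in>V. \<bar>fst (minus_alloc Y ?U) k - fst X k\<bar> + \<bar>snd (minus_alloc Y ?U) k - snd X k\<bar>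
          < \<bar>fst Y k - fst X k\<bar> + \<bar>snd Y k - snd X k\<bar>"
        using fst_step[of k] snd_step[of k] by (intro bexI[of _ k]) auto
    qed simp
    ultimately show False
      unfolding d_def by (subst (asm) nat_le_eq_zle) (simp_all add: dist1_nonneg add_nonneg_nonneg)
  qed
  have "\<bar>capacity Y k - capacity X k\<bar> \<le> 6 * int n" if "k \<in> V" for k
  proof (rule small_change[OF bal balY _ _ that])
    fix i j m assume ij: "i \<in> V" "j \<in> V" "i \<noteq> j" and m: "m \<in> moves n i j"
    have "capacity (move_vec 1 m) i \<noteq> 0" using ij by (simp add: capacity_move_vec[OF m] unit_vec_def)
    then have "fst (move_vec 1 m) i \<noteq> 0 \<or> snd (move_vec 1 m) i \<noteq> 0" by (auto simp: capacity_def)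
    then show "\<not> fits_alloc n (move_vec 2 m) X Y"
      unfolding move_vec_scale[of 2] using no[OF balanced_move_vec[OF ij(1,2) m]] ij by blast
  next
    fix i j assume ij: "i \<in> V" "j \<in> V" "i \<noteq> j"
    have "snd (bike_vec 1 i j) i \<noteq> 0" using ij by (simp add: zero_alloc_def unit_vec_def)
    then show "\<not> fits_alloc n (bike_vec 2 i j) X Y"
      unfolding bike_vec_scale[of 2] using no[OF balanced_bike_vec[OF ij(1,2)]] ij by blast
  qed
  then show ?thesis using Y by blast
qed

text \<open>The same for bikes alone, where the only circuits are exchanges between two stations.\<close>

lemma bike_proximity:
  assumes bal: "balanced n X" and fin: "F X < \<infinity>"
    and even_opt: "\<And>U. balanced n U \<Longrightarrow> capacity U = (\<lambda>_. 0) \<Longrightarrow> F X \<le> F (plus_alloc X (scale_alloc 2 U))"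
  shows "\<exists>\<beta>. is_min (bike_cost (capacity X)) \<beta> \<and> dist1 V (snd X) \<beta> \<le> 2 * int n"
proof -
  let ?g = "bike_cost (capacity X)"
  interpret M_convex V ?g by (rule M_convex_bike_cost)
  have gX: "?g (snd X) = F X" by (rule bike_cost_snd[OF bal])
  obtain m where "is_min ?g m" using minimum_exists[of "snd X"] fin gX by auto
  then obtain \<beta> where b: "is_min ?g \<beta>" and near: "\<And>\<gamma>. is_min ?g \<gamma> \<Longrightarrow> dist1 V (snd X) \<beta> \<le> dist1 V (snd X) \<gamma>"
    using nearest_exists[of "is_min ?g" m V "snd X"] by blast
  have bfin: "?g \<beta> < \<infinity>" using b by (simp add: is_min_def)
  have sb: "(\<Sum>k\<in>V. \<beta> k) = 0" using bfin by (auto simp: bike_cost_def split: if_splits)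
  let ?Y = "with_bikes (capacity X) \<beta>"
  have gb: "?g \<beta> = F ?Y" using sb by (simp add: bike_cost_def)
  have no2: "\<not> (snd X i \<le> \<beta> i - 2 \<and> \<beta> j + 2 \<le> snd X j)" if ij: "i \<in> V" "j \<in> V" for i j
  proof
    assume *: "snd X i \<le> \<beta> i - 2 \<and> \<beta> j + 2 \<le> snd X j"
    let ?U = "bike_vec 1 i j" and ?U2 = "bike_vec 2 i j"
    have bU: "balanced n ?U" by (rule balanced_bike_vec[OF ij])
    have fits: "fits_alloc n ?U2 X ?Y"
      by (rule fits_bike_vec[THEN conjunct2]) (use * in \<open>auto simp: swap_units_def capacity_def\<close>)
    have ne: "i \<noteq> j" using * by auto
    let ?\<gamma> = "transfer i j (transfer i j \<beta>)"
    have eq: "minus_alloc ?Y ?U2 = with_bikes (capacity X) ?\<gamma>"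
      by (auto simp: minus_alloc_def with_bikes_def transfer_def zero_alloc_def unit_vec_def)
    have "F X \<le> F (plus_alloc X ?U2)"
      unfolding bike_vec_scale[of 2] by (rule even_opt[OF bU]) (simp add: capacity_bike_vec)
    from ereal_add_le_cancel[OF _ this, of "F (minus_alloc ?Y ?U2)" "F ?Y"]
    have "F (minus_alloc ?Y ?U2) \<le> F ?Y"
      using F_exchange[OF fits] F_nonneg fin bfin gb by (simp add: add.commute)
    then have "?g ?\<gamma> \<le> ?g \<beta>"
      using sb gb eq ij by (simp add: bike_cost_def sum_transfer_id)
    then have "is_min ?g ?\<gamma>" using b by (auto simp: is_min_def intro: order_trans)
    then have "dist1 V (snd X) \<beta> \<le> dist1 V (snd X) ?\<gamma>" by (rule near)
    moreover have "dist1 V (snd X) (transfer i j \<beta>) = dist1 V (snd X) \<beta> - 2"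
      using dist1_transfer[OF _ ij ne, of "snd X" \<beta>] * by simp
    moreover have "dist1 V (snd X) ?\<gamma> = dist1 V (snd X) (transfer i j \<beta>) - 2"
      using dist1_transfer[OF _ ij ne, of "snd X" "transfer i j \<beta>"] * ne by (simp add: transfer_apply)
    ultimately show False by simp
  qed
  have one_sided: "(\<forall>k\<in>V. \<beta> k - snd X k \<le> 1) \<or> (\<forall>k\<in>V. snd X k - \<beta> k \<le> 1)"
  proof (rule ccontr)
    assume "\<not> ?thesis"
    then obtain i j where "i \<in> V" "j \<in> V" "\<not> \<beta> i - snd X i \<le> 1" "\<not> snd X j - \<beta> j \<le> 1" by blast
    then show False using no2[of i j] by linarith
  qed
  have s0: "(\<Sum>k\<in>V. \<beta> k - snd X k) = 0"
    using sb bal by (simp add: sum_subtractf balanced_def)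
  have dist: "dist1 V (snd X) \<beta> = 2 * (\<Sum>k\<in>V. max 0 (\<beta> k - snd X k))"
    "dist1 V (snd X) \<beta> = 2 * (\<Sum>k\<in>V. max 0 (snd X k - \<beta> k))"
  proof -
    have "dist1 V (snd X) \<beta> = (\<Sum>k\<in>V. 2 * max 0 (\<beta> k - snd X k) - (\<beta> k - snd X k))"
      "dist1 V (snd X) \<beta> = (\<Sum>k\<in>V. 2 * max 0 (snd X k - \<beta> k) + (\<beta> k - snd X k))"
      unfolding dist1_def by (rule sum.cong; auto simp: max_def)+
    then show "dist1 V (snd X) \<beta> = 2 * (\<Sum>k\<in>V. max 0 (\<beta> k - snd X k))"
      "dist1 V (snd X) \<beta> = 2 * (\<Sum>k\<in>V. max 0 (snd X k - \<beta> k))"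
      using s0 unfolding sum_subtractf[of "\<lambda>k. 2 * max 0 (\<beta> k - snd X k)"] sum.distrib[of "\<lambda>k. 2 * max 0 (snd X k - \<beta> k)"]
      by (simp_all add: sum_distrib_left)
  qed
  have small: "(\<Sum>k\<in>V. max 0 (h k)) \<le> int n" if "\<forall>k\<in>V. h k \<le> (1::int)" for h
  proof -
    have "(\<Sum>k\<in>V. max 0 (h k)) \<le> (\<Sum>k\<in>V. 1)" by (rule sum_mono) (use that in auto)
    then show ?thesis by simp
  qed
  have "dist1 V (snd X) \<beta> \<le> 2 * int n"
    using one_sided dist small[of "\<lambda>k. \<beta> k - snd X k"] small[of "\<lambda>k. snd X k - \<beta> k"] by auto
  then show ?thesis using b by blast
qed

end

section \<open>Multimodularity of the expected cost\<close>

lemma card_less_Suc_shift: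
  "card {t. t < Suc m \<and> P t} = (if P 0 then 1 else 0) + card {t. t < m \<and> P (Suc t)}"
proof -
  have "{t. t < Suc m \<and> P t} = (if P 0 then {0} else {}) \<union> Suc ` {t. t < m \<and> P (Suc t)}"
    by (auto simp: less_Suc_eq_0_disj)
  then show ?thesis by (simp add: card_Un_disjoint card_image image_iff)
qed

lemma fill_Cons:
  assumes "d' = max 0 (min (d + b) (d - x))" "d' + b' = d + b"
  shows "fill (x # X) d b (Suc t) = fill X d' b' t"
  by (induction t) (use assms in auto)

text \<open>
  A successful attempt turns an empty dock into a full one or conversely; a failed one costs 1 and changes
  nothing.
\<close>

lemma sequence_cost_Cons:
  assumes "0 \<le> d" "0 \<le> b"
  shows "sequence_cost (1 # X) d b = (if d = 0 then 1 + sequence_cost X 0 b else sequence_cost X (d - 1) (b + 1))"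
    and "sequence_cost (- 1 # X) d b = (if b = 0 then 1 + sequence_cost X d 0 else sequence_cost X (d + 1) (b - 1))"
proof -
  show "sequence_cost (1 # X) d b = (if d = 0 then 1 + sequence_cost X 0 b else sequence_cost X (d - 1) (b + 1))"
  proof (cases "d = 0")
    case True
    have "fill (1 # X) d b (Suc t) = fill X 0 b t" for t
      by (rule fill_Cons) (use assms True in auto)
    then show ?thesis using True by (simp add: sequence_cost_def card_less_Suc_shift del: fill.simps(2))
  next
    case False
    have "fill (1 # X) d b (Suc t) = fill X (d - 1) (b + 1) t" for t
      by (rule fill_Cons) (use assms False in auto)
    then show ?thesis using False by (simp add: sequence_cost_def card_less_Suc_shift del: fill.simps(2))
  qed
  show "sequence_cost (- 1 # X) d b = (if b = 0 then 1 + sequence_cost X d 0 else sequence_cost X (d + 1) (b - 1))"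
  proof (cases "b = 0")
    case True
    have "fill (- 1 # X) d b (Suc t) = fill X d 0 t" for t
      by (rule fill_Cons) (use assms True in auto)
    then show ?thesis using True by (simp add: sequence_cost_def card_less_Suc_shift del: fill.simps(2))
  next
    case False
    have "fill (- 1 # X) d b (Suc t) = fill X (d + 1) (b - 1) t" for t
      by (rule fill_Cons) (use assms False in auto)
    then show ?thesis using False by (simp add: sequence_cost_def card_less_Suc_shift del: fill.simps(2))
  qed
qed

text \<open>
  The first three inequalities are multimodularity for unit changes. The others, that an extra dock
  never costs and that one bike more or less matters at most once, make these properties
  inherited by longer sequences, where the first attempt may fail at the boundary.
\<close>

definition cost_shape :: "(int \<Rightarrow> int \<Rightarrow> int) \<Rightarrow> bool" where
  "cost_shape g \<longleftrightarrow> (\<forall>d\<ge>0. \<forall>b\<ge>0.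
     g (d + 1) b + g d (b + 1) \<le> g d b + g (d + 1) (b + 1) \<and>
     g (d + 1) (b + 1) + g (d + 1) b \<le> g d (b + 1) + g (d + 2) b \<and>
     g (d + 1) (b + 1) + g d (b + 1) \<le> g (d + 1) b + g d (b + 2) \<and>
     \<bar>g (d + 1) b - g d (b + 1)\<bar> \<le> 1 \<and>
     g (d + 1) b \<le> g d b \<and> g d (b + 1) \<le> g d b)"

lemma cost_shapeD:
  assumes "cost_shape g" "0 \<le> d" "0 \<le> b"
  shows "g (d + 1) b + g d (b + 1) \<le> g d b + g (d + 1) (b + 1)"
    "g (d + 1) (b + 1) + g (d + 1) b \<le> g d (b + 1) + g (d + 2) b"
    "g (d + 1) (b + 1) + g d (b + 1) \<le> g (d + 1) b + g d (b + 2)"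
    "\<bar>g (d + 1) b - g d (b + 1)\<bar> \<le> 1"
    "g (d + 1) b \<le> g d b" "g d (b + 1) \<le> g d b"
  using assms unfolding cost_shape_def by blast+

lemma cost_shape_swap:
  assumes "cost_shape g"
  shows "cost_shape (\<lambda>d b. g b d)"
  unfolding cost_shape_def
  by (intro allI impI conjI) (use cost_shapeD[OF assms] in \<open>smt (verit)\<close>)+

lemma cost_shape_return:
  assumes g: "cost_shape g"
    and h: "\<And>d b. 0 \<le> d \<Longrightarrow> 0 \<le> b \<Longrightarrow> h d b = (if d = 0 then 1 + g 0 b else g (d - 1) (b + 1))"
  shows "cost_shape h"
  unfolding cost_shape_def
proof (intro allI impI)
  fix d b :: int assume db: "0 \<le> d" "0 \<le> b"
  note D = cost_shapeD[OF g]
  show "h (d + 1) b + h d (b + 1) \<le> h d b + h (d + 1) (b + 1) \<and>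
     h (d + 1) (b + 1) + h (d + 1) b \<le> h d (b + 1) + h (d + 2) b \<and>
     h (d + 1) (b + 1) + h d (b + 1) \<le> h (d + 1) b + h d (b + 2) \<and>
     \<bar>h (d + 1) b - h d (b + 1)\<bar> \<le> 1 \<and>
     h (d + 1) b \<le> h d b \<and> h d (b + 1) \<le> h d b"
  proof (cases "d = 0")
    case True
    have e: "h 0 b = 1 + g 0 b" "h 0 (b + 1) = 1 + g 0 (b + 1)" "h 0 (b + 2) = 1 + g 0 (b + 2)"
      "h 1 b = g 0 (b + 1)" "h 1 (b + 1) = g 0 (b + 2)" "h 2 b = g 1 (b + 1)"
      using db by (auto simp: h add.commute)
    show ?thesis
      using D[of 0 b] D[of 0 "b + 1"] db True e by (simp add: add.commute)
  next
    case False
    define e where "e = d - 1"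
    have d: "d = e + 1" "0 \<le> e" using False db by (auto simp: e_def)
    have "h (e + 1) b = g e (b + 1)" "h (e + 1) (b + 1) = g e (b + 2)" "h (e + 1) (b + 2) = g e (b + 3)"
      "h (e + 2) b = g (e + 1) (b + 1)" "h (e + 2) (b + 1) = g (e + 1) (b + 2)" "h (e + 3) b = g (e + 2) (b + 1)"
      using db d by (auto simp: h add.commute)
    then show ?thesis
      using D[OF d(2), of "b + 1"] db unfolding d by (simp add: add.assoc add.commute)
  qed
qed

lemma cost_shape_sequence_cost:
  "set X \<subseteq> {-1, 1} \<Longrightarrow> cost_shape (\<lambda>d b. int (sequence_cost X d b))"
proof (induction X)
  case Nil
  then show ?case by (simp add: sequence_cost_def cost_shape_def)
next
  case (Cons x X)
  let ?g = "\<lambda>d b. int (sequence_cost X d b)"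
  have IH: "cost_shape ?g" using Cons by simp
  have "x = 1 \<or> x = -1" using Cons.prems by auto
  then show ?case
  proof
    assume x: "x = 1"
    show ?case unfolding x by (rule cost_shape_return[OF IH]) (simp add: sequence_cost_Cons)
  next
    assume x: "x = -1"
    have "cost_shape (\<lambda>b d. int (sequence_cost (x # X) d b))"
      unfolding x by (rule cost_shape_return[OF cost_shape_swap[OF IH]]) (simp add: sequence_cost_Cons)
    then show ?case by (rule cost_shape_swap)
  qed
qed

text \<open>
  In a grid spanned by two neighbouring kinds of unit changes, nonnegative second differences add up to
  the inequality for larger changes.
\<close>

lemma grid_inequality:
  fixes h :: "nat \<Rightarrow> nat \<Rightarrow> int"
  assumes c11: "\<And>i j. i + 2 \<le> I \<Longrightarrow> j \<le> J \<Longrightarrow> 2 * h (Suc i) j \<le> h i j + h (Suc (Suc i)) j"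
    and c12: "\<And>i j. i + 1 \<le> I \<Longrightarrow> j + 1 \<le> J \<Longrightarrow> h (Suc i) j + h i (Suc j) \<le> h i j + h (Suc i) (Suc j)"
    and c22: "\<And>i j. i \<le> I \<Longrightarrow> j + 2 \<le> J \<Longrightarrow> 2 * h i (Suc j) \<le> h i j + h i (Suc (Suc j))"
  shows "a + s \<le> I \<Longrightarrow> c + r \<le> J \<Longrightarrow> h a c + h s r \<le> h 0 0 + h (a + s) (c + r)"
proof -
  have d1: "h (Suc i) j - h i j \<le> h (Suc (i + a)) (j + c) - h (i + a) (j + c)"
    if "i + a + 1 \<le> I" "j + c \<le> J" for i j a c
  proof -
    have "h (Suc i) j - h i j \<le> h (Suc (i + a)) j - h (i + a) j" using that
    proof (induction a)
      case (Suc a)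
      then show ?case using c11[of "i + a" j] by (simp add: algebra_simps)
    qed simp
    also have "\<dots> \<le> h (Suc (i + a)) (j + c) - h (i + a) (j + c)" using that
    proof (induction c)
      case (Suc c)
      then show ?case using c12[of "i + a" "j + c"] by (simp add: algebra_simps)
    qed simp
    finally show ?thesis .
  qed
  have d2: "h i (Suc j) - h i j \<le> h (i + a) (Suc (j + c)) - h (i + a) (j + c)"
    if "i + a \<le> I" "j + c + 1 \<le> J" for i j a c
  proof -
    have "h i (Suc j) - h i j \<le> h i (Suc (j + c)) - h i (j + c)" using that
    proof (induction c)
      case (Suc c)
      then show ?case using c22[of i "j + c"] by (simp add: algebra_simps)
    qed simp
    also have "\<dots> \<le> h (i + a) (Suc (j + c)) - h (i + a) (j + c)" using that
    proof (induction a)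
      case (Suc a)
      then show ?case using c12[of "i + a" "j + c"] by (simp add: algebra_simps)
    qed simp
    finally show ?thesis .
  qed
  assume *: "a + s \<le> I" "c + r \<le> J"
  have "h a c - h 0 0 \<le> h (a + s) c - h s 0" using *
  proof (induction s)
    case (Suc s)
    then show ?case using d1[of s a 0 c] by (simp add: algebra_simps)
  qed simp
  also have "\<dots> \<le> h (a + s) (c + r) - h s r" using *
  proof (induction r)
    case (Suc r)
    then show ?case using d2[of s a r c] by (simp add: algebra_simps)
  qed simp
  finally show ?thesis by simp
qed

lemma cost_shape_quadrant:
  assumes g: "cost_shape g" and xy: "0 \<le> x" "0 \<le> y" and uv: "0 \<le> u" "u \<le> p" "0 \<le> v" "v \<le> q"
  shows "g (x + u) (y + v) + g (x + p - u) (y + q - v) \<le> g x y + g (x + p) (y + q)"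
proof -
  let ?h = "\<lambda>i j. g (x + int i) (y + int j)"
  note D = cost_shapeD[OF g]
  have "?h (nat u) (nat v) + ?h (nat (p - u)) (nat (q - v)) \<le>
      ?h 0 0 + ?h (nat u + nat (p - u)) (nat v + nat (q - v))"
  proof (rule grid_inequality[where I = "nat p" and J = "nat q"])
    fix i j :: nat
    let ?d = "x + int i" and ?b = "y + int j"
    have db: "0 \<le> ?d" "0 \<le> ?b" using xy by auto
    show "2 * ?h (Suc i) j \<le> ?h i j + ?h (Suc (Suc i)) j"
      using D(1,2)[OF db] by (simp add: algebra_simps)
    show "2 * ?h i (Suc j) \<le> ?h i j + ?h i (Suc (Suc j))"
      using D(1,3)[OF db] by (simp add: algebra_simps)
    show "?h (Suc i) j + ?h i (Suc j) \<le> ?h i j + ?h (Suc i) (Suc j)"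
      using D(1)[OF db] by (simp add: algebra_simps)
  qed (use uv in auto)
  then show ?thesis using uv by (simp add: algebra_simps)
qed

lemma cost_shape_swap_cone:
  assumes g: "cost_shape g" and xy: "0 \<le> x" "0 \<le> y + q"
    and uv: "v \<le> 0" "q \<le> v" "0 \<le> u + v" "u + v \<le> p + q"
  shows "g (x + u) (y + v) + g (x + p - u) (y + q - v) \<le> g x y + g (x + p) (y + q)"
proof -
  let ?h = "\<lambda>i j. g (x + int i + int j) (y - int j)"
  note D = cost_shapeD[OF g]
  have "?h (nat (u + v)) (nat (- v)) + ?h (nat (p + q - u - v)) (nat (v - q)) \<le>
      ?h 0 0 + ?h (nat (u + v) + nat (p + q - u - v)) (nat (- v) + nat (v - q))"
  proof (rule grid_inequality[where I = "nat (p + q)" and J = "nat (- q)"])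
    fix i j :: nat
    let ?d = "x + int i + int j"
    { assume "j \<le> nat (- q)"
      then have "0 \<le> ?d" "0 \<le> y - int j" using xy uv by auto
      from D(1,2)[OF this] show "2 * ?h (Suc i) j \<le> ?h i j + ?h (Suc (Suc i)) j"
        by (simp add: algebra_simps) }
    { assume "j + 1 \<le> nat (- q)"
      then have "0 \<le> ?d" "0 \<le> y - int j - 1" using xy uv by auto
      from D(2)[OF this] show "?h (Suc i) j + ?h i (Suc j) \<le> ?h i j + ?h (Suc i) (Suc j)"
        by (simp add: algebra_simps) }
    { assume "j + 2 \<le> nat (- q)"
      then have *: "0 \<le> ?d" "0 \<le> ?d + 1" "0 \<le> y - int j - 1" "0 \<le> y - int j - 2" using xy uv by auto
      from D(2)[OF *(1,3)] D(3)[OF *(2,4)] show "2 * ?h i (Suc j) \<le> ?h i j + ?h i (Suc (Suc j))"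
        by (simp add: algebra_simps) }
  qed (use uv in auto)
  then show ?thesis using uv by (simp add: algebra_simps)
qed

lemma cost_shape_fits:
  assumes g: "cost_shape g" and xy: "0 \<le> x" "0 \<le> y" "0 \<le> x + p" "0 \<le> y + q" and fits: "fits u v p q"
  shows "g (x + u) (y + v) + g (x + p - u) (y + q - v) \<le> g x y + g (x + p) (y + q)"
proof -
  note c = fits[unfolded fits_def conforms_def]
  note g' = cost_shape_swap[OF g]
  consider "0 \<le> p" "0 \<le> q" | "p \<le> 0" "q \<le> 0"
    | "0 \<le> p" "q \<le> 0" "0 \<le> p + q" | "p \<le> 0" "0 \<le> q" "p + q \<le> 0"
    | "p \<le> 0" "0 \<le> q" "0 \<le> p + q" | "0 \<le> p" "q \<le> 0" "p + q \<le> 0" by linarith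
  then show ?thesis
  proof cases
    case 1
    then show ?thesis by (intro cost_shape_quadrant[OF g]) (use c xy in linarith)+
  next
    case 2
    then have "g (x + p + - u) (y + q + - v) + g (x + p + - p - - u) (y + q + - q - - v)
        \<le> g (x + p) (y + q) + g (x + p + - p) (y + q + - q)"
      by (intro cost_shape_quadrant[OF g]) (use c xy in linarith)+
    then show ?thesis by (simp add: algebra_simps)
  next
    case 3
    then show ?thesis by (intro cost_shape_swap_cone[OF g]) (use c xy in linarith)+
  next
    case 4
    then have "g (x + p + - u) (y + q + - v) + g (x + p + - p - - u) (y + q + - q - - v)
        \<le> g (x + p) (y + q) + g (x + p + - p) (y + q + - q)"
      by (intro cost_shape_swap_cone[OF g]) (use c xy in linarith)+
    then show ?thesis by (simp add: algebra_simps)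
  next
    case 5
    then show ?thesis by (intro cost_shape_swap_cone[OF g']) (use c xy in linarith)+
  next
    case 6
    then have "g (x + p + - u) (y + q + - v) + g (x + p + - p - - u) (y + q + - q - - v)
        \<le> g (x + p) (y + q) + g (x + p + - p) (y + q + - q)"
      by (intro cost_shape_swap_cone[OF g']) (use c xy in linarith)+
    then show ?thesis by (simp add: algebra_simps)
  qed
qed

lemma cost_shape_grow:
  assumes g: "cost_shape g" and "0 \<le> d" "0 \<le> b"
  shows "g (d + int k) b \<le> g d b" "g d (b + int k) \<le> g d b"
proof -
  show "g (d + int k) b \<le> g d b"
  proof (induction k)
    case (Suc k)
    then show ?case using cost_shapeD(5)[OF g, of "d + int k" b] assms by (simp add: algebra_simps)
  qed simp
  show "g d (b + int k) \<le> g d b"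
  proof (induction k)
    case (Suc k)
    then show ?case using cost_shapeD(6)[OF g, of d "b + int k"] assms by (simp add: algebra_simps)
  qed simp
qed

definition expected_cost :: "int list pmf \<Rightarrow> int \<Rightarrow> int \<Rightarrow> ereal" where
  "expected_cost P d b = enn2ereal (\<integral>\<^sup>+ X. of_nat (sequence_cost X d b) \<partial>measure_pmf P)"

lemma expected_cost_fits:
  assumes P: "set_pmf P \<subseteq> {X. set X \<subseteq> {-1, 1}}"
    and xy: "0 \<le> x" "0 \<le> y" "0 \<le> x + p" "0 \<le> y + q" and fits: "fits u v p q"
  shows "expected_cost P (x + u) (y + v) + expected_cost P (x + p - u) (y + q - v)
    \<le> expected_cost P x y + expected_cost P (x + p) (y + q)"
proof -
  let ?c = "\<lambda>X d b. of_nat (sequence_cost X d b) :: ennreal"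
  have "(\<integral>\<^sup>+ X. ?c X (x + u) (y + v) + ?c X (x + p - u) (y + q - v) \<partial>measure_pmf P)
      \<le> (\<integral>\<^sup>+ X. ?c X x y + ?c X (x + p) (y + q) \<partial>measure_pmf P)"
  proof (intro nn_integral_mono_AE, subst AE_measure_pmf_iff, intro ballI)
    fix X assume "X \<in> set_pmf P"
    then have "set X \<subseteq> {-1, 1}" using P by auto
    from cost_shape_fits[OF cost_shape_sequence_cost[OF this] xy fits]
    have "sequence_cost X (x + u) (y + v) + sequence_cost X (x + p - u) (y + q - v)
        \<le> sequence_cost X x y + sequence_cost X (x + p) (y + q)" by linarith
    then show "?c X (x + u) (y + v) + ?c X (x + p - u) (y + q - v) \<le> ?c X x y + ?c X (x + p) (y + q)"
      unfolding of_nat_add[symmetric] by (rule of_nat_mono)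
  qed
  then show ?thesis
    unfolding expected_cost_def plus_ennreal.rep_eq[symmetric] less_eq_ennreal.rep_eq[symmetric]
    by (simp add: nn_integral_add)
qed

lemma expected_cost_grow:
  assumes P: "set_pmf P \<subseteq> {X. set X \<subseteq> {-1, 1}}" and db: "0 \<le> d" "0 \<le> b"
  shows "expected_cost P (d + int k) b \<le> expected_cost P d b"
    "expected_cost P d (b + int k) \<le> expected_cost P d b"
proof -
  have shape: "cost_shape (\<lambda>d b. int (sequence_cost X d b))" if "X \<in> set_pmf P" for X
    by (rule cost_shape_sequence_cost) (use P that in auto)
  show "expected_cost P (d + int k) b \<le> expected_cost P d b"
    "expected_cost P d (b + int k) \<le> expected_cost P d b"
    unfolding expected_cost_def less_eq_ennreal.rep_eq[symmetric]
    using cost_shape_grow[OF shape db] by (auto intro!: nn_integral_mono_AE simp: AE_measure_pmf_iff)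
qed

definition rescaled :: "(nat \<Rightarrow> int \<Rightarrow> int \<Rightarrow> ereal) \<Rightarrow> (nat \<Rightarrow> int) \<Rightarrow> (nat \<Rightarrow> int) \<Rightarrow> int
    \<Rightarrow> nat \<Rightarrow> int \<Rightarrow> int \<Rightarrow> ereal" where
  "rescaled c dbar bbar a k x y = c k (dbar k + a * x) (bbar k + a * y)"

lemma conforms_scale: "0 \<le> a \<Longrightarrow> conforms u p \<Longrightarrow> conforms (a * u) (a * p)"
  by (auto simp: conforms_def mult_left_mono mult_nonneg_nonpos)

lemma fits_scale: "0 \<le> a \<Longrightarrow> fits u v p q \<Longrightarrow> fits (a * u) (a * v) (a * p) (a * q)"
  using conforms_scale[of a u p] conforms_scale[of a v q] conforms_scale[of a "u + v" "p + q"]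
  by (simp add: fits_def distrib_left)

lemma station_cost_nonneg: "0 \<le> station_cost p l u depot k d b"
  by (simp add: station_cost_def)

lemma station_cost_finiteD:
  "station_cost p l u depot k d b < \<infinity> \<Longrightarrow> 0 \<le> d \<and> 0 \<le> b \<and> int (l k) \<le> d + b \<and> d + b \<le> int (u k)"
  by (auto simp: station_cost_def split: if_splits)

lemma station_cost_multimodular:
  assumes P: "set_pmf (P k) \<subseteq> {X. set X \<subseteq> {-1, 1}}"
  shows "multimodular (station_cost P l w depot k)"
  unfolding multimodular_def
proof (intro allI impI)
  fix x y p q u v :: int assume fits: "fits u v p q"
  let ?c = "station_cost P l w depot k"
  show "?c (x + u) (y + v) + ?c (x + p - u) (y + q - v) \<le> ?c x y + ?c (x + p) (y + q)"
  proof (cases "?c x y < \<infinity> \<and> ?c (x + p) (y + q) < \<infinity>")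
    case False
    then show ?thesis using station_cost_nonneg[of P l w depot k] by auto
  next
    case True
    note d1 = station_cost_finiteD[OF conjunct1[OF True]]
      and d2 = station_cost_finiteD[OF conjunct2[OF True]]
    note c = fits[unfolded fits_def conforms_def]
    have in1: "0 \<le> x + u \<and> 0 \<le> y + v \<and> int (l k) \<le> x + u + (y + v) \<and> x + u + (y + v) \<le> int (w k)"
      and in2: "0 \<le> x + p - u \<and> 0 \<le> y + q - v \<and> int (l k) \<le> x + p - u + (y + q - v) \<and>
        x + p - u + (y + q - v) \<le> int (w k)"
      using c d1 d2 by linarith+
    show ?thesis
    proof (cases "depot = Some k")
      case True
      then show ?thesis using in1 in2 d1 d2 by (simp add: station_cost_def)
    next
      case False
      then show ?thesis
        using in1 in2 d1 d2 expected_cost_fits[OF P, of x y p q u v] fits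
        by (simp add: station_cost_def expected_cost_def)
    qed
  qed
qed

lemma station_cost_grow:
  assumes P: "set_pmf (P k) \<subseteq> {X. set X \<subseteq> {-1, 1}}"
    and fin: "station_cost P l w depot k d b < \<infinity>" and w: "d + b + int m \<le> int (w k)"
  shows "station_cost P l w depot k (d + int m) b < \<infinity>" "station_cost P l w depot k d (b + int m) < \<infinity>"
  using station_cost_finiteD[OF fin] fin w expected_cost_grow[OF P, of d b m]
  by (auto simp: station_cost_def expected_cost_def[symmetric] ac_simps split: if_splits)

lemma rescaled_station_cost:
  assumes P: "\<And>k. k \<in> {1..n} \<Longrightarrow> set_pmf (P k) \<subseteq> {X. set X \<subseteq> {-1, 1}}"
    and fin: "objective n (station_cost P l w depot) (dbar, bbar) < \<infinity>" and a: "1 \<le> a"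
  shows "multimodular_stations n (rescaled (station_cost P l w depot) dbar bbar a)"
proof
  let ?c = "station_cost P l w depot"
  have origin: "?c k (dbar k) (bbar k) < \<infinity>" if "k \<in> {1..n}" for k
    using fin that unfolding objective_def less_top[symmetric]
    by (auto simp: sum_Pinfty)
  show "0 \<le> rescaled ?c dbar bbar a k x y" for k x y
    by (simp add: rescaled_def station_cost_nonneg)
  show "multimodular (rescaled ?c dbar bbar a k)" if k: "k \<in> {1..n}" for k
    unfolding multimodular_def
  proof (intro allI impI)
    fix x y p q u v :: int assume "fits u v p q"
    then have "fits (a * u) (a * v) (a * p) (a * q)" using a by (intro fits_scale) auto
    then show "rescaled ?c dbar bbar a k (x + u) (y + v) + rescaled ?c dbar bbar a k (x + p - u) (y + q - v)
        \<le> rescaled ?c dbar bbar a k x y + rescaled ?c dbar bbar a k (x + p) (y + q)"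
      using station_cost_multimodular[of P k l w depot, OF P[OF k], unfolded multimodular_def, rule_format,
          of "a * u" "a * v" "a * p" "a * q" "dbar k + a * x" "bbar k + a * y"]
      by (simp add: rescaled_def algebra_simps)
  qed
  show "\<exists>K. \<forall>k\<in>{1..n}. \<forall>x y. rescaled ?c dbar bbar a k x y < \<infinity> \<longrightarrow> \<bar>x\<bar> \<le> K \<and> \<bar>y\<bar> \<le> K"
  proof (intro exI ballI allI impI)
    fix k x y assume k: "k \<in> {1..n}" and f: "rescaled ?c dbar bbar a k x y < \<infinity>"
    let ?K = "\<lambda>k. int (w k) + \<bar>dbar k\<bar> + \<bar>bbar k\<bar>"
    have le: "?K k \<le> (\<Sum>k\<in>{1..n}. ?K k)" by (rule member_le_sum) (use k in auto)
    have dom: "0 \<le> dbar k + a * x" "0 \<le> bbar k + a * y" "dbar k + a * x + (bbar k + a * y) \<le> int (w k)"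
      using station_cost_finiteD f unfolding rescaled_def by blast+
    have "\<bar>a * x\<bar> \<le> ?K k" "\<bar>a * y\<bar> \<le> ?K k" using dom by linarith+
    moreover have "\<bar>x\<bar> \<le> \<bar>a * x\<bar>" "\<bar>y\<bar> \<le> \<bar>a * y\<bar>"
      using a mult_right_mono[of 1 a "\<bar>x\<bar>"] mult_right_mono[of 1 a "\<bar>y\<bar>"] by (auto simp: abs_mult)
    ultimately show "\<bar>x\<bar> \<le> (\<Sum>k\<in>{1..n}. ?K k) \<and> \<bar>y\<bar> \<le> (\<Sum>k\<in>{1..n}. ?K k)" using le by linarith
  qed
  show "rescaled ?c dbar bbar a k 0 0 < \<infinity>" if "k \<in> {1..n}" for k
    using origin[OF that] by (simp add: rescaled_def)
  show "rescaled ?c dbar bbar a k (x + 1) y < \<infinity> \<and> rescaled ?c dbar bbar a k x (y + 1) < \<infinity>"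
    if k: "k \<in> {1..n}" and f: "rescaled ?c dbar bbar a k x y < \<infinity>" and less: "x + y < 0" for k x y
  proof -
    have "a * (x + y + 1) \<le> 0" using less a by (intro mult_nonneg_nonpos) auto
    then have "dbar k + a * x + (bbar k + a * y) + int (nat a) \<le> int (w k)"
      using station_cost_finiteD[OF origin[OF k]] a by (auto simp: algebra_simps)
    from station_cost_grow[of P k, OF P[OF k] f[unfolded rescaled_def] this] show ?thesis
      using a by (simp add: rescaled_def algebra_simps)
  qed
qed

section \<open>One phase in the scale of its step length\<close>

text \<open>The radius \<open>M\<close> of the rollback, in units of the step length.\<close>

definition rollback :: "nat \<Rightarrow> nat" where
  "rollback n = 16 * n ^ 6 * (n + 4)"

lemma rollback_ge:
  assumes "1 \<le> n"
  shows "12 * n ^ 2 \<le> rollback n" "6 * n ^ 2 + 2 \<le> 2 * rollback n"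
proof -
  have "n ^ 2 * 1 \<le> n ^ 6 * (n + 4)"
    using assms by (intro mult_mono power_increasing) auto
  moreover have "1 \<le> n ^ 2" using assms by simp
  ultimately show "12 * n ^ 2 \<le> rollback n" "6 * n ^ 2 + 2 \<le> 2 * rollback n"
    unfolding rollback_def by linarith+
qed

text \<open>
  Invariants of the two loops that roll back the docks \<open>s\<close> at the end of the bike step. The current
  docks are \<open>w\<close>, and \<open>q\<close> bounds the number of remaining iterations. The disjunction says that the
  radius \<open>n * K\<close> is used only after all deficit stations have been rolled back by \<open>K\<close>.
\<close>

definition first_rollback :: "nat \<Rightarrow> int \<Rightarrow> (nat \<Rightarrow> int) \<Rightarrow> (nat \<Rightarrow> int) \<Rightarrow> nat \<Rightarrow> bool" where
  "first_rollback n K s w q \<longleftrightarrow>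
     (\<forall>k\<in>{1..n}. 0 \<le> s k \<longrightarrow> max (s k - K) 0 \<le> w k \<and> w k \<le> s k) \<and>
     (\<forall>k\<in>{1..n}. s k < 0 \<longrightarrow> s k \<le> w k \<and> w k \<le> 0 \<and> w k \<le> s k + int n * K) \<and>
     ((\<forall>k\<in>{1..n}. s k < 0 \<longrightarrow> w k \<le> s k + K) \<or> (\<forall>k\<in>{1..n}. s k < 0 \<longrightarrow> min (s k + K) 0 \<le> w k)) \<and>
     (\<Sum>k\<in>{1..n}. if 0 \<le> s k then w k - max (s k - K) 0 else 0) \<le> int q"

definition second_rollback :: "nat \<Rightarrow> int \<Rightarrow> (nat \<Rightarrow> int) \<Rightarrow> (nat \<Rightarrow> int) \<Rightarrow> nat \<Rightarrow> bool" where
  "second_rollback n K s w q \<longleftrightarrow>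
     (\<forall>k\<in>{1..n}. 0 \<le> s k \<longrightarrow> 0 \<le> w k \<and> w k \<le> s k \<and> w k \<le> max (s k - K) 0 \<and> s k - int n * K \<le> w k) \<and>
     (\<forall>k\<in>{1..n}. s k < 0 \<longrightarrow> s k \<le> w k \<and> w k \<le> 0 \<and> w k \<le> s k + int n * K) \<and>
     ((\<forall>k\<in>{1..n}. s k < 0 \<longrightarrow> w k \<le> s k + K) \<or> (\<forall>k\<in>{1..n}. s k < 0 \<longrightarrow> min (s k + K) 0 \<le> w k)) \<and>
     (\<Sum>k\<in>{1..n}. if s k < 0 then max 0 (min (s k + K) 0 - w k) else 0) \<le> int q"

lemma first_rollback_init:
  assumes "0 \<le> K" "1 \<le> n"
  shows "first_rollback n K s s (n * nat K)"
proof -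
  have nK: "K \<le> int n * K" using assms mult_right_mono[of 1 "int n" K] by simp
  have "(\<Sum>k\<in>{1..n}. if 0 \<le> s k then s k - max (s k - K) 0 else 0) \<le> (\<Sum>k\<in>{1..n}. K)"
    by (rule sum_mono) (use assms in auto)
  then show ?thesis using assms nK by (auto simp: first_rollback_def)
qed

lemma first_rollback_step:
  assumes inv: "first_rollback n K s w q" and K: "0 \<le> K"
    and i: "i \<in> {1..n}" "0 \<le> s i" "max (s i - K) 0 < w i"
    and j: "j \<in> {1..n}" "s j < 0" "w j < min (s j + int n * K) 0"
      "w j < min (s j + K) 0 \<or> (\<forall>k\<in>{1..n}. s k < 0 \<longrightarrow> min (s k + K) 0 \<le> w k)"
  shows "0 < q \<and> first_rollback n K s (transfer i j w) (q - 1)"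
proof -
  have ne: "i \<noteq> j" using i j by auto
  let ?h = "\<lambda>k t. if 0 \<le> s k then t - max (s k - K) 0 else 0"
  have sum: "(\<Sum>k\<in>{1..n}. ?h k (transfer i j w k)) = (\<Sum>k\<in>{1..n}. ?h k (w k)) - 1"
    using sum_transfer[OF _ i(1) j(1) ne, of ?h w] i j by simp
  have "0 \<le> (\<Sum>k\<in>{1..n}. ?h k (transfer i j w k))"
    by (rule sum_nonneg) (use inv i j in \<open>auto simp: first_rollback_def transfer_apply[OF ne]\<close>)
  then have q: "0 < q" using sum inv unfolding first_rollback_def by linarith
  have t: "transfer i j w k = (if k = i then w i - 1 else if k = j then w j + 1 else w k)" for k
    by (rule transfer_apply[OF ne])
  have 1: "\<forall>k\<in>{1..n}. 0 \<le> s k \<longrightarrow> max (s k - K) 0 \<le> transfer i j w k \<and> transfer i j w k \<le> s k"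
    using inv i j unfolding first_rollback_def t by auto
  have 2: "\<forall>k\<in>{1..n}. s k < 0 \<longrightarrow> s k \<le> transfer i j w k \<and> transfer i j w k \<le> 0 \<and>
      transfer i j w k \<le> s k + int n * K"
    using inv i j unfolding first_rollback_def t by auto
  have 3: "(\<forall>k\<in>{1..n}. s k < 0 \<longrightarrow> transfer i j w k \<le> s k + K) \<or>
      (\<forall>k\<in>{1..n}. s k < 0 \<longrightarrow> min (s k + K) 0 \<le> transfer i j w k)"
  proof (cases "\<forall>k\<in>{1..n}. s k < 0 \<longrightarrow> min (s k + K) 0 \<le> w k")
    case True
    have "\<forall>k\<in>{1..n}. s k < 0 \<longrightarrow> min (s k + K) 0 \<le> transfer i j w k"
    proof (intro ballI impI)
      fix k assume k: "k \<in> {1..n}" "s k < 0"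
      then have "k \<noteq> i" "min (s k + K) 0 \<le> w k" using i(2) True by auto
      then show "min (s k + K) 0 \<le> transfer i j w k" unfolding t by auto
    qed
    then show ?thesis by blast
  next
    case False
    then have "w j < s j + K" "\<forall>k\<in>{1..n}. s k < 0 \<longrightarrow> w k \<le> s k + K"
      using inv j(4) unfolding first_rollback_def by auto
    then have "\<forall>k\<in>{1..n}. s k < 0 \<longrightarrow> transfer i j w k \<le> s k + K"
      using i(2) unfolding t by auto
    then show ?thesis by blast
  qed
  show ?thesis using q 1 2 3 sum inv unfolding first_rollback_def by auto
qed

lemma rollback_balance:
  fixes s w :: "nat \<Rightarrow> int"
  assumes "(\<Sum>k\<in>{1..n}. s k) = 0" "(\<Sum>k\<in>{1..n}. w k) = 0"
  shows "(\<Sum>k\<in>{1..n}. if 0 \<le> s k then s k - w k else 0) = (\<Sum>k\<in>{1..n}. if s k < 0 then w k - s k else 0)"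
proof -
  have "(\<Sum>k\<in>{1..n}. if 0 \<le> s k then s k - w k else 0) - (\<Sum>k\<in>{1..n}. if s k < 0 then w k - s k else 0) =
      (\<Sum>k\<in>{1..n}. s k - w k)"
    unfolding sum_subtractf[symmetric] by (rule sum.cong) auto
  also have "\<dots> = 0" using assms by (simp add: sum_subtractf)
  finally show ?thesis by simp
qed

lemma sum_less_bound:
  fixes e :: "nat \<Rightarrow> int"
  assumes "\<And>k. k \<in> {1..n} \<Longrightarrow> e k \<le> K" "i \<in> {1..n}" "e i < K"
  shows "(\<Sum>k\<in>{1..n}. e k) < int n * K"
proof -
  have "(\<Sum>k\<in>{1..n}. e k) < (\<Sum>k\<in>{1..n}. K)"
    by (rule sum_strict_mono_ex1) (use assms in auto)
  then show ?thesis by simp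
qed

lemma exists_opposite_sign:
  fixes w :: "nat \<Rightarrow> int"
  assumes "(\<Sum>k\<in>{1..n}. w k) = 0" "i \<in> {1..n}" "0 < w i"
  shows "\<exists>j\<in>{1..n}. w j < 0"
proof (rule ccontr)
  assume "\<not> ?thesis"
  then have "0 \<le> w k" if "k \<in> {1..n}" for k using that by (meson not_le)
  then have "w i \<le> (\<Sum>k\<in>{1..n}. w k)" by (intro member_le_sum) (use assms in auto)
  then show False using assms by simp
qed

text \<open>
  The deficit stations have together received what the surplus stations have given, at most \<open>K\<close> each and
  less than \<open>K\<close> at \<open>i\<close>. So none of them has received \<open>n * K\<close>, and as there is a surplus left at \<open>i\<close>, some
  deficit is left as well.
\<close>

lemma first_rollback_not_stuck:
  assumes inv: "first_rollback n K s w q" and K: "0 \<le> K"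
    and s: "(\<Sum>k\<in>{1..n}. s k) = 0" and w: "(\<Sum>k\<in>{1..n}. w k) = 0"
    and i: "i \<in> {1..n}" "0 \<le> s i" "max (s i - K) 0 < w i"
  shows "\<exists>j\<in>{1..n}. s j < 0 \<and> w j < min (s j + int n * K) 0"
proof -
  have "0 < w i" using i by simp
  then obtain j where j: "j \<in> {1..n}" "w j < 0" using exists_opposite_sign[OF w i(1)] by blast
  have sj: "s j < 0"
  proof (rule ccontr)
    assume "\<not> s j < 0"
    then have "0 \<le> w j" using inv j(1) unfolding first_rollback_def by auto
    then show False using j(2) by simp
  qed
  have "w j - s j = (\<lambda>k. if s k < 0 then w k - s k else 0) j" using sj by simp
  also have "\<dots> \<le> (\<Sum>k\<in>{1..n}. if s k < 0 then w k - s k else 0)"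
    by (rule member_le_sum) (use inv j in \<open>auto simp: first_rollback_def\<close>)
  also have "\<dots> = (\<Sum>k\<in>{1..n}. if 0 \<le> s k then s k - w k else 0)" using rollback_balance[OF s w] by simp
  also have "\<dots> < int n * K"
  proof (rule sum_less_bound)
    show "(if 0 \<le> s k then s k - w k else 0) \<le> K" if "k \<in> {1..n}" for k
    proof (cases "0 \<le> s k")
      case True
      then have "max (s k - K) 0 \<le> w k" using inv that unfolding first_rollback_def by blast
      with True show ?thesis by simp
    qed (use K in auto)
  qed (use i in auto)
  finally show ?thesis using j sj by (intro bexI[of _ j]) auto
qed

lemma first_rollback_end:
  assumes inv: "first_rollback n K s w q" and K: "0 \<le> K" and n: "1 \<le> n"
    and no: "\<And>i. i \<in> {1..n} \<Longrightarrow> 0 \<le> s i \<Longrightarrow> w i \<le> max (s i - K) 0"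
  shows "second_rollback n K s w (n * nat K)"
proof -
  have nK: "K \<le> int n * K" using K n mult_right_mono[of 1 "int n" K] by simp
  have "(\<Sum>k\<in>{1..n}. if s k < 0 then max 0 (min (s k + K) 0 - w k) else 0) \<le> (\<Sum>k\<in>{1..n}. K)"
    by (rule sum_mono) (use inv K in \<open>force simp: first_rollback_def\<close>)
  then have sum: "(\<Sum>k\<in>{1..n}. if s k < 0 then max 0 (min (s k + K) 0 - w k) else 0) \<le> int (n * nat K)"
    using K by simp
  have "0 \<le> w k \<and> w k \<le> s k \<and> w k \<le> max (s k - K) 0 \<and> s k - int n * K \<le> w k" if "k \<in> {1..n}" "0 \<le> s k" for k
  proof -
    have "max (s k - K) 0 \<le> w k" "w k \<le> s k" using inv that unfolding first_rollback_def by blast+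
    then show ?thesis using no[OF that] nK by auto
  qed
  then show ?thesis using inv sum unfolding first_rollback_def second_rollback_def by blast
qed

lemma second_rollback_step:
  assumes inv: "second_rollback n K s w q" and K: "0 \<le> K"
    and j: "j \<in> {1..n}" "s j < 0" "w j < min (s j + K) 0"
    and i: "i \<in> {1..n}" "0 \<le> s i" "max (s i - int n * K) 0 < w i"
  shows "0 < q \<and> second_rollback n K s (transfer i j w) (q - 1)"
proof -
  have ne: "i \<noteq> j" using i j by auto
  let ?h = "\<lambda>k t. if s k < 0 then max 0 (min (s k + K) 0 - t) else 0"
  have sum: "(\<Sum>k\<in>{1..n}. ?h k (transfer i j w k)) = (\<Sum>k\<in>{1..n}. ?h k (w k)) - 1"
    using sum_transfer[OF _ i(1) j(1) ne, of ?h w] i j by auto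
  have "0 \<le> (\<Sum>k\<in>{1..n}. ?h k (transfer i j w k))" by (rule sum_nonneg) auto
  then have q: "0 < q" using sum inv unfolding second_rollback_def by linarith
  have t: "transfer i j w k = (if k = i then w i - 1 else if k = j then w j + 1 else w k)" for k
    by (rule transfer_apply[OF ne])
  have nK: "K \<le> int n * K" using K i(1) mult_right_mono[of 1 "int n" K] by simp
  have A: "\<forall>k\<in>{1..n}. s k < 0 \<longrightarrow> w k \<le> s k + K"
    using inv j unfolding second_rollback_def by force
  have 1: "\<forall>k\<in>{1..n}. 0 \<le> s k \<longrightarrow> 0 \<le> transfer i j w k \<and> transfer i j w k \<le> s k \<and>
      transfer i j w k \<le> max (s k - K) 0 \<and> s k - int n * K \<le> transfer i j w k"
    using inv i j unfolding second_rollback_def t by auto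
  have 2: "\<forall>k\<in>{1..n}. s k < 0 \<longrightarrow> s k \<le> transfer i j w k \<and> transfer i j w k \<le> 0 \<and>
      transfer i j w k \<le> s k + int n * K"
    using inv i j nK unfolding second_rollback_def t by auto
  have 3: "\<forall>k\<in>{1..n}. s k < 0 \<longrightarrow> transfer i j w k \<le> s k + K"
    using A i j unfolding t by auto
  show ?thesis using q 1 2 3 sum inv unfolding second_rollback_def by auto
qed

lemma second_rollback_not_stuck:
  assumes inv: "second_rollback n K s w q" and K: "0 \<le> K"
    and s: "(\<Sum>k\<in>{1..n}. s k) = 0" and w: "(\<Sum>k\<in>{1..n}. w k) = 0"
    and j: "j \<in> {1..n}" "s j < 0" "w j < min (s j + K) 0"
  shows "\<exists>i\<in>{1..n}. 0 \<le> s i \<and> max (s i - int n * K) 0 < w i"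
proof -
  have "\<exists>i\<in>{1..n}. - w i < 0"
    by (rule exists_opposite_sign[where i = j]) (use w j in \<open>auto simp: sum_negf\<close>)
  then obtain i where i: "i \<in> {1..n}" "0 < w i" by auto
  have si: "0 \<le> s i"
  proof (rule ccontr)
    assume "\<not> 0 \<le> s i"
    then have "w i \<le> 0" using inv i(1) unfolding second_rollback_def by auto
    then show False using i(2) by simp
  qed
  have A: "\<forall>k\<in>{1..n}. s k < 0 \<longrightarrow> w k \<le> s k + K"
    using inv j unfolding second_rollback_def by force
  have "s i - w i = (\<lambda>k. if 0 \<le> s k then s k - w k else 0) i" using si by simp
  also have "\<dots> \<le> (\<Sum>k\<in>{1..n}. if 0 \<le> s k then s k - w k else 0)"
    by (rule member_le_sum) (use inv i in \<open>auto simp: second_rollback_def\<close>)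
  also have "\<dots> = (\<Sum>k\<in>{1..n}. if s k < 0 then w k - s k else 0)" using rollback_balance[OF s w] .
  also have "\<dots> < int n * K"
    by (rule sum_less_bound[where i = j]) (use A j K in auto)
  finally show ?thesis using i si by (intro bexI[of _ i]) auto
qed

context multimodular_stations
begin

abbreviation "K \<equiv> int (rollback n)"

text \<open>
  What rollback and descent need to know about the docks \<open>s\<close> before the rollback: a point of the path of
  penalized minimizers is so close that the rollback does not miss it, it moves at most \<open>N\<close> docks, and
  unless it minimizes the cost itself, it moves so many that few further steps are possible.
\<close>

definition near_path :: "int \<Rightarrow> (nat \<Rightarrow> int) \<Rightarrow> bool" where
  "near_path N s \<longleftrightarrow> (\<exists>x \<mu>. 0 \<le> \<mu> \<and> is_min (docks.penalized \<mu>) x \<and> norm1 V x \<le> 2 * N \<and>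
     (\<forall>k\<in>V. \<bar>x k - s k\<bar> \<le> K) \<and> (\<mu> = 0 \<or> 2 * N \<le> norm1 V x + 2 * K))"

lemma even_norm1:
  assumes "(\<Sum>k\<in>V. x k) = 0"
  shows "even (norm1 V x)"
proof -
  have "even (norm1 V x - (\<Sum>k\<in>V. x k))"
    unfolding norm1_def sum_subtractf[symmetric] by (rule dvd_sum) (auto simp: abs_if)
  then show ?thesis using assms by simp
qed

lemma dock_cost_sum: "dock_cost x < \<infinity> \<Longrightarrow> (\<Sum>k\<in>V. x k) = 0"
  by (auto simp: dock_cost_def split: if_splits)

lemma dock_cost_origin: "dock_cost (\<lambda>_. 0) < \<infinity>"
proof -
  have "balanced n zero_alloc" by (simp add: balanced_def zero_alloc_def)
  moreover have "F zero_alloc < \<infinity>" unfolding F_finite_iff zero_alloc_def fst_conv snd_conv using f_origin by blast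
  moreover have "capacity zero_alloc = (\<lambda>_. 0)" by (simp add: capacity_def zero_alloc_def)
  ultimately show ?thesis using dock_cost_le[of zero_alloc] by (auto intro: le_less_trans)
qed

text \<open>
  An optimum near \<open>X\<close> for the same multiplier may move more docks than \<open>N\<close> allows; but only slightly more,
  as \<open>X\<close> respects the bound. Following the path back to \<open>N\<close> moved docks then changes little.
\<close>

lemma near_path_from_coarse:
  assumes n: "1 \<le> n" and r: "0 \<le> r" and bal: "balanced n X" and fin: "F X < \<infinity>"
    and even_opt: "\<And>U. balanced n U \<Longrightarrow> penalized_cost r X \<le> penalized_cost r (plus_alloc X (scale_alloc 2 U))"
    and N: "0 \<le> N" "norm1 V (capacity X) \<le> 2 * N" "r = 0 \<or> 2 * N \<le> norm1 V (capacity X) + 2"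
  shows "near_path N (capacity X)"
proof -
  let ?s = "capacity X"
  obtain Y where Y: "optimal r Y" and close: "\<forall>k\<in>V. \<bar>capacity Y k - ?s k\<bar> \<le> 6 * int n"
    using proximity[OF r bal fin even_opt] by blast
  let ?y = "capacity Y"
  have ymin: "is_min (docks.penalized r) ?y" using Y by (simp add: optimal_iff)
  have dist: "dist1 V ?y ?s \<le> 6 * int n ^ 2"
  proof -
    have "dist1 V ?y ?s \<le> (\<Sum>k\<in>V. 6 * int n)" unfolding dist1_def by (rule sum_mono) (use close in auto)
    then show ?thesis by (simp add: power2_eq_square)
  qed
  have ineq: "12 * int n ^ 2 \<le> K" "6 * int n ^ 2 + 2 \<le> 2 * K" "int n \<le> int n ^ 2"
    using rollback_ge[OF n] n unfolding of_nat_le_iff[where 'a=int, symmetric]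
    by (simp_all add: power2_eq_square)
  have ns: "norm1 V ?s \<le> norm1 V ?y + 6 * int n ^ 2" "norm1 V ?y \<le> norm1 V ?s + 6 * int n ^ 2"
    using norm1_triangle[of V ?s ?y] norm1_triangle[of V ?y ?s] dist by (simp_all add: dist1_commute)
  show ?thesis
  proof (cases "norm1 V ?y \<le> 2 * N")
    case True
    have "\<forall>k\<in>V. \<bar>?y k - ?s k\<bar> \<le> K"
    proof
      fix k assume "k \<in> V"
      then have "\<bar>?y k - ?s k\<bar> \<le> 6 * int n" using close by blast
      then show "\<bar>?y k - ?s k\<bar> \<le> K" using ineq by linarith
    qed
    moreover have "r = 0 \<or> 2 * N \<le> norm1 V ?y + 2 * K" using N(3) ns ineq by linarith
    ultimately show ?thesis using ymin r True unfolding near_path_def by blast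
  next
    case False
    have ev: "even (norm1 V ?y)" by (rule even_norm1) (use Y sum_capacity in \<open>auto simp: optimal_def\<close>)
    obtain x \<mu> where x: "r \<le> \<mu>" "is_min (docks.penalized \<mu>) x" "norm1 V x = 2 * N"
        "dist1 V ?y x \<le> norm1 V ?y - 2 * N"
      using docks.penalized_min_back[OF ymin r dock_cost_origin, of "nat N"] False N(1) ev by auto
    have "\<bar>x k - ?s k\<bar> \<le> K" if k: "k \<in> V" for k
    proof -
      have "\<bar>?y k - x k\<bar> \<le> dist1 V ?y x" unfolding dist1_def by (rule member_le_sum) (use k in auto)
      then have "\<bar>?y k - x k\<bar> \<le> 6 * int n ^ 2" using x(4) ns(2) N(2) by linarith
      moreover have "\<bar>?y k - ?s k\<bar> \<le> 6 * int n" using close k by blast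
      ultimately show ?thesis using ineq by linarith
    qed
    then show ?thesis using x r unfolding near_path_def by (intro exI[of _ x] exI[of _ \<mu>]) auto
  qed
qed

text \<open>
  Invariant of the descent from docks \<open>w\<close>, with at most \<open>R\<close> steps to go. Either \<open>w\<close> heads for a
  minimizer that can be reached within the bound \<open>N\<close>, or \<open>w\<close> lies between the origin and a penalized
  minimizer, and then every step increases the number of moved docks.
\<close>

definition descending :: "int \<Rightarrow> (nat \<Rightarrow> int) \<Rightarrow> nat \<Rightarrow> bool" where
  "descending N w R \<longleftrightarrow>
     (\<exists>x. is_min dock_cost x \<and> norm1 V w + dist1 V w x \<le> 2 * N \<and> dist1 V w x \<le> 2 * int R) \<or>
     (\<exists>x \<mu>. 0 < \<mu> \<and> is_min (docks.penalized \<mu>) x \<and> (\<forall>k\<in>V. conforms (w k) (x k)) \<and>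
       norm1 V x \<le> 2 * N \<and> 2 * N \<le> norm1 V w + 2 * int R)"

definition descent_bound :: nat where
  "descent_bound = (n ^ 2 + 1) * rollback n"

text \<open>
  The rollback by \<open>K\<close> passes the point of the path, which is within \<open>K\<close> of \<open>s\<close>, unless it has returned to
  the initial number of docks. In both cases \<open>w\<close> lies between the origin and that point.
\<close>

lemma descending_init:
  assumes near: "near_path N s" and roll: "second_rollback n K s w q" and n: "1 \<le> n"
    and no: "\<And>j. j \<in> V \<Longrightarrow> s j < 0 \<Longrightarrow> min (s j + K) 0 \<le> w j"
  shows "descending N w descent_bound"
proof -
  obtain x \<mu> where x: "0 \<le> \<mu>" "is_min (docks.penalized \<mu>) x" "norm1 V x \<le> 2 * N"
      "\<forall>k\<in>V. \<bar>x k - s k\<bar> \<le> K" "\<mu> = 0 \<or> 2 * N \<le> norm1 V x + 2 * K"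
    using near unfolding near_path_def by blast
  have nK: "K \<le> int n * K" using n mult_right_mono[of 1 "int n" K] by simp
  have box: "conforms (w k) (x k)" and move: "\<bar>w k - x k\<bar> \<le> 2 * (int n * K)" if k: "k \<in> V" for k
  proof -
    have xk: "\<bar>x k - s k\<bar> \<le> K" using x(4) k by blast
    have *: "0 \<le> s k \<Longrightarrow> 0 \<le> w k \<and> w k \<le> s k \<and> w k \<le> max (s k - K) 0 \<and> s k - int n * K \<le> w k"
      "s k < 0 \<Longrightarrow> s k \<le> w k \<and> w k \<le> 0 \<and> w k \<le> s k + int n * K"
      using roll k unfolding second_rollback_def by blast+
    show "conforms (w k) (x k)"
    proof (cases "0 \<le> s k")
      case True
      then show ?thesis using *(1) xk unfolding conforms_def by linarith
    next
      case False
      then show ?thesis using *(2) no[OF k] xk unfolding conforms_def by linarith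
    qed
    show "\<bar>w k - x k\<bar> \<le> 2 * (int n * K)" using * xk nK by linarith
  qed
  have normx: "norm1 V x = norm1 V w + dist1 V w x" by (rule norm1_conforms) (use box in blast)
  have "dist1 V w x \<le> (\<Sum>k\<in>V. 2 * (int n * K))" unfolding dist1_def by (rule sum_mono) (use move in auto)
  then have dist: "dist1 V w x \<le> 2 * (int n ^ 2 * K)" by (simp add: power2_eq_square mult.assoc mult.left_commute)
  have bound: "int descent_bound = int n ^ 2 * K + K" by (simp add: descent_bound_def distrib_right)
  show ?thesis
  proof (cases "\<mu> = 0")
    case True
    then have "is_min dock_cost x" using x(2) by simp
    then show ?thesis using normx x(3) dist bound unfolding descending_def by auto
  next
    case False
    then have "2 * N \<le> norm1 V w + 2 * int descent_bound" "0 < \<mu>"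
      using x(1,5) normx dist bound by linarith+
    then show ?thesis using x(2,3) box unfolding descending_def by blast
  qed
qed

lemma descending_norm1: 
  assumes "descending N w R"
  shows "norm1 V w \<le> 2 * N"
proof -
  have "0 \<le> dist1 V w x" for x by (rule dist1_nonneg)
  then show ?thesis
    using assms norm1_conforms[of V w] unfolding descending_def by (smt (verit, best))
qed

text \<open>
  A step that the bound forbids can only start from a penalized minimizer: towards any other target,
  the norm of \<open>w\<close> plus the distance to the target does not increase, and it is within the bound.
\<close>

lemma descending_step:
  assumes desc: "descending N w R" and fin: "dock_cost w < \<infinity>"
    and best: "best_transfer V dock_cost w i j" and less: "dock_cost (transfer i j w) < dock_cost w"
  shows "norm1 V (transfer i j w) \<le> 2 * N \<Longrightarrow> 0 < R \<and> descending N (transfer i j w) (R - 1)"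
    and "2 * N < norm1 V (transfer i j w) \<Longrightarrow> (\<exists>\<mu>>0. is_min (docks.penalized \<mu>) w) \<and> 2 * N \<le> norm1 V w"
proof -
  let ?w = "transfer i j w"
  have notmin: "\<not> is_min dock_cost w" using less by (auto simp: is_min_def not_le)
  have ij: "i \<in> V" "j \<in> V" "i \<noteq> j" using best by (auto simp: best_transfer_def)
  have len: "norm1 V ?w \<le> norm1 V w + 2" using norm1_transfer[OF _ ij, of w] by simp
  have nn: "0 \<le> dist1 V ?w x" for x by (rule dist1_nonneg)
  have ev: "even (norm1 V w)" by (rule even_norm1[OF dock_cost_sum[OF fin]])
  have "(norm1 V ?w \<le> 2 * N \<longrightarrow> 0 < R \<and> descending N ?w (R - 1)) \<and>
      (2 * N < norm1 V ?w \<longrightarrow> (\<exists>\<mu>>0. is_min (docks.penalized \<mu>) w) \<and> 2 * N \<le> norm1 V w)"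
    using desc unfolding descending_def[of N w]
  proof (elim disjE exE conjE)
    fix x assume x: "is_min dock_cost x" "norm1 V w + dist1 V w x \<le> 2 * N" "dist1 V w x \<le> 2 * int R"
    obtain y where y: "is_min dock_cost y" "dist1 V ?w y + 2 \<le> dist1 V w x"
      using docks.best_transfer_approaches_minimum[OF fin notmin best x(1)] by blast
    have R: "0 < R" using y x nn[of y] by linarith
    have "norm1 V ?w + dist1 V ?w y \<le> 2 * N" "dist1 V ?w y \<le> 2 * int (R - 1)"
      using y x len R by (simp_all add: of_nat_diff)
    then show ?thesis using y R nn[of y] unfolding descending_def by force
  next
    fix x \<mu> assume x: "0 < \<mu>" "is_min (docks.penalized \<mu>) x" "\<forall>k\<in>V. conforms (w k) (x k)"
      "norm1 V x \<le> 2 * N" "2 * N \<le> norm1 V w + 2 * int R"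
    show ?thesis
    proof (cases "is_min (docks.penalized \<mu>) w")
      case True
      have norm: "norm1 V ?w = norm1 V w + 2"
        using docks.best_transfer_from_penalized_min(1)[OF True _ best less] x(1) by simp
      obtain \<nu> where nu: "0 < \<nu>" "is_min (docks.penalized \<nu>) ?w"
        using docks.best_transfer_from_penalized_min(2)[OF True _ best less] x(1) by auto
      show ?thesis
      proof (intro conjI impI)
        assume le: "norm1 V ?w \<le> 2 * N"
        then show R: "0 < R" using x(5) norm by linarith
        have "2 * N \<le> norm1 V ?w + 2 * int (R - 1)" using x(5) norm R by (simp add: of_nat_diff)
        moreover have "\<forall>k\<in>V. conforms (?w k) (?w k)" by (auto simp: conforms_def)
        ultimately show "descending N ?w (R - 1)" using nu le unfolding descending_def by blast
      next
        assume "2 * N < norm1 V ?w"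
        then show "2 * N \<le> norm1 V w" using norm ev by presburger
        show "\<exists>\<mu>>0. is_min (docks.penalized \<mu>) w" using True x(1) by blast
      qed
    next
      case False
      note step = docks.best_transfer_towards_penalized_min[OF x(1,2,3) fin False best]
      obtain y where y: "is_min (docks.penalized \<mu>) y" "\<forall>k\<in>V. conforms (?w k) (y k)" "norm1 V y \<le> norm1 V x"
        using step(3) by blast
      have "norm1 V ?w \<le> norm1 V y" using norm1_conforms[OF y(2)] nn[of y] by simp
      then have le: "norm1 V ?w \<le> 2 * N" using y x by linarith
      have R: "0 < R" using step(1) x(5) le by linarith
      have "2 * N \<le> norm1 V ?w + 2 * int (R - 1)" using x(5) step(1) R by (simp add: of_nat_diff)
      moreover have "norm1 V y \<le> 2 * N" using y x by linarith
      ultimately have "descending N ?w (R - 1)" using y x(1) unfolding descending_def by blast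
      then show ?thesis using R le by auto
    qed
  qed
  then show "norm1 V ?w \<le> 2 * N \<Longrightarrow> 0 < R \<and> descending N ?w (R - 1)"
    and "2 * N < norm1 V ?w \<Longrightarrow> (\<exists>\<mu>>0. is_min (docks.penalized \<mu>) w) \<and> 2 * N \<le> norm1 V w" by blast+
qed

lemma best_move_towards_origin:
  assumes X: "bike_optimal X" and i: "i \<in> V" "0 < capacity X i" and j: "j \<in> V" "capacity X j < 0"
    and m: "m \<in> moves n i j"
    and best: "\<And>m'. m' \<in> moves n i j \<Longrightarrow> F (apply_move 1 m X) \<le> F (apply_move 1 m' X)"
  shows "bike_optimal (apply_move 1 m X) \<and> capacity (apply_move 1 m X) = transfer i j (capacity X)"
proof -
  have ne: "i \<noteq> j" using i j by auto
  note * = best_move_bike_optimal[OF X i(1) j(1) ne m best]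
  show ?thesis using *(2,3) *(1) towards_origin_finite[OF X i j] by simp
qed

text \<open>
  The descent step minimizes over all dock-moves; between bike-optimal allocations this is a best
  transfer for the dock cost.
\<close>

lemma best_move_best_transfer:
  assumes X: "bike_optimal X" and ij: "i \<in> V" "j \<in> V" "i \<noteq> j" and m: "m \<in> moves n i j"
    and best: "\<And>a b m'. a \<in> V \<Longrightarrow> b \<in> V \<Longrightarrow> a \<noteq> b \<Longrightarrow> m' \<in> moves n a b \<Longrightarrow>
      F (apply_move 1 m X) \<le> F (apply_move 1 m' X)"
  shows "best_transfer V dock_cost (capacity X) i j"
    and "F (apply_move 1 m X) = dock_cost (transfer i j (capacity X))"
    and "capacity (apply_move 1 m X) = transfer i j (capacity X)"
    and "F (apply_move 1 m X) < \<infinity> \<Longrightarrow> bike_optimal (apply_move 1 m X)"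
proof -
  note * = best_move_bike_optimal[OF X ij m best[OF ij]]
  show 1: "F (apply_move 1 m X) = dock_cost (transfer i j (capacity X))" using *(1) .
  show "capacity (apply_move 1 m X) = transfer i j (capacity X)" using *(2) .
  show "F (apply_move 1 m X) < \<infinity> \<Longrightarrow> bike_optimal (apply_move 1 m X)" using *(3) .
  have "dock_cost (transfer i j (capacity X)) \<le> dock_cost (transfer a b (capacity X))"
    if ab: "a \<in> V" "b \<in> V" "a \<noteq> b" for a b
  proof -
    obtain m' where "m' \<in> moves n a b" "F (apply_move 1 m' X) \<le> dock_cost (transfer a b (capacity X))"
      using dock_move_le[OF X ab] by blast
    then show ?thesis using best[OF ab, of m'] 1 by (metis order_trans)
  qed
  then show "best_transfer V dock_cost (capacity X) i j" using ij by (auto simp: best_transfer_def)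
qed

subsection \<open>The bike step\<close>

definition bike_distance :: "alloc \<Rightarrow> nat \<Rightarrow> bool" where
  "bike_distance X q \<longleftrightarrow> balanced n X \<and> F X < \<infinity> \<and>
     (\<exists>\<beta>. is_min (bike_cost (capacity X)) \<beta> \<and> dist1 V (snd X) \<beta> \<le> 2 * int q)"

text \<open>
  Written without subtraction, as the costs may be infinite.
\<close>

lemma F_bike_move:
  assumes "i \<in> V" "j \<in> V" "i \<noteq> j"
  shows "F (bike_move 1 i j X) + (f i (fst X i) (snd X i) + f j (fst X j) (snd X j)) =
    F X + (f i (fst X i - 1) (snd X i + 1) + f j (fst X j + 1) (snd X j - 1))"
proof -
  have V: "V = insert i (insert j (V - {i, j}))" "finite (V - {i, j})" using assms by auto
  have *: "(\<Sum>k\<in>V. h k) = h i + (h j + (\<Sum>k\<in>V - {i, j}. h k))" for h :: "nat \<Rightarrow> ereal"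
    using assms(3) V(2) by (subst V(1)) simp
  have "(\<Sum>k\<in>V - {i, j}. f k (fst (bike_move 1 i j X) k) (snd (bike_move 1 i j X) k)) =
      (\<Sum>k\<in>V - {i, j}. f k (fst X k) (snd X k))"
    by (rule sum.cong) (cases X; auto simp: unit_vec_def)+
  moreover have "fst (bike_move 1 i j X) i = fst X i - 1" "snd (bike_move 1 i j X) i = snd X i + 1"
    "fst (bike_move 1 i j X) j = fst X j + 1" "snd (bike_move 1 i j X) j = snd X j - 1"
    using assms(3) by (cases X; simp add: unit_vec_def)+
  ultimately show ?thesis unfolding objective_def * by (simp add: ac_simps)
qed

lemma ereal_gain_le:
  fixes a a' b b' i i' j j' :: ereal
  assumes "a - a' \<le> i - i'" "b - b' \<le> j - j'"
    and "0 \<le> a" "0 \<le> a'" "0 \<le> b" "0 \<le> b'" "0 \<le> i" "0 \<le> i'" "0 \<le> j" "0 \<le> j'"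
    and "a < \<infinity>" "b < \<infinity>" "i < \<infinity>" "j < \<infinity>"
  shows "(i' + j') + (a + b) \<le> (a' + b') + (i + j)"
proof (cases "a' < \<infinity> \<and> b' < \<infinity>")
  case False
  then show ?thesis using assms by auto
next
  case True
  have 1: "i' + a \<le> a' + i"
    using assms True by (cases a; cases a'; cases i; cases i') auto
  have 2: "j' + b \<le> b' + j"
    using assms True by (cases b; cases b'; cases j; cases j') auto
  show ?thesis using add_mono[OF 1 2] by (simp add: ac_simps)
qed

lemma ereal_le_add_cancel:
  fixes a b c :: ereal
  shows "a + c \<le> b + c \<Longrightarrow> 0 \<le> c \<Longrightarrow> c < \<infinity> \<Longrightarrow> a \<le> b"
  by (cases a; cases b; cases c) auto

text \<open>
  The largest gains at single stations give the steepest exchange of a bike between two different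
  stations. If both are attained at the same station, convexity makes their sum nonpositive.
\<close>

lemma bike_step:
  assumes inv: "bike_distance X q" and ij: "i \<in> V" "j \<in> V"
    and max_i: "\<And>a. a \<in> V \<Longrightarrow>
      f a (fst X a) (snd X a) - f a (fst X a - 1) (snd X a + 1) \<le>
      f i (fst X i) (snd X i) - f i (fst X i - 1) (snd X i + 1)"
    and max_j: "\<And>b. b \<in> V \<Longrightarrow>
      f b (fst X b) (snd X b) - f b (fst X b + 1) (snd X b - 1) \<le>
      f j (fst X j) (snd X j) - f j (fst X j + 1) (snd X j - 1)"
  defines "X' \<equiv> bike_move 1 i j X"
  defines "old \<equiv> f i (fst X i) (snd X i) + f j (fst X j) (snd X j)"
    and "new \<equiv> f i (fst X' i) (snd X' i) + f j (fst X' j) (snd X' j)"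
  shows "new < old \<Longrightarrow> 0 < q \<and> bike_distance X' (q - 1) \<and> capacity X' = capacity X"
    and "\<not> new < old \<Longrightarrow> bike_optimal X"
proof -
  let ?g = "bike_cost (capacity X)"
  interpret M_convex V ?g by (rule M_convex_bike_cost)
  define c where "c k = f k (fst X k) (snd X k)" for k
  define u where "u k = f k (fst X k - 1) (snd X k + 1)" for k
  define w where "w k = f k (fst X k + 1) (snd X k - 1)" for k
  have bal: "balanced n X" and fin: "F X < \<infinity>" using inv by (auto simp: bike_distance_def)
  have cfin: "c k < \<infinity>" if "k \<in> V" for k using fin that unfolding F_finite_iff c_def by blast
  have nn: "0 \<le> c k" "0 \<le> u k" "0 \<le> w k" for k by (simp_all add: c_def u_def w_def f_nonneg)
  have gain: "(u i + w j) + (c a + c b) \<le> (u a + w b) + (c i + c j)" if "a \<in> V" "b \<in> V" for a b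
    by (rule ereal_gain_le) (use max_i[OF that(1)] max_j[OF that(2)] nn cfin ij that in \<open>simp_all add: c_def u_def w_def\<close>)
  have gX: "?g (snd X) = F X" by (rule bike_cost_snd[OF bal])
  have bal': "balanced n (bike_move 1 a b X)" if "a \<in> V" "b \<in> V" for a b
    using balanced_plus[OF bal balanced_bike_vec[OF that, of 1]] unfolding plus_bike_vec .
  have cap: "capacity (bike_move 1 a b X) = capacity X" for a b
    by (simp add: bike_move_with_bikes)
  have g: "?g (transfer b a (snd X)) = F (bike_move 1 a b X)" if "a \<in> V" "b \<in> V" for a b
    using bike_cost_snd[OF bal'[OF that]] unfolding cap by (simp add: bike_move_with_bikes)
  have eq: "?g (transfer b a (snd X)) + (c a + c b) = F X + (u a + w b)" if "a \<in> V" "b \<in> V" "a \<noteq> b" for a b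
    using F_bike_move[OF that] g[OF that(1,2)] by (simp add: c_def u_def w_def)
  have new_eq: "i \<noteq> j \<Longrightarrow> new = u i + w j"
    unfolding new_def X'_def u_def w_def by (cases X) (simp add: unit_vec_def)
  have old_eq: "old = c i + c j" by (simp add: old_def c_def)
  have cc_fin: "c a + c b < \<infinity>" if "a \<in> V" "b \<in> V" for a b
    using cfin[OF that(1)] cfin[OF that(2)] by simp
  show "0 < q \<and> bike_distance X' (q - 1) \<and> capacity X' = capacity X" if less: "new < old"
  proof -
    have ne: "i \<noteq> j"
    proof
      assume "i = j"
      then have "new = old" unfolding new_def old_def X'_def by (cases X) simp
      then show False using less by simp
    qed
    have best: "best_transfer V ?g (snd X) j i"
      unfolding best_transfer_def
    proof (intro conjI ballI impI)
      fix b a assume ab: "b \<in> V" "a \<in> V" "b \<noteq> a"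
      let ?ji = "?g (transfer j i (snd X))" and ?ba = "?g (transfer b a (snd X))"
      have "?ji + ((c i + c j) + (c a + c b)) = F X + ((u i + w j) + (c a + c b))"
        using eq[OF ij ne] by (metis add.assoc)
      also have "\<dots> \<le> F X + ((u a + w b) + (c i + c j))" by (intro add_mono gain ab order_refl)
      also have "\<dots> = ?ba + ((c i + c j) + (c a + c b))"
        using eq[OF ab(2,1) ab(3)[symmetric]] by (metis add.assoc add.commute)
      finally show "?ji \<le> ?ba"
      proof (rule ereal_le_add_cancel)
        show "0 \<le> (c i + c j) + (c a + c b)" by (intro add_nonneg_nonneg nn)
        show "(c i + c j) + (c a + c b) < \<infinity>" using cc_fin[OF ij] cc_fin[OF ab(2,1)] by simp
      qed
    qed (use ij ne in auto)
    have lt: "?g (transfer j i (snd X)) < ?g (snd X)"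
    proof (rule ccontr)
      assume "\<not> ?thesis"
      then have "(c i + c j) + F X \<le> (u i + w j) + F X"
        unfolding add.commute[of _ "F X"] eq[OF ij ne, symmetric] gX by (intro add_mono) auto
      then have "old \<le> new" unfolding new_eq[OF ne] old_eq
        by (rule ereal_le_add_cancel) (fact F_nonneg fin)+
      then show False using less by simp
    qed
    then have notmin: "\<not> is_min ?g (snd X)" by (auto simp: is_min_def not_le)
    obtain \<beta> where b: "is_min ?g \<beta>" "dist1 V (snd X) \<beta> \<le> 2 * int q"
      using inv by (auto simp: bike_distance_def)
    have gfin: "?g (snd X) < \<infinity>" using gX fin by simp
    obtain \<gamma> where c: "is_min ?g \<gamma>" "dist1 V (transfer j i (snd X)) \<gamma> + 2 \<le> dist1 V (snd X) \<beta>"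
      using best_transfer_approaches_minimum[OF gfin notmin best b(1)] by blast
    have snd: "snd X' = transfer j i (snd X)" unfolding X'_def by (simp add: bike_move_with_bikes)
    have cap': "capacity X' = capacity X" unfolding X'_def by (rule cap)
    have q: "0 < q" using b c dist1_nonneg[of V "transfer j i (snd X)" \<gamma>] by linarith
    have "F X' < \<infinity>" using lt gfin g[OF ij] unfolding X'_def by (metis less_trans)
    moreover have "balanced n X'" unfolding X'_def by (rule bal'[OF ij])
    moreover have "dist1 V (snd X') \<gamma> \<le> 2 * int (q - 1)"
      using b c q unfolding snd by (simp add: of_nat_diff)
    ultimately show ?thesis using q c(1) cap' unfolding bike_distance_def by auto
  qed
  show "bike_optimal X" if nl: "\<not> new < old"
  proof -
    have le: "c i + c j \<le> u i + w j"
    proof (cases "i = j")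
      case True
      have "fits 1 (- 1) 2 (- 2)" by (simp add: fits_def conforms_def)
      from f_multimodular[OF ij(1), unfolded multimodular_def, rule_format, OF this, of "fst X i - 1" "snd X i + 1"]
      show ?thesis using True by (simp add: c_def u_def w_def add.commute[of 1])
    next
      case False
      then show ?thesis using nl unfolding old_eq new_eq[OF False] by simp
    qed
    have "is_min ?g (snd X)"
    proof (rule local_min_imp_is_min)
      show "?g (snd X) < \<infinity>" using gX fin by simp
      fix b a assume ab: "b \<in> V" "a \<in> V" "b \<noteq> a"
      have le': "c a + c b \<le> u a + w b"
      proof (cases "u a + w b < \<infinity>")
        case True
        show ?thesis
        proof (rule ereal_add_le_cancel[OF _ le])
          show "c a + c b + (u i + w j) \<le> u a + w b + (c i + c j)"
            using gain[OF ab(2,1)] by (simp add: add.commute)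
        qed (use True cc_fin[OF ij] nn in \<open>auto intro: add_nonneg_nonneg\<close>)
      qed auto
      have "F X + (c a + c b) \<le> ?g (transfer b a (snd X)) + (c a + c b)"
        unfolding eq[OF ab(2,1) ab(3)[symmetric]] by (intro add_mono le' order_refl)
      then show "?g (snd X) \<le> ?g (transfer b a (snd X))"
        unfolding gX by (rule ereal_le_add_cancel) (intro add_nonneg_nonneg nn, rule cc_fin[OF ab(2,1)])
    qed
    then show ?thesis using is_min_bike_costD[of "capacity X" "snd X"] sum_capacity[OF bal] by simp
  qed
qed

end

section \<open>Partial correctness and running time of computations\<close>

text \<open>A Hoare triple with a time bound. Having an outcome at all means not being stuck.\<close>

definition spec :: "'a nd \<Rightarrow> ('a \<Rightarrow> bool) \<Rightarrow> nat \<Rightarrow> bool" where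
  "spec m Q t \<longleftrightarrow> outcomes m \<noteq> {} \<and> (\<forall>(x, s)\<in>outcomes m. Q x \<and> s \<le> t)"

lemma spec_bind:
  assumes "spec m Q s" "\<And>x. Q x \<Longrightarrow> spec (f x) R t" "s + t \<le> u"
  shows "spec (nd_bind m f) R u"
proof -
  obtain x s' where x: "(x, s') \<in> outcomes m" using assms(1) by (auto simp: spec_def)
  then have "Q x" using assms(1) by (auto simp: spec_def)
  then obtain y t' where "(y, t') \<in> outcomes (f x)" using assms(2) by (fastforce simp: spec_def)
  then have "(y, s' + t') \<in> outcomes (nd_bind m f)" using x by (auto simp: nd_bind_def)
  moreover have "R y \<and> r \<le> u" if yr: "(y, r) \<in> outcomes (nd_bind m f)" for y r
  proof -
    obtain x s' t' where *: "(x, s') \<in> outcomes m" "(y, t') \<in> outcomes (f x)" "r = s' + t'"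
      using yr by (auto simp: nd_bind_def)
    then have "Q x" "s' \<le> s" using assms(1) by (auto simp: spec_def)
    then have "R y" "t' \<le> t" using assms(2)[of x] * by (auto simp: spec_def)
    then show ?thesis using * \<open>s' \<le> s\<close> assms(3) by simp
  qed
  ultimately show ?thesis by (auto simp: spec_def)
qed

lemma spec_ops: "Q x \<Longrightarrow> m \<le> t \<Longrightarrow> spec (ops m x) Q t"
  by (simp add: spec_def ops_def)

lemma spec_one_of: "S \<noteq> {} \<Longrightarrow> (\<And>x. x \<in> S \<Longrightarrow> Q x) \<Longrightarrow> spec (one_of S) Q t"
  by (auto simp: spec_def one_of_def)

lemma spec_weaken: "spec m Q s \<Longrightarrow> (\<And>x. Q x \<Longrightarrow> R x) \<Longrightarrow> s \<le> t \<Longrightarrow> spec m R t"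
  by (fastforce simp: spec_def)

lemma spec_bind_ops:
  assumes "spec (f x) R t" "m + t \<le> u"
  shows "spec (nd_bind (ops m x) f) R u"
  by (rule spec_bind[where Q = "\<lambda>y. y = x" and s = m and t = t]) (use assms in \<open>auto intro: spec_ops\<close>)

lemma spec_scan_best:
  assumes f: "\<And>x. x \<in> set xs \<Longrightarrow> spec (f x) (\<lambda>v. v = g x) t"
    and asym: "\<And>a b. better a b \<Longrightarrow> \<not> better b a"
    and trans: "\<And>a b c. \<not> better a b \<Longrightarrow> \<not> better b c \<Longrightarrow> \<not> better a c"
  shows "spec (scan_best better f xs)
    (\<lambda>r. case r of None \<Rightarrow> xs = []
       | Some (x, v) \<Rightarrow> x \<in> set xs \<and> v = g x \<and> (\<forall>y\<in>set xs. \<not> better (g y) (g x)))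
    (length xs * (t + 2))"
  using f
proof (induction xs)
  case Nil
  then show ?case by (auto intro: spec_ops)
next
  case (Cons x xs)
  have irrefl: "\<not> better a a" for a using asym by blast
  show ?case unfolding scan_best.simps
  proof (rule spec_bind[where s = t and t = "length xs * (t + 2) + 2"])
    show "spec (f x) (\<lambda>v. v = g x) t" using Cons.prems by simp
    fix v assume v: "v = g x"
    show "spec (nd_bind (scan_best better f xs)
        (\<lambda>r. case r of None \<Rightarrow> ops 0 (Some (x, v))
           | Some (y, w) \<Rightarrow> nd_bind (ops 1 (better v w)) (\<lambda>x_wins. nd_bind (ops 1 (better w v)) (\<lambda>y_wins.
               if x_wins then ops 0 (Some (x, v)) else if y_wins then ops 0 (Some (y, w))
               else one_of {Some (x, v), Some (y, w)}))))
        (\<lambda>r. case r of None \<Rightarrow> x # xs = []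
           | Some (x', v) \<Rightarrow> x' \<in> set (x # xs) \<and> v = g x' \<and> (\<forall>y\<in>set (x # xs). \<not> better (g y) (g x')))
        (length xs * (t + 2) + 2)"
    proof (rule spec_bind[OF Cons.IH])
      show "spec (f y) (\<lambda>v. v = g y) t" if "y \<in> set xs" for y using Cons.prems that by simp
      fix r assume r: "case r of None \<Rightarrow> xs = []
         | Some (x, v) \<Rightarrow> x \<in> set xs \<and> v = g x \<and> (\<forall>y\<in>set xs. \<not> better (g y) (g x))"
      show "spec (case r of None \<Rightarrow> ops 0 (Some (x, v))
           | Some (y, w) \<Rightarrow> nd_bind (ops 1 (better v w)) (\<lambda>x_wins. nd_bind (ops 1 (better w v)) (\<lambda>y_wins.
               if x_wins then ops 0 (Some (x, v)) else if y_wins then ops 0 (Some (y, w))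
               else one_of {Some (x, v), Some (y, w)})))
          (\<lambda>r. case r of None \<Rightarrow> x # xs = []
             | Some (x', v) \<Rightarrow> x' \<in> set (x # xs) \<and> v = g x' \<and> (\<forall>y\<in>set (x # xs). \<not> better (g y) (g x'))) 2"
      proof (cases r)
        case None
        then show ?thesis using r v irrefl by (auto intro: spec_ops)
      next
        case (Some yw)
        obtain y w where yw: "yw = (y, w)" by force
        have y: "y \<in> set xs" "w = g y" "\<And>y'. y' \<in> set xs \<Longrightarrow> \<not> better (g y') (g y)"
          using r Some yw by auto
        let ?R = "\<lambda>r. case r of None \<Rightarrow> x # xs = []
          | Some (x', v) \<Rightarrow> x' \<in> set (x # xs) \<and> v = g x' \<and> (\<forall>y\<in>set (x # xs). \<not> better (g y) (g x'))"
        have Rx: "?R (Some (x, g x))" if "\<not> better (g y) (g x)"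
          using trans[OF y(3) that] irrefl by simp
        have Ry: "?R (Some (y, g y))" if "\<not> better (g x) (g y)"
          using y that by simp
        have "spec (if better (g x) (g y) then ops 0 (Some (x, g x)) else if better (g y) (g x) then ops 0 (Some (y, g y))
            else one_of {Some (x, g x), Some (y, g y)}) ?R 0"
        proof (cases "better (g x) (g y)")
          case True
          have "spec (ops 0 (Some (x, g x))) ?R 0" by (rule spec_ops, rule Rx[OF asym[OF True]]) simp
          then show ?thesis using True by simp
        next
          case no: False
          show ?thesis
          proof (cases "better (g y) (g x)")
            case True
            have "spec (ops 0 (Some (y, g y))) ?R 0" by (rule spec_ops, rule Ry[OF no]) simp
            then show ?thesis using True no by simp
          next
            case False
            have "spec (one_of {Some (x, g x), Some (y, g y)}) ?R 0"
              by (rule spec_one_of) (use Rx[OF False] Ry[OF no] in blast)+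
            then show ?thesis using False no by simp
          qed
        qed
        then show ?thesis
          unfolding Some yw option.case prod.case v y(2)
          by (intro spec_bind_ops[where t = 1] spec_bind_ops[where t = 0]) auto
      qed
    qed simp
  qed simp
qed

lemma spec_scan_min:
  fixes g :: "'a \<Rightarrow> ereal"
  assumes "\<And>x. x \<in> set xs \<Longrightarrow> spec (f x) (\<lambda>v. v = g x) t"
  shows "spec (scan_min f xs)
    (\<lambda>r. case r of None \<Rightarrow> xs = []
       | Some (x, v) \<Rightarrow> x \<in> set xs \<and> v = g x \<and> (\<forall>y\<in>set xs. g x \<le> g y)) (length xs * (t + 2))"
  using spec_scan_best[of xs f g t "(<)"] assms by (simp add: not_less)

lemma spec_scan_max:
  fixes g :: "'a \<Rightarrow> ereal"
  assumes "\<And>x. x \<in> set xs \<Longrightarrow> spec (f x) (\<lambda>v. v = g x) t"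
  shows "spec (scan_max f xs)
    (\<lambda>r. case r of None \<Rightarrow> xs = []
       | Some (x, v) \<Rightarrow> x \<in> set xs \<and> v = g x \<and> (\<forall>y\<in>set xs. g y \<le> g x)) (length xs * (t + 2))"
  using spec_scan_best[of xs f g t "(>)"] assms by (simp add: not_less)

lemma spec_pick:
  assumes P: "\<And>x. spec (P x) (\<lambda>b. b = Q x) t"
  shows "spec (pick P xs)
    (\<lambda>r. case r of None \<Rightarrow> \<forall>x\<in>set xs. \<not> Q x | Some x \<Rightarrow> x \<in> set xs \<and> Q x) (length xs * t)"
proof -
  have "spec (scan_filter P xs) (\<lambda>ys. ys = filter Q xs) (length xs * t)"
  proof (induction xs)
    case Nil
    then show ?case by (auto intro: spec_ops)
  next
    case (Cons x xs)
    show ?case unfolding scan_filter.simps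
    proof (rule spec_bind[OF P])
      fix b assume b: "b = Q x"
      show "spec (nd_bind (scan_filter P xs) (\<lambda>ys. ops 0 (if b then x # ys else ys)))
          (\<lambda>ys. ys = filter Q (x # xs)) (length xs * t)"
        by (rule spec_bind[OF Cons, where t = 0]) (auto intro!: spec_ops simp: b)
    qed simp
  qed
  then show ?thesis unfolding pick_def
    by (rule spec_bind[where t = 0])
      (auto intro!: spec_ops spec_one_of simp: filter_empty_conv split: if_splits)
qed

section \<open>Running time of the scaling algorithm\<close>

locale scaling_run = scaling_algorithm +
  assumes total: "1 \<le> B + D"
    and start_alloc: "is_allocation n D B (dbar, bbar)"
    and rescaled_stations: "\<And>a. 1 \<le> a \<Longrightarrow> multimodular_stations n (rescaled c dbar bbar a)"
    and cost_domain: "\<And>k d b. c k d b < \<infinity> \<Longrightarrow> 0 \<le> d \<and> 0 \<le> b"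
begin

abbreviation "L \<equiv> last_phase"
abbreviation f :: "int \<Rightarrow> nat \<Rightarrow> int \<Rightarrow> int \<Rightarrow> ereal" where "f a \<equiv> rescaled c dbar bbar a"
abbreviation "M \<equiv> rollback n"

definition embed :: "int \<Rightarrow> alloc \<Rightarrow> alloc" where
  "embed a X = (\<lambda>k. dbar k + a * fst X k, \<lambda>k. bbar k + a * snd X k)"

lemma n_pos: "1 \<le> n"
proof (rule ccontr)
  assume "\<not> ?thesis"
  then have "n = 0" by simp
  then show False using start_alloc total by (simp add: is_allocation_def)
qed

lemma objective_embed: "objective n c (embed a X) = objective n (f a) X"
  by (simp add: objective_def embed_def rescaled_def)

lemma apply_move_embed: "apply_move a m (embed a X) = embed a (apply_move 1 m X)"
  by (cases X; cases m) (auto simp: embed_def algebra_simps)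

lemma bike_move_embed: "bike_move a i j (embed a X) = embed a (bike_move 1 i j X)"
  by (cases X) (auto simp: embed_def algebra_simps)

lemma docks_embed: "docks (embed a X) k = docks0 k + a * capacity X k"
  by (simp add: docks_def docks0_def embed_def capacity_def algebra_simps)

lemma dock_distance_embed:
  assumes "0 \<le> a"
  shows "dock_distance (embed a X) = a * norm1 {1..n} (capacity X)"
  using assms by (simp add: dock_distance_def docks_embed norm1_def sum_distrib_left abs_mult)

lemma surplus_iff:
  assumes "1 \<le> a"
  shows "docks (embed a S) i \<ge> docks0 i \<and>
      docks (embed a X) i > max (docks (embed a S) i - r * a) (docks0 i) \<longleftrightarrow>
    0 \<le> capacity S i \<and> max (capacity S i - r) 0 < capacity X i"
proof -
  have "0 < a" using assms by simp
  have "a * capacity S i - r * a < a * capacity X i \<longleftrightarrow> capacity S i - r < capacity X i"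
    using mult_less_cancel_left_pos[OF \<open>0 < a\<close>, of "capacity S i - r" "capacity X i"] by (simp add: algebra_simps)
  then show ?thesis using \<open>0 < a\<close> by (simp add: docks_embed zero_le_mult_iff zero_less_mult_iff)
qed

lemma deficit_iff:
  assumes "1 \<le> a"
  shows "docks (embed a S) j < docks0 j \<and>
      docks (embed a X) j < min (docks (embed a S) j + r * a) (docks0 j) \<longleftrightarrow>
    capacity S j < 0 \<and> capacity X j < min (capacity S j + r) 0"
proof -
  have "0 < a" using assms by simp
  have "a * capacity X j < a * capacity S j + r * a \<longleftrightarrow> capacity X j < capacity S j + r"
    using mult_less_cancel_left_pos[OF \<open>0 < a\<close>, of "capacity X j" "capacity S j + r"] by (simp add: algebra_simps)
  then show ?thesis using \<open>0 < a\<close> by (simp add: docks_embed mult_less_0_iff)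
qed

lemma set_stations: "set stations = {1..n}" and length_stations: "length stations = n"
  by (auto simp: stations_def)

lemma set_moves_between: "set (moves_between i j) = moves n i j"
  by (auto simp: moves_between_def moves_def set_stations)

lemma length_moves_between: "length (moves_between i j) = 2 * n + 2"
  by (simp add: moves_between_def length_concat comp_def sum_list_triv length_stations)

lemma set_all_moves: "set all_moves = (\<Union>i\<in>{1..n}. \<Union>j\<in>{1..n} - {i}. moves n i j)"
  unfolding all_moves_def
  by (simp only: set_concat set_map set_filter set_stations set_moves_between image_image) blast

lemma length_all_moves: "length all_moves \<le> n * (n * (2 * n + 2))"
proof -
  have 1: "length (concat (map (moves_between i) (filter (\<lambda>j. j \<noteq> i) stations))) \<le> n * (2 * n + 2)" for i
  proof -
    have "length (filter (\<lambda>j. j \<noteq> i) stations) \<le> n" using length_filter_le length_stations by metis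
    then show ?thesis
      by (simp add: length_concat comp_def length_moves_between sum_list_triv del: mult_Suc_right)
  qed
  have "length all_moves = (\<Sum>i\<leftarrow>stations. length (concat (map (moves_between i) (filter (\<lambda>j. j \<noteq> i) stations))))"
    by (simp add: all_moves_def length_concat comp_def)
  also have "\<dots> \<le> (\<Sum>i\<leftarrow>stations. n * (2 * n + 2))" by (rule sum_list_mono) (rule 1)
  finally show ?thesis by (simp add: sum_list_triv length_stations)
qed

lemma spec_query: "spec (query i d b) (\<lambda>v. v = c i d b) 1"
  by (auto simp: query_def intro: spec_ops)

lemma spec_sum_costs:
  "spec (sum_costs a is) (\<lambda>v. v = (\<Sum>i\<leftarrow>is. c i (fst a i) (snd a i))) (2 * length is)"
proof (induction "is")
  case Nil
  then show ?case by (auto intro: spec_ops)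
next
  case (Cons i "is")
  show ?case unfolding sum_costs.simps
  proof (rule spec_bind[OF spec_query])
    fix x assume x: "x = c i (fst a i) (snd a i)"
    show "spec (nd_bind (sum_costs a is) (\<lambda>y. ops 1 (x + y)))
        (\<lambda>v. v = (\<Sum>i\<leftarrow>i # is. c i (fst a i) (snd a i))) (2 * length is + 1)"
      by (rule spec_bind[OF Cons, where t = 1]) (auto intro!: spec_ops simp: x)
  qed simp
qed

lemma spec_eval_objective: "spec (eval_objective a) (\<lambda>v. v = objective n c a) (2 * n)"
proof -
  have "(\<Sum>i\<leftarrow>stations. c i (fst a i) (snd a i)) = objective n c a"
    using sum_list_distinct_conv_sum_set[of stations "\<lambda>i. c i (fst a i) (snd a i)"]
    unfolding set_stations objective_def by (simp add: stations_def)
  then show ?thesis using spec_sum_costs[of a stations] by (simp add: eval_objective_def length_stations)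
qed

lemma spec_eval_move:
  "spec (eval_move \<alpha> a m) (\<lambda>v. v = objective n c (apply_move \<alpha> m a)) (2 * n + 8)"
  unfolding eval_move_def by (rule spec_bind_ops, rule spec_eval_objective) simp

lemma spec_bike_gain:
  "spec (bike_gain \<beta> a i) (\<lambda>v. v = c i (fst a i) (snd a i) - c i (fst a i - \<beta>) (snd a i + \<beta>)) 5"
  unfolding bike_gain_def
proof (rule spec_bind[OF spec_query, where t = 4])
  fix x assume x: "x = c i (fst a i) (snd a i)"
  have "spec (nd_bind (query i (fst a i - \<beta>) (snd a i + \<beta>)) (\<lambda>y. ops 1 (x - y)))
      (\<lambda>v. v = c i (fst a i) (snd a i) - c i (fst a i - \<beta>) (snd a i + \<beta>)) 2"
    by (rule spec_bind[OF spec_query, where t = 1]) (auto intro: spec_ops simp: x)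
  then show "spec (nd_bind (ops 1 (fst a i - \<beta>)) (\<lambda>d'. nd_bind (ops 1 (snd a i + \<beta>))
      (\<lambda>b'. nd_bind (query i d' b') (\<lambda>y. ops 1 (x - y)))))
      (\<lambda>v. v = c i (fst a i) (snd a i) - c i (fst a i - \<beta>) (snd a i + \<beta>)) 4"
    by (intro spec_bind_ops[where t = 3] spec_bind_ops[where t = 2]) auto
qed simp

definition move_time :: nat where
  "move_time = (2 * n + 2) * (2 * n + 10) + 8"

lemma spec_best_dock_move:
  assumes cur: "current s = embed (scale s) X"
  shows "spec (best_dock_move i j s)
    (\<lambda>s'. \<exists>m\<in>moves n i j. s' = s\<lparr>current := embed (scale s) (apply_move 1 m X)\<rparr> \<and>
      (\<forall>m'\<in>moves n i j. objective n (f (scale s)) (apply_move 1 m X) \<le> objective n (f (scale s)) (apply_move 1 m' X)))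
    move_time"
  unfolding best_dock_move_def
proof (rule spec_bind[OF spec_scan_min[OF spec_eval_move], where t = 8])
  fix r assume r: "case r of None \<Rightarrow> moves_between i j = []
    | Some (m, v) \<Rightarrow> m \<in> set (moves_between i j) \<and> v = objective n c (apply_move (scale s) m (current s)) \<and>
       (\<forall>m'\<in>set (moves_between i j).
          objective n c (apply_move (scale s) m (current s)) \<le> objective n c (apply_move (scale s) m' (current s)))"
  show "spec (case r of None \<Rightarrow> stuck | Some (m, _) \<Rightarrow> ops 8 (s\<lparr>current := apply_move (scale s) m (current s)\<rparr>))
    (\<lambda>s'. \<exists>m\<in>moves n i j. s' = s\<lparr>current := embed (scale s) (apply_move 1 m X)\<rparr> \<and>
      (\<forall>m'\<in>moves n i j. objective n (f (scale s)) (apply_move 1 m X) \<le> objective n (f (scale s)) (apply_move 1 m' X))) 8"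
  proof (cases r)
    case None
    then show ?thesis using r by (simp add: moves_between_def)
  next
    case (Some mv)
    then show ?thesis using r
      by (cases mv) (auto intro!: spec_ops simp: cur apply_move_embed objective_embed set_moves_between)
  qed
qed (simp add: move_time_def length_moves_between)

subsection \<open>Invariants of the phases\<close>

text \<open>
  The allocation at the end of a phase with step length \<open>a\<close>. Unless it is optimal
  without penalty, no further dock can be moved within the bound.
\<close>

definition phase_opt :: "int \<Rightarrow> alloc \<Rightarrow> bool" where
  "phase_opt a A \<longleftrightarrow> (\<exists>X r. A = embed a X \<and> 0 \<le> r \<and> multimodular_stations.optimal n (f a) r X \<and>
     norm1 {1..n} (capacity X) \<le> 2 * (int z div a) \<and> (r = 0 \<or> 2 * (int z div a) \<le> norm1 {1..n} (capacity X)))"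

definition bike_inv :: "int \<Rightarrow> alloc \<Rightarrow> nat \<Rightarrow> bool" where
  "bike_inv a A q \<longleftrightarrow> (\<exists>X. A = embed a X \<and> multimodular_stations.bike_distance n (f a) X q \<and>
     multimodular_stations.near_path n (f a) (int z div a) (capacity X))"

definition dock_inv ::
  "(nat \<Rightarrow> int \<Rightarrow> (nat \<Rightarrow> int) \<Rightarrow> (nat \<Rightarrow> int) \<Rightarrow> nat \<Rightarrow> bool) \<Rightarrow> int \<Rightarrow> alloc \<Rightarrow> alloc \<Rightarrow> nat \<Rightarrow> bool" where
  "dock_inv roll a S' A q \<longleftrightarrow> (\<exists>S X. S' = embed a S \<and> A = embed a X \<and> balanced n S \<and>
     multimodular_stations.near_path n (f a) (int z div a) (capacity S) \<and>
     multimodular_stations.bike_optimal n (f a) X \<and> roll n (int M) (capacity S) (capacity X) q)"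

definition descent_inv :: "int \<Rightarrow> alloc \<Rightarrow> nat \<Rightarrow> bool" where
  "descent_inv a A R \<longleftrightarrow> (\<exists>X. A = embed a X \<and> multimodular_stations.bike_optimal n (f a) X \<and>
     multimodular_stations.descending n (f a) (int z div a) (capacity X) R)"

definition R0 :: nat where
  "R0 = (n ^ 2 + 1) * M"

definition phase_steps :: nat where
  "phase_steps = 5 + R0 + 2 * (n * M) + n"

definition in_phase :: "state \<Rightarrow> bool" where
  "in_phase s \<longleftrightarrow> phase s \<le> L \<and> scale s = 2 ^ (L - phase s) \<and> bound s = int M * scale s"

definition later_steps :: "state \<Rightarrow> nat" where
  "later_steps s = (L - phase s) * phase_steps + 1"

text \<open>
  The number \<open>r\<close> bounds the remaining steps: those of the later phases, the budgets of the later parts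
  of the present phase, and the steps \<open>q\<close> left in the present part. The allocation at the start of a
  phase comes from a phase with twice the step length; the first phase is treated as if it had such
  a predecessor.
\<close>

definition inv :: "state \<Rightarrow> nat \<Rightarrow> bool" where
  "inv s r \<longleftrightarrow> (case loc s of
     Phase_Start \<Rightarrow> phase s \<le> L + 1 \<and> phase_opt (2 ^ (L + 1 - phase s)) (current s) \<and>
       (L + 1 - phase s) * phase_steps + 1 \<le> r
   | Bike_Step \<Rightarrow> in_phase s \<and> (\<exists>q. bike_inv (scale s) (current s) q \<and>
       later_steps s + 4 + R0 + 2 * (n * M) + q \<le> r)
   | Dock_Loop_1 \<Rightarrow> in_phase s \<and> (\<exists>q. dock_inv first_rollback (scale s) (snapshot s) (current s) q \<and>
       later_steps s + 3 + R0 + n * M + q \<le> r)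
   | Dock_Loop_2 \<Rightarrow> in_phase s \<and> (\<exists>q. dock_inv second_rollback (scale s) (snapshot s) (current s) q \<and>
       later_steps s + 2 + R0 + q \<le> r)
   | Descent \<Rightarrow> in_phase s \<and> (\<exists>q. descent_inv (scale s) (current s) q \<and> later_steps s + 1 + q \<le> r)
   | Halted \<Rightarrow> True)"

text \<open>
  Changes by multiples of \<open>2 * a\<close> are the even ones in units of \<open>a\<close>, so proximity applies to the docks and,
  for fixed docks, to the bikes.
\<close>

lemma inv_start:
  assumes "1 \<le> a" "phase_opt (2 * a) A"
  shows "bike_inv a A n"
proof -
  interpret fine: multimodular_stations n "f a" by (rule rescaled_stations[OF assms(1)])
  interpret coarse: multimodular_stations n "f (2 * a)" by (rule rescaled_stations) (use assms in simp)
  obtain X r where A: "A = embed (2 * a) X" and r: "0 \<le> r" and opt: "coarse.optimal r X"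
    and N: "norm1 {1..n} (capacity X) \<le> 2 * (int z div (2 * a))"
      "r = 0 \<or> 2 * (int z div (2 * a)) \<le> norm1 {1..n} (capacity X)"
    using assms(2) unfolding phase_opt_def by blast
  let ?X = "scale_alloc 2 X"
  have emb: "embed (2 * a) Y = embed a (scale_alloc 2 Y)" for Y
    by (simp add: embed_def scale_alloc_def mult.assoc mult.left_commute)
  have obj: "objective n (f a) (scale_alloc 2 Y) = objective n (f (2 * a)) Y" for Y
    unfolding objective_embed[symmetric] emb ..
  have norm: "norm1 {1..n} (capacity (scale_alloc 2 Y)) = 2 * norm1 {1..n} (capacity Y)" for Y
    unfolding capacity_scale norm1_def by (simp add: abs_mult sum_distrib_left)
  have pen: "fine.penalized_cost (r / 2) (scale_alloc 2 Y) = coarse.penalized_cost r Y" for Y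
    unfolding fine.penalized_cost_def coarse.penalized_cost_def obj norm by simp
  have add: "plus_alloc ?X (scale_alloc 2 U) = scale_alloc 2 (plus_alloc X U)" for U
    by (simp add: plus_alloc_def scale_alloc_def distrib_left)
  have bal: "balanced n X" and fin: "objective n (f (2 * a)) X < \<infinity>" using opt by (auto simp: coarse.optimal_def)
  have bo: "coarse.bike_optimal X" using opt coarse.optimal_iff by blast
  have balX: "balanced n ?X" by (rule balanced_scale[OF bal])
  have finX: "objective n (f a) ?X < \<infinity>" using fin obj by simp
  have "fine.near_path (int z div a) (capacity ?X)"
  proof (rule fine.near_path_from_coarse[OF n_pos _ balX finX])
    show "0 \<le> r / 2" using r by simp
    show "fine.penalized_cost (r / 2) ?X \<le> fine.penalized_cost (r / 2) (plus_alloc ?X (scale_alloc 2 U))"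
      if "balanced n U" for U
      using opt balanced_plus[OF bal that] unfolding add pen coarse.optimal_def by blast
    have half: "int z div (2 * a) = (int z div a) div 2"
      using zdiv_zmult2_eq[of 2 "int z" a] by (simp add: mult.commute)
    show "0 \<le> int z div a" using assms(1) by (simp add: pos_imp_zdiv_nonneg_iff)
    show "norm1 {1..n} (capacity ?X) \<le> 2 * (int z div a)" using N(1) unfolding norm half by linarith
    show "r / 2 = 0 \<or> 2 * (int z div a) \<le> norm1 {1..n} (capacity ?X) + 2" using N(2) unfolding norm half by auto
  qed
  moreover have "fine.bike_distance ?X n"
  proof -
    have "objective n (f a) ?X \<le> objective n (f a) (plus_alloc ?X (scale_alloc 2 U))"
      if "balanced n U" "capacity U = (\<lambda>_. 0)" for U
      unfolding add obj
      by (rule coarse.bike_optimal_le[OF bo balanced_plus[OF bal that(1)]]) (simp add: capacity_plus that(2))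
    from fine.bike_proximity[OF balX finX this] show ?thesis
      using balX finX by (auto simp: fine.bike_distance_def)
  qed
  ultimately show ?thesis unfolding bike_inv_def A emb by blast
qed

lemma scale_bound: "int (D + B) < 2 ^ L"
proof -
  let ?x = "real (B + D)" and ?k = "nat \<lfloor>log 2 (real (B + D))\<rfloor>"
  have pos: "0 < ?x" using total by simp
  have "0 \<le> log 2 ?x" using total by simp
  then have "log 2 ?x < real (?k + 1)" by linarith
  then have "?x < 2 powr real (?k + 1)"
    by (subst log_less_iff[symmetric]) (use pos in assumption | simp only: one_less_numeral_iff semiring_norm)+
  also have "\<dots> = 2 ^ (?k + 1)" by (rule powr_realpow) simp
  finally have "real (B + D) < real (2 ^ L)" by (simp add: last_phase_def)
  then have "B + D < 2 ^ L" by (simp only: of_nat_less_iff)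
  then have "int (B + D) < int (2 ^ L)" by (simp only: of_nat_less_iff)
  then show ?thesis by (simp add: add.commute)
qed

text \<open>The step length exceeds the number of docks, so the initial allocation is the only one in reach.\<close>

lemma phase_opt_initial: "phase_opt (2 ^ (L + 1)) (dbar, bbar)"
proof -
  let ?a = "2 ^ (L + 1) :: int"
  interpret multimodular_stations n "f ?a" by (rule rescaled_stations) simp
  have bal: "balanced n zero_alloc" by (simp add: balanced_def zero_alloc_def)
  have fin: "F zero_alloc < \<infinity>" unfolding F_finite_iff zero_alloc_def fst_conv snd_conv using f_origin by blast
  have bound: "0 \<le> x k \<and> 0 \<le> y k \<and> x k \<le> int (D + B) \<and> y k \<le> int (D + B)"
    if nn: "\<And>k. k \<in> {1..n} \<Longrightarrow> 0 \<le> x k \<and> 0 \<le> y k" and sum: "(\<Sum>k\<in>{1..n}. x k + y k) = int (D + B)" and k: "k \<in> {1..n}" for x y k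
  proof -
    have "x k + y k \<le> (\<Sum>k\<in>{1..n}. x k + y k)" by (rule member_le_sum) (use nn k in \<open>auto intro: add_nonneg_nonneg\<close>)
    then show ?thesis using nn[OF k] sum by linarith
  qed
  have dom: "0 \<le> dbar k + ?a * fst Y k \<and> 0 \<le> bbar k + ?a * snd Y k" if "F Y < \<infinity>" "k \<in> {1..n}" for Y k
    using that cost_domain unfolding F_finite_iff rescaled_def by blast
  have sum0: "(\<Sum>k\<in>{1..n}. dbar k + bbar k) = int (D + B)"
    using start_alloc by (simp add: is_allocation_def)
  have le: "F zero_alloc \<le> F Y" if Y: "balanced n Y" for Y
  proof (cases "F Y < \<infinity>")
    case True
    have "(\<Sum>k\<in>{1..n}. (dbar k + ?a * fst Y k) + (bbar k + ?a * snd Y k)) =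
        (\<Sum>k\<in>{1..n}. dbar k + bbar k) + ?a * ((\<Sum>k\<in>{1..n}. fst Y k) + (\<Sum>k\<in>{1..n}. snd Y k))"
      by (simp add: sum.distrib sum_distrib_left distrib_left)
    then have sumY: "(\<Sum>k\<in>{1..n}. (dbar k + ?a * fst Y k) + (bbar k + ?a * snd Y k)) = int (D + B)"
      using Y sum0 by (simp add: balanced_def)
    have small: "t = 0" if "\<bar>?a * t\<bar> \<le> int (D + B)" for t
    proof (rule ccontr)
      assume "t \<noteq> 0"
      then have "?a * 1 \<le> ?a * \<bar>t\<bar>" by (intro mult_left_mono) auto
      moreover have "?a * \<bar>t\<bar> = \<bar>?a * t\<bar>" by (simp add: abs_mult)
      moreover have "int (D + B) < ?a" using scale_bound by (simp add: power_add)
      ultimately show False using that by linarith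
    qed
    have "fst Y k = 0 \<and> snd Y k = 0" if k: "k \<in> {1..n}" for k
    proof -
      have b1: "0 \<le> dbar k \<and> 0 \<le> bbar k \<and> dbar k \<le> int (D + B) \<and> bbar k \<le> int (D + B)"
        by (rule bound[OF _ sum0 k]) (use dom[OF fin] in \<open>simp add: zero_alloc_def\<close>)
      have b2: "0 \<le> dbar k + ?a * fst Y k \<and> 0 \<le> bbar k + ?a * snd Y k \<and>
          dbar k + ?a * fst Y k \<le> int (D + B) \<and> bbar k + ?a * snd Y k \<le> int (D + B)"
        by (rule bound[OF dom[OF True] sumY k])
      show ?thesis using b1 b2 by (intro conjI small) linarith+
    qed
    then have "F Y = F zero_alloc" by (intro F_cong) (auto simp: zero_alloc_def)
    then show ?thesis by simp
  qed auto
  have "optimal 0 zero_alloc" using bal fin le by (simp add: optimal_def penalized_cost_def)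
  moreover have "(dbar, bbar) = embed ?a zero_alloc" by (simp add: embed_def zero_alloc_def)
  moreover have "norm1 {1..n} (capacity zero_alloc) = 0" by (simp add: norm1_def capacity_def zero_alloc_def)
  ultimately show ?thesis unfolding phase_opt_def
    by (intro exI[of _ zero_alloc] exI[of _ 0]) (simp add: pos_imp_zdiv_nonneg_iff)
qed

definition step_time :: nat where
  "step_time = (3 * (L + 1) + 10) + (16 * n + 17) + (24 * n + 1 + move_time) +
     (n * (n * (2 * n + 2)) * (2 * n + 10) + 7 * n + 13)"

lemma in_phase_scale: "in_phase s \<Longrightarrow> 1 \<le> scale s"
  by (simp add: in_phase_def)

lemma start_phase_spec:
  assumes inv: "inv s r" and loc: "loc s = Phase_Start"
  shows "spec (start_phase s) (\<lambda>s'. \<exists>r'<r. inv s' r') step_time"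
proof -
  have ph: "phase s \<le> L + 1" and opt: "phase_opt (2 ^ (L + 1 - phase s)) (current s)"
    and r: "(L + 1 - phase s) * phase_steps + 1 \<le> r"
    using inv loc by (auto simp: inv_def)
  show ?thesis
  proof (cases "phase s \<le> L")
    case False
    have "spec (ops 0 (s\<lparr>loc := Halted\<rparr>)) (\<lambda>s'. \<exists>r'<r. inv s' r') 0"
      by (rule spec_ops) (use r in \<open>auto simp: inv_def intro!: exI[of _ 0]\<close>)
    then show ?thesis using False unfolding start_phase_def
      by (intro spec_bind_ops[where t = 0]) (simp_all add: step_time_def)
  next
    case True
    let ?a = "2 ^ (L - phase s) :: int"
    let ?s = "s\<lparr>loc := Bike_Step, scale := ?a, bound := 16 * int n ^ 6 * (int n + 4) * ?a\<rparr>"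
    have Suc: "L + 1 - phase s = Suc (L - phase s)" using True by simp
    then have "2 ^ (L + 1 - phase s) = 2 * ?a" by simp
    then have "bike_inv ?a (current s) n" using inv_start[of ?a "current s"] opt by simp
    moreover have "(L + 1 - phase s) * phase_steps = (L - phase s) * phase_steps + phase_steps"
      unfolding Suc by simp
    ultimately have "inv ?s (later_steps ?s + 4 + R0 + 2 * (n * M) + n)"
      "later_steps ?s + 4 + R0 + 2 * (n * M) + n < r"
      using True r by (auto simp: inv_def in_phase_def rollback_def later_steps_def phase_steps_def)
    then have "spec (ops 0 ?s) (\<lambda>s'. \<exists>r'<r. inv s' r') 0" by (intro spec_ops) auto
    then have "spec (do {
         \<alpha> \<leftarrow> ops (3 * (L + 1)) (2 ^ (L - phase s));
         M \<leftarrow> ops 9 (16 * int n ^ 6 * (int n + 4) * \<alpha>);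
         ret (s\<lparr>loc := Bike_Step, scale := \<alpha>, bound := M\<rparr>)
       }) (\<lambda>s'. \<exists>r'<r. inv s' r') (3 * (L + 1) + 9)"
      by (intro spec_bind_ops[where t = 9] spec_bind_ops[where t = 0]) auto
    then show ?thesis using True unfolding start_phase_def
      by (intro spec_bind_ops[where t = "3 * (L + 1) + 9"]) (simp_all add: step_time_def)
  qed
qed

lemma bike_step_spec:
  assumes inv: "inv s r" and loc: "loc s = Bike_Step"
  shows "spec (bike_step s) (\<lambda>s'. \<exists>r'<r. inv s' r') step_time"
proof -
  let ?a = "scale s"
  obtain q where ph: "in_phase s" and bi: "bike_inv ?a (current s) q"
    and r: "later_steps s + 4 + R0 + 2 * (n * M) + q \<le> r"
    using inv loc by (auto simp: inv_def)
  have a: "1 \<le> ?a" by (rule in_phase_scale[OF ph])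
  interpret multimodular_stations n "f ?a" by (rule rescaled_stations[OF a])
  obtain X where X: "current s = embed ?a X" "bike_distance X q" "near_path (int z div ?a) (capacity X)"
    using bi unfolding bike_inv_def by blast
  have cost: "c k (fst (current s) k) (snd (current s) k) = f ?a k (fst X k) (snd X k)"
    "c k (fst (current s) k - ?a) (snd (current s) k + ?a) = f ?a k (fst X k - 1) (snd X k + 1)"
    "c k (fst (current s) k - - ?a) (snd (current s) k + - ?a) = f ?a k (fst X k + 1) (snd X k - 1)" for k
    unfolding X(1) by (simp_all add: embed_def rescaled_def algebra_simps)
  let ?up = "\<lambda>k. c k (fst (current s) k) (snd (current s) k) - c k (fst (current s) k - ?a) (snd (current s) k + ?a)"
  let ?dn = "\<lambda>k. c k (fst (current s) k) (snd (current s) k) - c k (fst (current s) k - - ?a) (snd (current s) k + - ?a)"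
  let ?Q = "\<lambda>s'. \<exists>r'<r. inv s' r'"
  have end_step: "spec (end_bike_step s) ?Q (2 * n)" if bo: "bike_optimal X"
    unfolding end_bike_step_def
  proof (rule spec_ops)
    let ?s = "s\<lparr>loc := Dock_Loop_1, snapshot := current s\<rparr>"
    have "dock_inv first_rollback ?a (current s) (current s) (n * M)"
    proof -
      have "first_rollback n (int M) (capacity X) (capacity X) (n * M)"
        using first_rollback_init[OF _ n_pos, of "int M" "capacity X"] by simp
      moreover have "balanced n X" using bo by (simp add: bike_optimal_def)
      ultimately show ?thesis unfolding dock_inv_def using X(1,3) bo by blast
    qed
    then have "inv ?s (later_steps s + 3 + R0 + n * M + n * M)"
      using ph by (auto simp: inv_def in_phase_def later_steps_def)
    then show "?Q ?s" using r by (intro exI[of _ "later_steps s + 3 + R0 + n * M + n * M"]) auto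
  qed simp
  let ?move = "\<lambda>i j. do {
         a' \<leftarrow> ops 8 (bike_move ?a i j (current s));
         old \<leftarrow> sum_costs (current s) [i, j];
         new \<leftarrow> sum_costs a' [i, j];
         decreases \<leftarrow> ops 1 (new < old);
         if decreases then ret (s\<lparr>current := a'\<rparr>) else end_bike_step s
       }"
  have main: "spec (?move i j) ?Q (2 * n + 17)"
    if ij: "i \<in> {1..n}" "j \<in> {1..n}" and mi: "\<forall>k\<in>{1..n}. ?up k \<le> ?up i" and mj: "\<forall>k\<in>{1..n}. ?dn k \<le> ?dn j" for i j
  proof (rule spec_bind_ops[where t = "2 * n + 9"], rule spec_bind[OF spec_sum_costs, where t = "2 * n + 5"],
      rule spec_bind[OF spec_sum_costs, where t = "2 * n + 1"], rule spec_bind_ops[where t = "2 * n"])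
    let ?X' = "bike_move 1 i j X"
    fix old new assume old: "old = (\<Sum>i\<leftarrow>[i, j]. c i (fst (current s) i) (snd (current s) i))"
      and new: "new = (\<Sum>k\<leftarrow>[i, j]. c k (fst (bike_move ?a i j (current s)) k) (snd (bike_move ?a i j (current s)) k))"
    have A': "bike_move ?a i j (current s) = embed ?a ?X'" unfolding X(1) by (rule bike_move_embed)
    have old': "old = f ?a i (fst X i) (snd X i) + f ?a j (fst X j) (snd X j)"
      unfolding old X(1) by (simp add: embed_def rescaled_def)
    have new': "new = f ?a i (fst ?X' i) (snd ?X' i) + f ?a j (fst ?X' j) (snd ?X' j)"
      unfolding new A' by (simp add: embed_def rescaled_def)
    note step = bike_step[OF X(2) ij mi[unfolded cost, rule_format] mj[unfolded cost, rule_format]]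
    show "spec (if new < old then ops 0 (s\<lparr>current := bike_move ?a i j (current s)\<rparr>) else end_bike_step s) ?Q (2 * n)"
    proof (cases "new < old")
      case True
      then have *: "0 < q" "bike_distance ?X' (q - 1)" "capacity ?X' = capacity X"
        using step(1) unfolding old' new' by blast+
      let ?s = "s\<lparr>current := embed ?a ?X'\<rparr>"
      have "bike_inv ?a (embed ?a ?X') (q - 1)" 
        unfolding bike_inv_def using * X(3) by (intro exI[of _ ?X']) simp
      then have "inv ?s (later_steps s + 4 + R0 + 2 * (n * M) + (q - 1))"
        using ph loc by (auto simp: inv_def in_phase_def later_steps_def)
      then have "?Q ?s" using r *(1) by (intro exI[of _ "later_steps s + 4 + R0 + 2 * (n * M) + (q - 1)"]) auto
      then show ?thesis using True A' by (auto intro: spec_ops)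
    next
      case False
      then have "bike_optimal X" using step(2) unfolding old' new' by blast
      then show ?thesis using False end_step by simp
    qed
  qed auto
  show ?thesis unfolding bike_step_def Let_def
  proof (rule spec_bind[OF spec_scan_max[OF spec_bike_gain], where t = "9 * n + 17"])
    fix ri assume ri: "case ri of None \<Rightarrow> stations = []
      | Some (x, v) \<Rightarrow> x \<in> set stations \<and> v = ?up x \<and> (\<forall>y\<in>set stations. ?up y \<le> ?up x)"
    show "spec (nd_bind (scan_max (bike_gain (- ?a) (current s)) stations) (\<lambda>rj. case (ri, rj) of
       (Some (i, _), Some (j, _)) \<Rightarrow> ?move i j
     | _ \<Rightarrow> end_bike_step s)) ?Q (9 * n + 17)"
    proof (rule spec_bind[OF spec_scan_max[OF spec_bike_gain], where t = "2 * n + 17"])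
      fix rj assume rj: "case rj of None \<Rightarrow> stations = []
        | Some (x, v) \<Rightarrow> x \<in> set stations \<and> v = ?dn x \<and> (\<forall>y\<in>set stations. ?dn y \<le> ?dn x)"
      have "stations \<noteq> []" using n_pos length_stations by auto
      then obtain i v j w where "ri = Some (i, v)" "rj = Some (j, w)"
        using ri rj by (cases ri; cases rj) auto
      then show "spec (case (ri, rj) of
       (Some (i, _), Some (j, _)) \<Rightarrow> ?move i j
     | _ \<Rightarrow> end_bike_step s) ?Q (2 * n + 17)"
        using main[of i j] ri rj by (simp add: set_stations)
    qed (simp add: length_stations)
  qed (simp add: length_stations step_time_def)
qed

lemma surplus_spec:
  assumes "1 \<le> scale s" "snapshot s = embed (scale s) S" "current s = embed (scale s) X"
  shows "spec (surplus_station s (r * scale s) i)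
    (\<lambda>b. b = (0 \<le> capacity S i \<and> max (capacity S i - r) 0 < capacity X i)) 8"
  unfolding surplus_station_def assms(2,3) surplus_iff[OF assms(1)] by (rule spec_ops) auto

lemma deficit_spec:
  assumes "1 \<le> scale s" "snapshot s = embed (scale s) S" "current s = embed (scale s) X"
  shows "spec (deficit_station s (r * scale s) j)
    (\<lambda>b. b = (capacity S j < 0 \<and> capacity X j < min (capacity S j + r) 0)) 8"
  unfolding deficit_station_def assms(2,3) deficit_iff[OF assms(1)] by (rule spec_ops) auto

lemma rollback_move_spec:
  assumes ph: "in_phase s" and S: "snapshot s = embed (scale s) S" and X: "current s = embed (scale s) X"
    and balS: "balanced n S" and near: "multimodular_stations.near_path n (f (scale s)) (int z div scale s) (capacity S)"
    and bo: "multimodular_stations.bike_optimal n (f (scale s)) X"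
    and i: "i \<in> {1..n}" "0 < capacity X i" and j: "j \<in> {1..n}" "capacity X j < 0"
    and step: "0 < q \<and> roll n (int M) (capacity S) (transfer i j (capacity X)) (q - 1)"
  shows "spec (best_dock_move i j s)
    (\<lambda>s'. loc s' = loc s \<and> in_phase s' \<and> later_steps s' = later_steps s \<and>
      dock_inv roll (scale s') (snapshot s') (current s') (q - 1)) move_time"
proof (rule spec_weaken[OF spec_best_dock_move[OF X]])
  let ?a = "scale s"
  interpret multimodular_stations n "f ?a" by (rule rescaled_stations[OF in_phase_scale[OF ph]])
  fix s' assume "\<exists>m\<in>moves n i j. s' = s\<lparr>current := embed ?a (apply_move 1 m X)\<rparr> \<and>
    (\<forall>m'\<in>moves n i j. F (apply_move 1 m X) \<le> F (apply_move 1 m' X))"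
  then obtain m where m: "m \<in> moves n i j" and s': "s' = s\<lparr>current := embed ?a (apply_move 1 m X)\<rparr>"
    and best: "\<And>m'. m' \<in> moves n i j \<Longrightarrow> F (apply_move 1 m X) \<le> F (apply_move 1 m' X)" by blast
  have *: "bike_optimal (apply_move 1 m X)" "capacity (apply_move 1 m X) = transfer i j (capacity X)"
    using best_move_towards_origin[OF bo i j m best] by auto
  then have "dock_inv roll ?a (snapshot s) (embed ?a (apply_move 1 m X)) (q - 1)"
    unfolding dock_inv_def using S balS near step * by (metis (no_types, lifting))
  then show "loc s' = loc s \<and> in_phase s' \<and> later_steps s' = later_steps s \<and>
      dock_inv roll (scale s') (snapshot s') (current s') (q - 1)"
    using ph unfolding s' by (simp add: in_phase_def later_steps_def)
qed simp

lemma dock_loop_1_spec: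
  assumes inv: "inv s r" and loc: "loc s = Dock_Loop_1"
  shows "spec (dock_loop_1 s) (\<lambda>s'. \<exists>r'<r. inv s' r') step_time"
proof -
  let ?a = "scale s"
  let ?Q = "\<lambda>s'. \<exists>r'<r. inv s' r'"
  obtain q where ph: "in_phase s" and di: "dock_inv first_rollback ?a (snapshot s) (current s) q"
    and r: "later_steps s + 3 + R0 + n * M + q \<le> r"
    using inv loc by (auto simp: inv_def)
  have a: "1 \<le> ?a" by (rule in_phase_scale[OF ph])
  interpret multimodular_stations n "f ?a" by (rule rescaled_stations[OF a])
  obtain S X where S: "snapshot s = embed ?a S" and X: "current s = embed ?a X" and balS: "balanced n S"
    and near: "near_path (int z div ?a) (capacity S)" and bo: "bike_optimal X"
    and roll: "first_rollback n (int M) (capacity S) (capacity X) q"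
    using di unfolding dock_inv_def by blast
  have M0: "0 \<le> int M" by simp
  have sumS: "(\<Sum>k\<in>{1..n}. capacity S k) = 0" by (rule sum_capacity[OF balS])
  have sumX: "(\<Sum>k\<in>{1..n}. capacity X k) = 0" using bo sum_capacity by (auto simp: bike_optimal_def)
  have bound: "bound s = int M * ?a" using ph by (simp add: in_phase_def)
  have radius: "int n * (int M * ?a) = (int n * int M) * ?a" by simp
  have move: "spec (best_dock_move i j s) ?Q move_time"
    if i: "i \<in> {1..n}" "0 \<le> capacity S i" "max (capacity S i - int M) 0 < capacity X i"
      and j: "j \<in> {1..n}" "capacity S j < 0" "capacity X j < min (capacity S j + int n * int M) 0"
        "capacity X j < min (capacity S j + int M) 0 \<or>
          (\<forall>k\<in>{1..n}. capacity S k < 0 \<longrightarrow> min (capacity S k + int M) 0 \<le> capacity X k)" for i j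
  proof -
    have step: "0 < q \<and> first_rollback n (int M) (capacity S) (transfer i j (capacity X)) (q - 1)"
      by (rule first_rollback_step[OF roll M0 i j])
    have "0 < capacity X i" "capacity X j < 0" using i j by auto
    note move = rollback_move_spec[where roll = first_rollback and q = q, OF ph S X balS near bo i(1) this(1) j(1) this(2) step]
    show ?thesis
    proof (rule spec_weaken[OF move])
      fix s' assume "loc s' = loc s \<and> in_phase s' \<and> later_steps s' = later_steps s \<and>
        dock_inv first_rollback (scale s') (snapshot s') (current s') (q - 1)"
      then have "inv s' (later_steps s + 3 + R0 + n * M + (q - 1))" using loc by (auto simp: inv_def)
      then show "?Q s'" using r step by (intro exI[of _ "later_steps s + 3 + R0 + n * M + (q - 1)"]) auto
    qed simp
  qed
  show ?thesis unfolding dock_loop_1_def bound radius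
  proof (rule spec_bind[OF spec_pick[OF surplus_spec[OF a S X]], where t = "16 * n + 1 + move_time"])
    fix ri assume ri: "case ri of
        None \<Rightarrow> \<forall>i\<in>set stations. \<not> (0 \<le> capacity S i \<and> max (capacity S i - int M) 0 < capacity X i)
      | Some i \<Rightarrow> i \<in> set stations \<and> 0 \<le> capacity S i \<and> max (capacity S i - int M) 0 < capacity X i"
    show "spec (case ri of
       None \<Rightarrow> ret (s\<lparr>loc := Dock_Loop_2\<rparr>)
     | Some i \<Rightarrow> do {
         rj \<leftarrow> pick (deficit_station s (int M * ?a)) stations;
         case rj of
           Some j \<Rightarrow> best_dock_move i j s
         | None \<Rightarrow> do {
             radius \<leftarrow> ops 1 (int n * int M * ?a);
             rj' \<leftarrow> pick (deficit_station s radius) stations;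
             case rj' of
               Some j \<Rightarrow> best_dock_move i j s
             | None \<Rightarrow> stuck
           }
       }) ?Q (16 * n + 1 + move_time)"
    proof (cases ri)
      case None
      then have "\<forall>i\<in>{1..n}. \<not> (0 \<le> capacity S i \<and> max (capacity S i - int M) 0 < capacity X i)"
        using ri by (simp only: option.case set_stations)
      then have no: "\<And>i. i \<in> {1..n} \<Longrightarrow> 0 \<le> capacity S i \<Longrightarrow> capacity X i \<le> max (capacity S i - int M) 0"
        by (meson not_le)
      have "second_rollback n (int M) (capacity S) (capacity X) (n * M)"
        using first_rollback_end[OF roll M0 n_pos no] by simp
      then have "dock_inv second_rollback ?a (snapshot s) (current s) (n * M)"
        unfolding dock_inv_def using S X balS near bo by blast
      then have "inv (s\<lparr>loc := Dock_Loop_2\<rparr>) (later_steps s + 2 + R0 + n * M)"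
        using ph by (auto simp: inv_def in_phase_def later_steps_def)
      then have "?Q (s\<lparr>loc := Dock_Loop_2\<rparr>)" using r by (intro exI[of _ "later_steps s + 2 + R0 + n * M"]) auto
      then show ?thesis using None by (auto intro: spec_ops)
    next
      case (Some i)
      then have i: "i \<in> {1..n}" "0 \<le> capacity S i" "max (capacity S i - int M) 0 < capacity X i"
        using ri by (auto simp: set_stations)
      show ?thesis unfolding Some option.case
      proof (rule spec_bind[OF spec_pick[OF deficit_spec[OF a S X]], where t = "8 * n + 1 + move_time"])
        fix rj assume rj: "case rj of
            None \<Rightarrow> \<forall>j\<in>set stations. \<not> (capacity S j < 0 \<and> capacity X j < min (capacity S j + int M) 0)
          | Some j \<Rightarrow> j \<in> set stations \<and> capacity S j < 0 \<and> capacity X j < min (capacity S j + int M) 0"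
        show "spec (case rj of
           None \<Rightarrow> do {
             radius \<leftarrow> ops 1 (int n * int M * ?a);
             rj' \<leftarrow> pick (deficit_station s radius) stations;
             case rj' of
               None \<Rightarrow> stuck
             | Some j \<Rightarrow> best_dock_move i j s
           }
         | Some j \<Rightarrow> best_dock_move i j s) ?Q (8 * n + 1 + move_time)"
        proof (cases rj)
          case (Some j)
          then have j: "j \<in> {1..n}" "capacity S j < 0" "capacity X j < min (capacity S j + int M) 0"
            using rj by (auto simp: set_stations)
          have "int M \<le> int n * int M" using n_pos mult_right_mono[of 1 "int n" "int M"] by simp
          then have "capacity X j < min (capacity S j + int n * int M) 0" using j by linarith
          from move[OF i j(1,2) this disjI1[OF j(3)]] show ?thesis
            using Some by (auto intro: spec_weaken)
        next
          case None
          then have "\<forall>j\<in>{1..n}. \<not> (capacity S j < 0 \<and> capacity X j < min (capacity S j + int M) 0)"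
            using rj by (simp only: option.case set_stations)
          then have no: "\<forall>k\<in>{1..n}. capacity S k < 0 \<longrightarrow> min (capacity S k + int M) 0 \<le> capacity X k"
            by (meson not_le)
          obtain j0 where j0: "j0 \<in> {1..n}" "capacity S j0 < 0" "capacity X j0 < min (capacity S j0 + int n * int M) 0"
            using first_rollback_not_stuck[OF roll M0 sumS sumX i] by blast
          show ?thesis unfolding None option.case
          proof (rule spec_bind_ops[where t = "8 * n + move_time"],
              rule spec_bind[OF spec_pick[OF deficit_spec[OF a S X]], where t = move_time])
            fix rj' assume rj': "case rj' of
                None \<Rightarrow> \<forall>j\<in>set stations. \<not> (capacity S j < 0 \<and> capacity X j < min (capacity S j + int n * int M) 0)
              | Some j \<Rightarrow> j \<in> set stations \<and> capacity S j < 0 \<and> capacity X j < min (capacity S j + int n * int M) 0"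
            show "spec (case rj' of None \<Rightarrow> stuck | Some j \<Rightarrow> best_dock_move i j s) ?Q move_time"
            proof (cases rj')
              case None
              then show ?thesis using rj' j0 by (auto simp: set_stations)
            next
              case (Some j)
              then have j: "j \<in> {1..n}" "capacity S j < 0" "capacity X j < min (capacity S j + int n * int M) 0"
                using rj' by (auto simp: set_stations)
              from move[OF i j disjI2[OF no]] show ?thesis using Some by simp
            qed
          qed (simp_all add: length_stations)
        qed
      qed (simp add: length_stations)
    qed
  qed (simp add: length_stations step_time_def)
qed

lemma dock_loop_2_spec:
  assumes inv: "inv s r" and loc: "loc s = Dock_Loop_2"
  shows "spec (dock_loop_2 s) (\<lambda>s'. \<exists>r'<r. inv s' r') step_time"
proof -
  let ?a = "scale s"
  let ?Q = "\<lambda>s'. \<exists>r'<r. inv s' r'"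
  obtain q where ph: "in_phase s" and di: "dock_inv second_rollback ?a (snapshot s) (current s) q"
    and r: "later_steps s + 2 + R0 + q \<le> r"
    using inv loc by (auto simp: inv_def)
  have a: "1 \<le> ?a" by (rule in_phase_scale[OF ph])
  interpret multimodular_stations n "f ?a" by (rule rescaled_stations[OF a])
  obtain S X where S: "snapshot s = embed ?a S" and X: "current s = embed ?a X" and balS: "balanced n S"
    and near: "near_path (int z div ?a) (capacity S)" and bo: "bike_optimal X"
    and roll: "second_rollback n (int M) (capacity S) (capacity X) q"
    using di unfolding dock_inv_def by blast
  have M0: "0 \<le> int M" by simp
  have sumS: "(\<Sum>k\<in>{1..n}. capacity S k) = 0" by (rule sum_capacity[OF balS])
  have sumX: "(\<Sum>k\<in>{1..n}. capacity X k) = 0" using bo sum_capacity by (auto simp: bike_optimal_def)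
  have bound: "bound s = int M * ?a" using ph by (simp add: in_phase_def)
  have radius: "int n * (int M * ?a) = (int n * int M) * ?a" by simp
  have move: "spec (best_dock_move i j s) ?Q move_time"
    if j: "j \<in> {1..n}" "capacity S j < 0" "capacity X j < min (capacity S j + int M) 0"
      and i: "i \<in> {1..n}" "0 \<le> capacity S i" "max (capacity S i - int n * int M) 0 < capacity X i" for i j
  proof -
    have step: "0 < q \<and> second_rollback n (int M) (capacity S) (transfer i j (capacity X)) (q - 1)"
      by (rule second_rollback_step[OF roll M0 j i])
    have "0 < capacity X i" "capacity X j < 0" using i j by auto
    note move = rollback_move_spec[where roll = second_rollback and q = q, OF ph S X balS near bo i(1) this(1) j(1) this(2) step]
    show ?thesis
    proof (rule spec_weaken[OF move])
      fix s' assume "loc s' = loc s \<and> in_phase s' \<and> later_steps s' = later_steps s \<and>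
        dock_inv second_rollback (scale s') (snapshot s') (current s') (q - 1)"
      then have "inv s' (later_steps s + 2 + R0 + (q - 1))" using loc by (auto simp: inv_def)
      then show "?Q s'" using r step by (intro exI[of _ "later_steps s + 2 + R0 + (q - 1)"]) auto
    qed simp
  qed
  show ?thesis unfolding dock_loop_2_def bound radius
  proof (rule spec_bind[OF spec_pick[OF deficit_spec[OF a S X]], where t = "8 * n + 1 + move_time"])
    fix rj assume rj: "case rj of
        None \<Rightarrow> \<forall>j\<in>set stations. \<not> (capacity S j < 0 \<and> capacity X j < min (capacity S j + int M) 0)
      | Some j \<Rightarrow> j \<in> set stations \<and> capacity S j < 0 \<and> capacity X j < min (capacity S j + int M) 0"
    show "spec (case rj of
       None \<Rightarrow> ret (s\<lparr>loc := Descent\<rparr>)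
     | Some j \<Rightarrow> do {
         radius \<leftarrow> ops 1 (int n * int M * ?a);
         ri \<leftarrow> pick (surplus_station s radius) stations;
         case ri of
           Some i \<Rightarrow> best_dock_move i j s
         | None \<Rightarrow> stuck
       }) ?Q (8 * n + 1 + move_time)"
    proof (cases rj)
      case None
      then have "\<forall>j\<in>{1..n}. \<not> (capacity S j < 0 \<and> capacity X j < min (capacity S j + int M) 0)"
        using rj by (simp only: option.case set_stations)
      then have no: "\<And>j. j \<in> {1..n} \<Longrightarrow> capacity S j < 0 \<Longrightarrow> min (capacity S j + int M) 0 \<le> capacity X j"
        by (meson not_le)
      have "descending (int z div ?a) (capacity X) R0"
        using descending_init[OF near roll n_pos no] unfolding descent_bound_def R0_def .
      then have "descent_inv ?a (current s) R0" unfolding descent_inv_def using X bo by blast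
      then have "inv (s\<lparr>loc := Descent\<rparr>) (later_steps s + 1 + R0)"
        using ph by (auto simp: inv_def in_phase_def later_steps_def)
      then have "?Q (s\<lparr>loc := Descent\<rparr>)" using r by (intro exI[of _ "later_steps s + 1 + R0"]) auto
      then show ?thesis using None by (auto intro: spec_ops)
    next
      case (Some j)
      then have j: "j \<in> {1..n}" "capacity S j < 0" "capacity X j < min (capacity S j + int M) 0"
        using rj by (auto simp: set_stations)
      obtain i0 where i0: "i0 \<in> {1..n}" "0 \<le> capacity S i0" "max (capacity S i0 - int n * int M) 0 < capacity X i0"
        using second_rollback_not_stuck[OF roll M0 sumS sumX j] by blast
      show ?thesis unfolding Some option.case
      proof (rule spec_bind_ops[where t = "8 * n + move_time"],
          rule spec_bind[OF spec_pick[OF surplus_spec[OF a S X]], where t = move_time])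
        fix ri assume ri: "case ri of
            None \<Rightarrow> \<forall>i\<in>set stations. \<not> (0 \<le> capacity S i \<and> max (capacity S i - int n * int M) 0 < capacity X i)
          | Some i \<Rightarrow> i \<in> set stations \<and> 0 \<le> capacity S i \<and> max (capacity S i - int n * int M) 0 < capacity X i"
        show "spec (case ri of None \<Rightarrow> stuck | Some i \<Rightarrow> best_dock_move i j s) ?Q move_time"
        proof (cases ri)
          case None
          then show ?thesis using ri i0 by (auto simp: set_stations)
        next
          case (Some i)
          then have i: "i \<in> {1..n}" "0 \<le> capacity S i" "max (capacity S i - int n * int M) 0 < capacity X i"
            using ri by (auto simp: set_stations)
          from move[OF j i] show ?thesis using Some by simp
        qed
      qed (simp_all add: length_stations)
    qed
  qed (simp add: length_stations step_time_def)
qed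

lemma distance_bound_iff:
  assumes "1 \<le> (a::int)" "even N"
  shows "real_of_int (a * N) / 2 \<le> real z \<longleftrightarrow> N \<le> 2 * (int z div a)"
proof -
  obtain h where h: "N = 2 * h" using assms(2) by blast
  have "real_of_int (a * N) / 2 = real_of_int (a * h)" by (simp add: h)
  also have "real_of_int (a * h) \<le> real z \<longleftrightarrow> a * h \<le> int z" by linarith
  also have "\<dots> \<longleftrightarrow> h \<le> int z div a"
  proof
    assume "a * h \<le> int z"
    then have "(a * h) div a \<le> int z div a" using assms(1) by (intro zdiv_mono1) auto
    then show "h \<le> int z div a" using assms(1) by simp
  next
    assume "h \<le> int z div a"
    then have "a * h \<le> a * (int z div a)" using assms(1) by (intro mult_left_mono) auto
    also have "\<dots> \<le> int z" using mult_div_mod_eq[of a "int z"] assms(1) pos_mod_sign[of a "int z"] by linarith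
    finally show "a * h \<le> int z" .
  qed
  finally show ?thesis by (simp add: h)
qed

lemma descent_step_spec:
  assumes inv: "inv s r" and loc: "loc s = Descent"
  shows "spec (descent_step s) (\<lambda>s'. \<exists>r'<r. inv s' r') step_time"
proof -
  let ?a = "scale s"
  let ?Q = "\<lambda>s'. \<exists>r'<r. inv s' r'"
  obtain q where ph: "in_phase s" and di: "descent_inv ?a (current s) q"
    and r: "later_steps s + 1 + q \<le> r"
    using inv loc by (auto simp: inv_def)
  have a: "1 \<le> ?a" by (rule in_phase_scale[OF ph])
  interpret multimodular_stations n "f ?a" by (rule rescaled_stations[OF a])
  let ?N = "int z div ?a"
  obtain X where X: "current s = embed ?a X" and bo: "bike_optimal X"
    and desc: "descending ?N (capacity X) q"
    using di unfolding descent_inv_def by blast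
  have bal: "balanced n X" and fin: "F X < \<infinity>" and dX: "dock_cost (capacity X) = F X"
    using bo by (auto simp: bike_optimal_def)
  have normX: "norm1 {1..n} (capacity X) \<le> 2 * ?N" by (rule descending_norm1[OF desc])
  let ?end = "s\<lparr>loc := Phase_Start, phase := phase s + 1\<rparr>"
  have end_phase: "spec (ops 1 ?end) ?Q 1" if "phase_opt ?a (current s)"
  proof (rule spec_ops)
    have "inv ?end (later_steps s)"
      using ph that by (auto simp: inv_def in_phase_def later_steps_def)
    then show "?Q ?end" using r by (intro exI[of _ "later_steps s"]) auto
  qed simp
  have opt_min: "phase_opt ?a (current s)" if "is_min dock_cost (capacity X)"
  proof -
    have "optimal 0 X" using bo that by (simp add: optimal_iff)
    then show ?thesis unfolding phase_opt_def using X normX by blast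
  qed
  let ?try = "\<lambda>m new. do {
         old \<leftarrow> eval_objective (current s);
         a' \<leftarrow> ops 8 (apply_move ?a m (current s));
         dist \<leftarrow> ops (5 * n) (dock_distance a');
         continue \<leftarrow> ops 4 (new < old \<and> real_of_int dist / 2 \<le> real z);
         if continue then ret (s\<lparr>current := a'\<rparr>) else ops 1 ?end
       }"
  have cont: "spec (?try m new) ?Q (7 * n + 13)"
    if m: "m \<in> set all_moves" and new: "new = objective n c (apply_move ?a m (current s))"
      and best: "\<forall>m'\<in>set all_moves. objective n c (apply_move ?a m (current s)) \<le> objective n c (apply_move ?a m' (current s))"
    for m new
  proof (rule spec_bind[OF spec_eval_objective, where t = "5 * n + 13"])
    fix old assume old: "old = objective n c (current s)"
    let ?X' = "apply_move 1 m X"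
    obtain i j where ij: "i \<in> {1..n}" "j \<in> {1..n}" "i \<noteq> j" and mij: "m \<in> moves n i j"
      using m unfolding set_all_moves by blast
    have A': "apply_move ?a m' (current s) = embed ?a (apply_move 1 m' X)" for m'
      unfolding X by (rule apply_move_embed)
    have best': "F (apply_move 1 m X) \<le> F (apply_move 1 m' X)"
      if "p \<in> {1..n}" "t \<in> {1..n}" "p \<noteq> t" "m' \<in> moves n p t" for p t m'
    proof -
      have "m' \<in> set all_moves" unfolding set_all_moves using that by blast
      then show ?thesis using best unfolding A' objective_embed by blast
    qed
    have bm: "best_transfer {1..n} dock_cost (capacity X) i j"
      "F ?X' = dock_cost (transfer i j (capacity X))"
      "capacity ?X' = transfer i j (capacity X)"
      "F ?X' < \<infinity> \<Longrightarrow> bike_optimal ?X'"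
      using best_move_best_transfer[OF bo ij mij] best' by blast+
    have new': "new = F ?X'" unfolding new A' objective_embed ..
    have old': "old = F X" unfolding old X objective_embed ..
    have balX': "balanced n ?X'"
      using balanced_plus[OF bal balanced_move_vec[OF ij(1,2) mij, of 1]] unfolding plus_move_vec .
    have dist: "real_of_int (dock_distance (embed ?a ?X')) / 2 \<le> real z \<longleftrightarrow> norm1 {1..n} (capacity ?X') \<le> 2 * ?N"
      using dock_distance_embed[of ?a ?X'] distance_bound_iff[OF a even_norm1[OF sum_capacity[OF balX']]] a by simp
    have result: "spec (if new < old \<and> real_of_int (dock_distance (embed ?a ?X')) / 2 \<le> real z
        then ops 0 (s\<lparr>current := embed ?a ?X'\<rparr>) else ops 1 ?end) ?Q 1"
    proof (cases "new < old")
      case False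
      then have "F X \<le> F ?X'" by (simp add: old' new')
      then have le: "dock_cost (capacity X) \<le> dock_cost (transfer i j (capacity X))"
        using bm(2) dX by simp
      have "dock_cost (capacity X) \<le> dock_cost (transfer p t (capacity X))"
        if "p \<in> {1..n}" "t \<in> {1..n}" "p \<noteq> t" for p t
      proof (rule order_trans[OF le])
        show "dock_cost (transfer i j (capacity X)) \<le> dock_cost (transfer p t (capacity X))"
          using bm(1) that unfolding best_transfer_def by blast
      qed
      then have "is_min dock_cost (capacity X)"
        using fin dX by (intro docks.local_min_imp_is_min) auto
      then show ?thesis using False end_phase[OF opt_min] by simp
    next
      case True
      then have less: "dock_cost (transfer i j (capacity X)) < dock_cost (capacity X)"
        using bm(2) dX by (simp add: old' new')
      have dfin: "dock_cost (capacity X) < \<infinity>" using dX fin by simp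
      have finX': "F ?X' < \<infinity>" using True fin unfolding old' new' by (rule less_trans)
      note step = descending_step[OF desc dfin bm(1) less]
      show ?thesis
      proof (cases "norm1 {1..n} (capacity ?X') \<le> 2 * ?N")
        case le: True
        then have *: "0 < q" "descending ?N (capacity ?X') (q - 1)" using step(1) unfolding bm(3) by blast+
        let ?s = "s\<lparr>current := embed ?a ?X'\<rparr>"
        have "descent_inv ?a (embed ?a ?X') (q - 1)" unfolding descent_inv_def using bm(4)[OF finX'] * by blast
        then have "inv ?s (later_steps s + 1 + (q - 1))"
          using ph loc by (auto simp: inv_def in_phase_def later_steps_def)
        then have "?Q ?s" using r *(1) by (intro exI[of _ "later_steps s + 1 + (q - 1)"]) auto
        then show ?thesis using True le dist by (auto intro: spec_ops)
      next
        case False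
        then obtain \<mu> where mu: "0 < \<mu>" "is_min (docks.penalized \<mu>) (capacity X)" "2 * ?N \<le> norm1 {1..n} (capacity X)"
          using step(2) unfolding bm(3) by force
        have "optimal \<mu> X" using bo mu by (simp add: optimal_iff)
        then have "phase_opt ?a (current s)"
          unfolding phase_opt_def using X normX mu by (intro exI[of _ X] exI[of _ \<mu>]) auto
        then show ?thesis using False dist end_phase by simp
      qed
    qed
    show "spec (do {
         a' \<leftarrow> ops 8 (apply_move ?a m (current s));
         dist \<leftarrow> ops (5 * n) (dock_distance a');
         continue \<leftarrow> ops 4 (new < old \<and> real_of_int dist / 2 \<le> real z);
         if continue then ret (s\<lparr>current := a'\<rparr>) else ops 1 ?end
       }) ?Q (5 * n + 13)"
      unfolding A'
      by (rule spec_bind_ops[where t = "5 * n + 5"], rule spec_bind_ops[where t = 5],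
          rule spec_bind_ops[where t = 1]) (use result in auto)
  qed simp
  have time: "length all_moves * (2 * n + 8 + 2) + (7 * n + 13) \<le> step_time"
  proof -
    have eq: "2 * n + 8 + 2 = 2 * n + 10" by simp
    have "length all_moves * (2 * n + 8 + 2) \<le> n * (n * (2 * n + 2)) * (2 * n + 10)"
      unfolding eq by (rule mult_right_mono[OF length_all_moves]) simp
    from add_right_mono[OF this, of "7 * n + 13"] show ?thesis
      unfolding step_time_def by (rule trans_le_add2[OF ord_le_eq_trans]) (simp only: add.assoc)
  qed
  show ?thesis unfolding descent_step_def Let_def
  proof (rule spec_bind[OF spec_scan_min[OF spec_eval_move] _ time])
    fix rm assume rm: "case rm of None \<Rightarrow> all_moves = []
      | Some (m, v) \<Rightarrow> m \<in> set all_moves \<and> v = objective n c (apply_move ?a m (current s)) \<and>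
         (\<forall>m'\<in>set all_moves. objective n c (apply_move ?a m (current s)) \<le> objective n c (apply_move ?a m' (current s)))"
    show "spec (case rm of
       None \<Rightarrow> ops 1 ?end
     | Some (m, new) \<Rightarrow> ?try m new) ?Q (7 * n + 13)"
    proof (cases rm)
      case None
      then have empty: "set all_moves = {}" using rm by simp
      have False if "i \<in> {1..n}" "j \<in> {1..n}" "i \<noteq> j" for i j
        using empty that unfolding set_all_moves by (force simp: moves_def)
      then have "is_min dock_cost (capacity X)"
        using fin dX by (intro docks.local_min_imp_is_min) auto
      then show ?thesis using None spec_weaken[OF end_phase[OF opt_min]] by simp
    next
      case (Some mv)
      then show ?thesis using rm cont by (cases mv) auto
    qed
  qed
qed

lemma advance_spec:
  assumes "inv s r" "loc s \<noteq> Halted"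
  shows "spec (advance s) (\<lambda>s'. \<exists>r'<r. inv s' r') step_time"
  using assms start_phase_spec bike_step_spec dock_loop_1_spec dock_loop_2_spec descent_step_spec
  by (cases "loc s") auto

definition total_steps :: nat where
  "total_steps = (L + 1) * phase_steps + 1"

text \<open>
  The elapsed time plus the worst-case time of the remaining steps never increases.
\<close>

lemma reaches_inv:
  "reaches T s \<Longrightarrow> \<exists>r. inv s r \<and> T + r * (step_time + 1) \<le> 2 * n + total_steps * (step_time + 1)"
proof (induction rule: reaches.induct)
  case start
  have "inv initial total_steps"
    using phase_opt_initial by (simp add: inv_def initial_def total_steps_def)
  then show ?case by (intro exI[of _ total_steps]) simp
next
  case (step T s s' t)
  then obtain r where r: "inv s r" "T + r * (step_time + 1) \<le> 2 * n + total_steps * (step_time + 1)" by blast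
  have "loc s \<noteq> Halted" using step.hyps(2) by (auto simp: stuck_def)
  from advance_spec[OF r(1) this] step.hyps(2) obtain r' where r': "r' < r" "inv s' r'" "t \<le> step_time"
    unfolding spec_def by blast
  have "Suc r' * (step_time + 1) \<le> r * (step_time + 1)" using r'(1) by (intro mult_right_mono) auto
  then have "Suc (T + t) + r' * (step_time + 1) \<le> 2 * n + total_steps * (step_time + 1)" using r' r(2) by simp
  then show ?case using r'(2) by blast
qed

lemma runs_within_total_steps:
  assumes "real (2 * n + total_steps * (step_time + 1)) \<le> tmax"
  shows "runs_within tmax"
  unfolding runs_within_def
proof (intro allI impI conjI)
  fix T s assume "reaches T s"
  then obtain r where r: "inv s r" "T + r * (step_time + 1) \<le> 2 * n + total_steps * (step_time + 1)"
    using reaches_inv by blast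
  then have "T \<le> 2 * n + total_steps * (step_time + 1)" by simp
  then have "real T \<le> real (2 * n + total_steps * (step_time + 1))" by (simp only: of_nat_le_iff)
  then show "real T \<le> tmax" using assms by linarith
  show "loc s = Halted \<or> outcomes (advance s) \<noteq> {}"
    using advance_spec[OF r(1)] by (auto simp: spec_def)
qed

end

section \<open>The polynomial bound\<close>

definition is_poly2 :: "(real \<Rightarrow> real \<Rightarrow> real) \<Rightarrow> bool" where
  "is_poly2 g \<longleftrightarrow> (\<exists>P. \<forall>x y. poly2 P x y = g x y)"

lemma is_poly2_const: "is_poly2 (\<lambda>x y. a)"
  unfolding is_poly2_def by (rule exI[of _ "[:[:a:]:]"]) (simp add: poly2_def)

lemma is_poly2_fst: "is_poly2 (\<lambda>x y. x)"
  unfolding is_poly2_def by (rule exI[of _ "[:0, 1:]"]) (simp add: poly2_def)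

lemma is_poly2_snd: "is_poly2 (\<lambda>x y. y)"
  unfolding is_poly2_def by (rule exI[of _ "[:[:0, 1:]:]"]) (simp add: poly2_def)

lemma is_poly2_add:
  assumes "is_poly2 g" "is_poly2 h"
  shows "is_poly2 (\<lambda>x y. g x y + h x y)"
proof -
  obtain P Q where "\<forall>x y. poly2 P x y = g x y" "\<forall>x y. poly2 Q x y = h x y"
    using assms by (auto simp: is_poly2_def)
  then show ?thesis unfolding is_poly2_def by (intro exI[of _ "P + Q"]) (simp add: poly2_def)
qed

lemma is_poly2_mult:
  assumes "is_poly2 g" "is_poly2 h"
  shows "is_poly2 (\<lambda>x y. g x y * h x y)"
proof -
  obtain P Q where "\<forall>x y. poly2 P x y = g x y" "\<forall>x y. poly2 Q x y = h x y"
    using assms by (auto simp: is_poly2_def)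
  then show ?thesis unfolding is_poly2_def by (intro exI[of _ "P * Q"]) (simp add: poly2_def)
qed

lemma is_poly2_power: "is_poly2 g \<Longrightarrow> is_poly2 (\<lambda>x y. g x y ^ m)"
  by (induction m) (auto intro: is_poly2_const is_poly2_mult)

lemmas is_poly2_intros =
  is_poly2_const is_poly2_fst is_poly2_snd is_poly2_add is_poly2_mult is_poly2_power

text \<open>The bound of \<open>runs_within_total_steps\<close>, with \<open>y + 1\<close> instead of \<open>last_phase\<close>.\<close>

definition time_bound :: "real \<Rightarrow> real \<Rightarrow> real" where
  "time_bound x y = 2 * x +
     ((y + 2) * (5 + (x ^ 2 + 1) * (16 * x ^ 6 * (x + 4)) + 2 * (x * (16 * x ^ 6 * (x + 4))) + x) + 1) *
     ((3 * (y + 2) + 10) + (16 * x + 17) + (24 * x + 1 + ((2 * x + 2) * (2 * x + 10) + 8)) +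
       (x * (x * (2 * x + 2)) * (2 * x + 10) + 7 * x + 13) + 1)"

lemma is_poly2_time_bound: "is_poly2 time_bound"
  unfolding time_bound_def[abs_def] by (intro is_poly2_intros)

lemma (in scaling_run) runs_within_time_bound:
  "runs_within (time_bound (real n) (log 2 (real (B + D))))"
proof (rule runs_within_total_steps)
  let ?y = "log 2 (real (B + D))"
  have "0 \<le> ?y" using total by simp
  then have L: "real (L + 1) \<le> ?y + 2" by (simp add: last_phase_def)
  have steps: "real total_steps \<le> (?y + 2) * real phase_steps + 1"
    unfolding total_steps_def of_nat_add of_nat_mult using mult_right_mono[OF L, of "real phase_steps"] by simp
  have time: "real (step_time + 1) \<le> (3 * (?y + 2) + 10) + (16 * real n + 17) + (24 * real n + 1 + real move_time) +
     (real n * (real n * (2 * real n + 2)) * (2 * real n + 10) + 7 * real n + 13) + 1"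
    using L unfolding step_time_def of_nat_add of_nat_mult of_nat_numeral of_nat_1
    by (intro add_right_mono mult_left_mono) auto
  have "real phase_steps = 5 + (real n ^ 2 + 1) * (16 * real n ^ 6 * (real n + 4)) +
      2 * (real n * (16 * real n ^ 6 * (real n + 4))) + real n"
    by (simp add: phase_steps_def R0_def rollback_def)
  moreover have "real move_time = (2 * real n + 2) * (2 * real n + 10) + 8"
    unfolding move_time_def of_nat_add of_nat_mult of_nat_numeral ..
  ultimately have "time_bound (real n) ?y = 2 * real n + ((?y + 2) * real phase_steps + 1) *
    ((3 * (?y + 2) + 10) + (16 * real n + 17) + (24 * real n + 1 + real move_time) +
     (real n * (real n * (2 * real n + 2)) * (2 * real n + 10) + 7 * real n + 13) + 1)"
    unfolding time_bound_def by simp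
  moreover have "real total_steps * real (step_time + 1) \<le> ((?y + 2) * real phase_steps + 1) *
    ((3 * (?y + 2) + 10) + (16 * real n + 17) + (24 * real n + 1 + real move_time) +
     (real n * (real n * (2 * real n + 2)) * (2 * real n + 10) + 7 * real n + 13) + 1)"
    using steps time \<open>0 \<le> ?y\<close> by (intro mult_mono) auto
  moreover have "real (2 * n + total_steps * (step_time + 1)) = 2 * real n + real total_steps * real (step_time + 1)"
    by simp
  ultimately show "real (2 * n + total_steps * (step_time + 1)) \<le> time_bound (real n) ?y" by linarith
qed

theorem theorem3:
  shows "\<exists>P :: real poly poly.
    \<forall>(n :: nat) (D :: nat) (B :: nat)
     (p :: nat \<Rightarrow> int list pmf) (l :: nat \<Rightarrow> nat) (u :: nat \<Rightarrow> nat) (depot :: nat option)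
     (dbar :: nat \<Rightarrow> int) (bbar :: nat \<Rightarrow> int) (z :: nat).
      B + D \<ge> 1 \<longrightarrow>
      (\<forall>i\<in>{1..n}. set_pmf (p i) \<subseteq> {X. set X \<subseteq> {-1, 1}} \<and> l i \<le> u i) \<longrightarrow>
      is_allocation n D B (dbar, bbar) \<longrightarrow>
      objective n (station_cost p l u depot) (dbar, bbar) < \<infinity> \<longrightarrow>
      scaling_algorithm.runs_within n D B (station_cost p l u depot) dbar bbar z
        (poly2 P (real n) (log 2 (real (B + D))))"
proof -
  obtain P where P: "\<And>x y. poly2 P x y = time_bound x y"
    using is_poly2_time_bound unfolding is_poly2_def by blast
  show ?thesis
  proof (rule exI[of _ P], intro allI impI)
    fix n D B :: nat and p :: "nat \<Rightarrow> int list pmf" and l u :: "nat \<Rightarrow> nat" and depot :: "nat option"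
      and dbar bbar :: "nat \<Rightarrow> int" and z :: nat
    assume total: "B + D \<ge> 1" and seqs: "\<forall>i\<in>{1..n}. set_pmf (p i) \<subseteq> {X. set X \<subseteq> {-1, 1}} \<and> l i \<le> u i"
      and alloc: "is_allocation n D B (dbar, bbar)"
      and fin: "objective n (station_cost p l u depot) (dbar, bbar) < \<infinity>"
    interpret scaling_run n D B "station_cost p l u depot" dbar bbar z
    proof (rule scaling_run.intro)
      show "multimodular_stations n (rescaled (station_cost p l u depot) dbar bbar a)" if "1 \<le> a" for a
        by (rule rescaled_station_cost[OF _ fin that]) (use seqs in blast)
      show "0 \<le> d \<and> 0 \<le> b" if "station_cost p l u depot k d b < \<infinity>" for k d b
        using station_cost_finiteD[OF that] by blast
    qed (fact total alloc)+
    show "scaling_algorithm.runs_within n D B (station_cost p l u depot) dbar bbar z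
        (poly2 P (real n) (log 2 (real (B + D))))"
      unfolding P by (rule runs_within_time_bound)
  qed
qed

end
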